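(* For all $P_1,P_2,N>0$ and $\sigma_2^2\ge0$, $$\mathcal C_{\mathrm{MAC}}(P_1,P_2,N)\subsetneq\mathcal C_{\mathrm{NoisyPartialFB}}(P_1,P_2,N,\sigma_2^2),$$ i.e., the inclusion holds and is strict.
   Context: Channel model (noisy partial feedback). Fix $P_1,P_2,N>0$ and $\sigma_2^2\ge0$. Messages $M_1,M_2$ are independent and uniform on finite sets $\mathcal M_1,\mathcal M_2$. $\{Z_t\}$ is IID $\mathcal N(0,N)$, $\{W_{2,t}\}$ is IID $\mathcal N(0,\sigma_2^2)$, and $M_1,M_2,\{Z_t\},\{W_{2,t}\}$ are mutually independent. The output is $Y_t=X_{1,t}+X_{2,t}+Z_t$. Transmitter 1 has no feedback: $X_{1,t}=\varphi_{1,t}(M_1)$. Transmitter 2 observes causally $V_{2,t}=Y_t+W_{2,t}$: $X_{2,t}=\varphi_{2,t}(M_2,V_{2,1},\dots,V_{2,t-1})$. Encoders must satisfy $\frac1n\sum_{t=1}^n\mathbb E[X_{\nu,t}^2]\le P_\nu$, and the decoder is $\phi:\mathbb R^n\to\mathcal M_1\times\mathcal M_2$. Achievability of $(R_1,R_2)$: for every $\delta>0$ and all sufficiently large $n$ there is a blocklength-$n$ code with $\frac1n\log|\mathcal M_\nu|>R_\nu-\delta$ and error probability $\Pr[\phi(Y^n)\neq(M_1,M_2)]\to0$ as $n\to\infty$. $\mathcal C_{\mathrm{NoisyPartialFB}}(P_1,P_2,N,\sigma_2^2)$ is the set of achievable pairs. The no-feedback capacity region $\mathcal C_{\mathrm{MAC}}(P_1,P_2,N)$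 is the set of nonnegative $(R_1,R_2)$ with $R_1\le\frac12\log(1+\frac{P_1}{N})$, $R_2\le\frac12\log(1+\frac{P_2}{N})$, $R_1+R_2\le\frac12\log(1+\frac{P_1+P_2}{N})$. *)

theory Defs
  imports "HOL-Probability.Probability"
begin

text \<open>A blocklength code for the two-user Gaussian MAC with noisy partial feedback
to transmitter 2. Messages are M1 in {0..<nmsg1}, M2 in {0..<nmsg2}; time indices
are 0..n-1. enc2 t m v receives the feedback prefix v = (V_2,0..V_2,t-1) as a
function restricted (extensional) to {..<t}.\<close>

record fbcode =
  nmsg1 :: nat
  nmsg2 :: nat
  enc1 :: "nat \<Rightarrow> nat \<Rightarrow> real"
  enc2 :: "nat \<Rightarrow> nat \<Rightarrow> (nat \<Rightarrow> real) \<Rightarrow> real"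
  dec  :: "(nat \<Rightarrow> real) \<Rightarrow> nat \<times> nat"

text \<open>Channel output prefix (Y_0..Y_{t-1}), as a function extensional on {..<t}.
Noise: Z_t = sqrt N * g t, W_2t = sqrt s * h t with g, h IID standard normal.\<close>

fun chan_out :: "fbcode \<Rightarrow> real \<Rightarrow> real \<Rightarrow> nat \<Rightarrow> nat \<Rightarrow> (nat \<Rightarrow> real) \<Rightarrow> (nat \<Rightarrow> real)
    \<Rightarrow> nat \<Rightarrow> (nat \<Rightarrow> real)" where
  "chan_out c N s m1 m2 g h 0 = restrict (\<lambda>_. 0) {..<0}"
| "chan_out c N s m1 m2 g h (Suc t) =
     (let y = chan_out c N s m1 m2 g h t;
          v = restrict (\<lambda>i. y i + sqrt s * h i) {..<t}
      in y(t := enc1 c t m1 + enc2 c t m2 v + sqrt N * g t))"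

definition input2 :: "fbcode \<Rightarrow> real \<Rightarrow> real \<Rightarrow> nat \<Rightarrow> nat \<Rightarrow> (nat \<Rightarrow> real) \<Rightarrow> (nat \<Rightarrow> real)
    \<Rightarrow> nat \<Rightarrow> real" where
  "input2 c N s m1 m2 g h t =
     enc2 c t m2 (restrict (\<lambda>i. chan_out c N s m1 m2 g h t i + sqrt s * h i) {..<t})"

definition noise_space :: "nat \<Rightarrow> (nat \<Rightarrow> real) measure" where
  "noise_space n = PiM {..<n} (\<lambda>_. density lborel std_normal_density)"

definition code_space :: "fbcode \<Rightarrow> nat \<Rightarrow> ((nat \<times> nat) \<times> ((nat \<Rightarrow> real) \<times> (nat \<Rightarrow> real))) measure" where
  "code_space c n =
     uniform_measure (count_space UNIV) ({..<nmsg1 c} \<times> {..<nmsg2 c})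
       \<Otimes>\<^sub>M (noise_space n \<Otimes>\<^sub>M noise_space n)"

definition err_prob :: "fbcode \<Rightarrow> real \<Rightarrow> real \<Rightarrow> nat \<Rightarrow> real" where
  "err_prob c N s n = measure (code_space c n)
     {\<omega> \<in> space (code_space c n).
        dec c (chan_out c N s (fst (fst \<omega>)) (snd (fst \<omega>)) (fst (snd \<omega>)) (snd (snd \<omega>)) n)
          \<noteq> fst \<omega>}"

definition valid_code :: "fbcode \<Rightarrow> nat \<Rightarrow> real \<Rightarrow> real \<Rightarrow> real \<Rightarrow> real \<Rightarrow> bool" where
  "valid_code c n P1 P2 N s \<longleftrightarrow>
     nmsg1 c \<ge> 1 \<and> nmsg2 c \<ge> 1 \<and>
     (\<forall>t<n. \<forall>m. enc2 c t m \<in> borel_measurable (PiM {..<t} (\<lambda>_. borel))) \<and>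
     dec c \<in> measurable (PiM {..<n} (\<lambda>_. borel)) (count_space UNIV) \<and>
     (\<Sum>t<n. \<integral>\<^sup>+ \<omega>. ennreal ((enc1 c t (fst (fst \<omega>)))\<^sup>2) \<partial>code_space c n)
        \<le> ennreal (real n * P1) \<and>
     (\<Sum>t<n. \<integral>\<^sup>+ \<omega>. ennreal ((input2 c N s (fst (fst \<omega>)) (snd (fst \<omega>))
                                   (fst (snd \<omega>)) (snd (snd \<omega>)) t)\<^sup>2) \<partial>code_space c n)
        \<le> ennreal (real n * P2)"

definition achievable_fb :: "real \<Rightarrow> real \<Rightarrow> real \<Rightarrow> real \<Rightarrow> real \<Rightarrow> real \<Rightarrow> bool" where
  "achievable_fb P1 P2 N s R1 R2 \<longleftrightarrow>
     (\<forall>\<delta>>0. \<exists>C :: nat \<Rightarrow> fbcode.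
        (\<forall>\<^sub>F n in sequentially. valid_code (C n) n P1 P2 N s \<and>
            ln (real (nmsg1 (C n))) / real n > R1 - \<delta> \<and>
            ln (real (nmsg2 (C n))) / real n > R2 - \<delta>) \<and>
        (\<lambda>n. err_prob (C n) N s n) \<longlonglongrightarrow> 0)"

definition C_NoisyPartialFB :: "real \<Rightarrow> real \<Rightarrow> real \<Rightarrow> real \<Rightarrow> (real \<times> real) set" where
  "C_NoisyPartialFB P1 P2 N s =
     {(R1, R2). R1 \<ge> 0 \<and> R2 \<ge> 0 \<and> achievable_fb P1 P2 N s R1 R2}"

definition C_MAC :: "real \<Rightarrow> real \<Rightarrow> real \<Rightarrow> (real \<times> real) set" where
  "C_MAC P1 P2 N =
     {(R1, R2). R1 \<ge> 0 \<and> R2 \<ge> 0 \<and>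
        R1 \<le> 1/2 * ln (1 + P1 / N) \<and> R2 \<le> 1/2 * ln (1 + P2 / N) \<and>
        R1 + R2 \<le> 1/2 * ln (1 + (P1 + P2) / N)}"

end

theory Submission
  imports Defs
begin

text \<open>
  The time axis is cut into blocks of two channel uses. In the first use the transmitters send
  independent Gaussian symbols \<open>u\<close> and \<open>v\<close>; in the second use each adds a multiple of its old symbol
  to a fresh one, with opposite correlations chosen so that the two received sums are uncorrelated,
  and transmitter 2 moreover adds \<open>\<alpha>\<close> times its feedback of the first use. The receiver cancels
  \<open>\<alpha> y\<close>, which leaves a channel without feedback whose second noise has variance
  \<open>N + \<alpha>\<^sup>2 s\<close>. Because the old symbol of transmitter 2 enters the second use with negative sign,
  the feedback term lowers its energy at first order in \<open>\<alpha>\<close>, while noise and energy increase only at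
  second order; so a small \<open>\<alpha> > 0\<close> raises the sum rate. For \<open>\<alpha> = 0\<close> and uncorrelated
  uses the scheme reaches the whole region without feedback.

  Achievability is random coding with a threshold decoder. Its three scores are likelihood ratios, which
  integrate to 1 against an independent codeword, so wrong messages are handled by Markov's inequality;
  the true message and the energies are handled by Chernoff bounds for sums of squares of linear
  forms in independent normals.
\<close>

section \<open>Gaussian integrals\<close>

text \<open>Correlating the slots costs no sum rate by itself. The second-slot coefficients
  \<open>(b1, b2)\<close> of the old symbols are \<kappa> times \<open>(-a2, a1)\<close>, orthogonal
  to \<open>(a1, a2)\<close>, so the two noiseless sums are independent Gaussians and the likelihood
  ratio of a codeword pair factors over the slots. The energies \<kappa>^2 a2^2 and \<kappa>^2 a1^2
  spent on old symbols reappear in full in the variance of the second sum. A first-order saving in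
  \<alpha> is therefore a net gain, whatever the feedback noise variance.

  The power constraint shapes the rest. It concerns the mean energy of one fixed codebook, and the
  input of transmitter 2 contains channel noise, so energy must be controlled on atypical events
  too. Hence \<open>penalty\<close> has two roles: it is at least 1 whenever the true pair fails a
  threshold, and a multiple of it bounds the excess energy of each user. One averaging step selects
  a codebook with small mean of error indicator plus \<open>penalty\<close>.\<close>

abbreviation std_normal :: "real measure" where
  "std_normal \<equiv> density lborel (\<lambda>x. ennreal (std_normal_density x))"

lemma prob_space_std_normal: "prob_space std_normal"
  using prob_space_normal_density[of 1 0] by simp

lemma sets_std_normal [measurable_cong]: "sets std_normal = sets borel"
  by simp

text \<open>Completing the square: with \<open>D = 1 - 2 * p\<close> the integrand is a constant
  times the normal density of mean \<open>q / D\<close> and variance \<open>1 / D\<close>.\<close>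

lemma std_normal_exp_quadratic:
  fixes p q :: real
  assumes "p < 1/2"
  shows "(\<integral>\<^sup>+u. ennreal (exp (p * u\<^sup>2 + q * u)) \<partial>std_normal)
    = ennreal (exp (q\<^sup>2 / (2 * (1 - 2 * p))) / sqrt (1 - 2 * p))"
proof -
  define D where "D = 1 - 2 * p"
  have D: "D > 0" and p: "p = (1 - D) / 2" using assms by (auto simp: D_def)
  define c where "c = exp (q\<^sup>2 / (2 * D)) / sqrt D"
  have c: "c > 0" using D by (simp add: c_def)
  have eq: "std_normal_density u * exp (p * u\<^sup>2 + q * u)
      = c * normal_density (q / D) (1 / sqrt D) u" for u
  proof -
    have "exp (- (u\<^sup>2) / 2) * exp (p * u\<^sup>2 + q * u)
       = exp (q\<^sup>2 / (2 * D)) * exp (- ((u - q / D)\<^sup>2) / (2 * (1 / sqrt D)\<^sup>2))"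
      unfolding exp_add[symmetric] p using D
      by (simp add: field_simps power2_eq_square)
    moreover have "sqrt (2 * pi * (1 / sqrt D)\<^sup>2) = sqrt (2 * pi) / sqrt D"
      using D by (simp add: real_sqrt_divide real_sqrt_mult power_divide)
    ultimately show ?thesis
      using D unfolding normal_density_def c_def by (simp add: field_simps)
  qed
  have "(\<integral>\<^sup>+u. ennreal (exp (p * u\<^sup>2 + q * u)) \<partial>std_normal)
     = (\<integral>\<^sup>+u. ennreal (std_normal_density u) * ennreal (exp (p * u\<^sup>2 + q * u)) \<partial>lborel)"
    by (subst nn_integral_density) auto
  also have "\<dots> = (\<integral>\<^sup>+u. ennreal c * ennreal (normal_density (q / D) (1 / sqrt D) u) \<partial>lborel)"
    using c by (intro nn_integral_cong) (simp add: ennreal_mult[symmetric] eq)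
  also have "\<dots> = ennreal c * (\<integral>\<^sup>+u. ennreal (normal_density (q / D) (1 / sqrt D) u) \<partial>lborel)"
    by (subst nn_integral_cmult) auto
  also have "(\<integral>\<^sup>+u. ennreal (normal_density (q / D) (1 / sqrt D) u) \<partial>lborel) = 1"
    using prob_space.emeasure_space_1[OF prob_space_normal_density[of "1 / sqrt D" "q / D"]] D
    by (simp add: emeasure_density)
  finally show ?thesis by (simp add: c_def D_def)
qed

lemma std_normal_cmult_exp_quadratic:
  fixes c p q :: real
  assumes "0 \<le> c" "p < 1/2"
  shows "(\<integral>\<^sup>+u. ennreal (c * exp (p * u\<^sup>2 + q * u)) \<partial>std_normal)
    = ennreal (c * (exp (q\<^sup>2 / (2 * (1 - 2 * p))) / sqrt (1 - 2 * p)))"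
  using assms
  by (simp add: ennreal_mult nn_integral_cmult std_normal_exp_quadratic del: times_divide_eq_right)

text \<open>The value of \<open>E exp (s (x + sqrt v G)\<^sup>2)\<close> for a standard normal \<open>G\<close>.\<close>

definition gauss_mgf :: "real \<Rightarrow> real \<Rightarrow> real \<Rightarrow> real" where
  "gauss_mgf s v x = exp (s * x\<^sup>2 / (1 - 2 * s * v)) / sqrt (1 - 2 * s * v)"

lemma gauss_mgf_nonneg: "2 * s * v < 1 \<Longrightarrow> 0 \<le> gauss_mgf s v x"
  by (simp add: gauss_mgf_def)

lemma gauss_mgf_0: "gauss_mgf s 0 x = exp (s * x\<^sup>2)"
  by (simp add: gauss_mgf_def)

lemma gauss_mgf_measurable [measurable]: "gauss_mgf s v \<in> borel_measurable borel"
  unfolding gauss_mgf_def by measurable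

text \<open>Semigroup property: an independent normal with coefficient \<open>c\<close> only raises
  the variance from \<open>v\<close> to \<open>v + c^2\<close>. Iterating it removes the normals of
  a linear form one at a time.\<close>

lemma nn_integral_gauss_mgf:
  assumes v: "2 * s * v < 1" and vc: "2 * s * (v + c\<^sup>2) < 1"
  shows "(\<integral>\<^sup>+u. ennreal (gauss_mgf s v (x + c * u)) \<partial>std_normal)
    = ennreal (gauss_mgf s (v + c\<^sup>2) x)"
proof -
  define D E where "D = 1 - 2 * s * v" and "E = 1 - 2 * s * (v + c\<^sup>2)"
  have D: "D > 0" and E: "E > 0" using assms by (auto simp: D_def E_def)
  have DE: "E = D - 2 * s * c\<^sup>2" by (simp add: D_def E_def algebra_simps)
  define p q where "p = s * c\<^sup>2 / D" and "q = 2 * s * c * x / D"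
  have p: "1 - 2 * p = E / D" using D by (simp add: p_def DE field_simps)
  have "0 < 1 - 2 * p" unfolding p using D E by simp
  then have p2: "p < 1/2" by simp
  have "gauss_mgf s v (x + c * u) = exp (s * x\<^sup>2 / D) / sqrt D * exp (p * u\<^sup>2 + q * u)" for u
    unfolding gauss_mgf_def D_def[symmetric] p_def q_def
    by (simp add: exp_add[symmetric] power2_eq_square algebra_simps add_divide_distrib)
  then have "(\<integral>\<^sup>+u. ennreal (gauss_mgf s v (x + c * u)) \<partial>std_normal)
     = (\<integral>\<^sup>+u. ennreal (exp (s * x\<^sup>2 / D) / sqrt D) * ennreal (exp (p * u\<^sup>2 + q * u)) \<partial>std_normal)"
    using D by (simp add: ennreal_mult[symmetric])
  also have "\<dots> = ennreal (exp (s * x\<^sup>2 / D) / sqrt D) *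
      ennreal (exp (q\<^sup>2 / (2 * (1 - 2 * p))) / sqrt (1 - 2 * p))"
    by (subst nn_integral_cmult) (auto simp: std_normal_exp_quadratic[OF p2])
  also have "\<dots> = ennreal (exp (s * x\<^sup>2 / D) / sqrt D * (exp (q\<^sup>2 / (2 * (1 - 2 * p))) / sqrt (1 - 2 * p)))"
    using D E p by (subst ennreal_mult[symmetric]) auto
  also have "exp (s * x\<^sup>2 / D) / sqrt D * (exp (q\<^sup>2 / (2 * (1 - 2 * p))) / sqrt (1 - 2 * p))
      = exp (s * x\<^sup>2 / E) / sqrt E"
  proof -
    have "q\<^sup>2 / (2 * (1 - 2 * p)) = (2 * s\<^sup>2 * c\<^sup>2 * x\<^sup>2) / (D * E)"
      unfolding p q_def using D E by (simp add: power2_eq_square)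
    moreover have "s * x\<^sup>2 / D + (2 * s\<^sup>2 * c\<^sup>2 * x\<^sup>2) / (D * E) = s * x\<^sup>2 * (E + 2 * s * c\<^sup>2) / (D * E)"
      using D E by (simp add: divide_simps) (simp add: algebra_simps power2_eq_square)
    ultimately have "s * x\<^sup>2 / D + q\<^sup>2 / (2 * (1 - 2 * p)) = s * x\<^sup>2 / E"
      using D E DE by simp
    then show ?thesis using D E p
      by (simp add: exp_add[symmetric] real_sqrt_divide)
  qed
  finally show ?thesis by (simp add: gauss_mgf_def E_def)
qed

section \<open>Likelihood ratios and their Gaussian averages\<close>

text \<open>The likelihood ratio of the output of the channel \<open>x \<mapsto> x + N(0,N)\<close> under the input \<open>x\<close>
  and under a Gaussian input of variance \<open>v\<close>.\<close>

definition lratio :: "real \<Rightarrow> real \<Rightarrow> real \<Rightarrow> real \<Rightarrow> real" where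
  "lratio N v x y = sqrt (1 + v / N) * exp (y\<^sup>2 / (2 * (N + v)) - (y - x)\<^sup>2 / (2 * N))"

lemma lratio_nonneg: "0 < N \<Longrightarrow> 0 \<le> v \<Longrightarrow> 0 \<le> lratio N v x y"
  by (simp add: lratio_def)

lemma lratio_measurable [measurable]:
  "f \<in> borel_measurable M \<Longrightarrow> g \<in> borel_measurable M \<Longrightarrow>
    (\<lambda>\<omega>. lratio N v (f \<omega>) (g \<omega>)) \<in> borel_measurable M"
  unfolding lratio_def by (intro borel_measurable_times borel_measurable_const borel_measurable_exp
    borel_measurable_diff borel_measurable_divide borel_measurable_power measurable_compose[OF _ borel_measurable_exp])

lemma lratio_null: "lratio N 0 0 y = 1"
  by (simp add: lratio_def)

text \<open>Averaging over a part of the input of variance \<open>d^2\<close> moves that variance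
  from signal to noise: the output law in the denominator keeps total variance
  \<open>N + v + d^2\<close>, while the numerator is convolved with a normal of variance
  \<open>d^2\<close>.\<close>

lemma nn_integral_lratio:
  fixes N v x y d :: real
  assumes N: "0 < N" and v: "0 \<le> v"
  shows "(\<integral>\<^sup>+u. ennreal (lratio N (v + d\<^sup>2) (x + d * u) y) \<partial>std_normal) = ennreal (lratio (N + d\<^sup>2) v x y)"
proof -
  have Nd: "0 < N + d\<^sup>2" "N + d\<^sup>2 \<noteq> 0" using N by (smt (verit) zero_le_power2)+
  define A where "A = sqrt (1 + (v + d\<^sup>2) / N) * exp (y\<^sup>2 / (2 * (N + (v + d\<^sup>2))))"
  have A: "A \<ge> 0" using N v by (simp add: A_def)
  have D: "1 - 2 * (- 1 / (2 * N)) * d\<^sup>2 = (N + d\<^sup>2) / N" using N by (simp add: field_simps)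
  have lt: "2 * (- 1 / (2 * N)) * d\<^sup>2 < 1" using N
    by (smt (verit) divide_minus_left mult_minus_left zero_le_divide_1_iff zero_le_mult_iff zero_le_power2)
  have "lratio N (v + d\<^sup>2) (x + d * u) y = A * gauss_mgf (- 1 / (2 * N)) 0 ((x - y) + d * u)" for u
    by (simp add: lratio_def A_def gauss_mgf_def exp_diff exp_minus field_simps power2_commute[of y])
  then have "(\<integral>\<^sup>+u. ennreal (lratio N (v + d\<^sup>2) (x + d * u) y) \<partial>std_normal)
      = (\<integral>\<^sup>+u. ennreal A * ennreal (gauss_mgf (- 1 / (2 * N)) 0 ((x - y) + d * u)) \<partial>std_normal)"
    using A by (simp add: ennreal_mult[symmetric] gauss_mgf_nonneg)
  also have "\<dots> = ennreal A * ennreal (gauss_mgf (- 1 / (2 * N)) (0 + d\<^sup>2) (x - y))"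
    using lt by (subst nn_integral_cmult, measurable) (subst nn_integral_gauss_mgf, auto)
  also have "\<dots> = ennreal (A * gauss_mgf (- 1 / (2 * N)) (d\<^sup>2) (x - y))"
    using A lt by (subst ennreal_mult[symmetric]) (auto simp: gauss_mgf_nonneg)
  also have "A * gauss_mgf (- 1 / (2 * N)) (d\<^sup>2) (x - y) = lratio (N + d\<^sup>2) v x y"
  proof -
    have "sqrt (1 + (v + d\<^sup>2) / N) / sqrt ((N + d\<^sup>2) / N) = sqrt (1 + v / (N + d\<^sup>2))"
    proof -
      have "(1 + (v + d\<^sup>2) / N) / ((N + d\<^sup>2) / N) = (N + d\<^sup>2 + v) / (N + d\<^sup>2)"
      proof -
        have "1 + (v + d\<^sup>2) / N = (N + d\<^sup>2 + v) / N" using N by (simp add: field_simps)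
        then show ?thesis using N by simp
      qed
      also have "\<dots> = 1 + v / (N + d\<^sup>2)" using Nd by (simp add: add_divide_distrib)
      finally show ?thesis unfolding real_sqrt_divide[symmetric] by simp
    qed
    moreover have "- 1 / (2 * N) * (x - y)\<^sup>2 / ((N + d\<^sup>2) / N) = - ((y - x)\<^sup>2 / (2 * (N + d\<^sup>2)))"
      using N Nd by (simp add: field_simps power2_commute[of y])
    moreover have "N + (v + d\<^sup>2) = N + d\<^sup>2 + v" by simp
    moreover have "A * gauss_mgf (- 1 / (2 * N)) (d\<^sup>2) (x - y) =
      (sqrt (1 + (v + d\<^sup>2) / N) / sqrt ((N + d\<^sup>2) / N)) *
      exp (y\<^sup>2 / (2 * (N + (v + d\<^sup>2))) + (- 1 / (2 * N) * (x - y)\<^sup>2 / ((N + d\<^sup>2) / N)))"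
      unfolding A_def gauss_mgf_def D exp_add by simp
    ultimately show ?thesis
      unfolding lratio_def by simp
  qed
  finally show ?thesis .
qed

lemma nn_integral_lratio_single:
  "0 < N \<Longrightarrow> (\<integral>\<^sup>+u. ennreal (lratio N (d\<^sup>2) (d * u) y) \<partial>std_normal) = 1"
  using nn_integral_lratio[of N 0 d 0 y] by (simp add: lratio_null)

text \<open>The vectors \<open>(a, b)\<close> and \<open>(-b, a)\<close> are orthogonal, so the two
  inputs are independent normals, and each ratio alone has mean 1. The calculation verifies this
  directly, completing the square first in \<open>v\<close> and then in \<open>u\<close>; inverse
  noise variances \<open>w\<close> and \<open>x\<close> keep the exponents polynomial in the
  parameters.\<close>

lemma nn_integral_lratio_orthogonal:
  assumes N: "0 < N" and N': "0 < N'"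
  shows "(\<integral>\<^sup>+u. \<integral>\<^sup>+v. ennreal (lratio N (a\<^sup>2 + b\<^sup>2) (a * u + b * v) y *
       lratio N' (k\<^sup>2 * (a\<^sup>2 + b\<^sup>2)) (k * (a * v - b * u)) z) \<partial>std_normal \<partial>std_normal) = 1"
proof -
  define w x where "w = 1 / N" and "x = 1 / N'"
  have w: "w > 0" and x: "x > 0" and Nw: "N = 1 / w" and Nx: "N' = 1 / x"
    using N N' by (auto simp: w_def x_def)
  define r where "r = a\<^sup>2 + b\<^sup>2"
  define F G where "F = 1 + w * r" and "G = 1 + x * k\<^sup>2 * r"
  have r: "r \<ge> 0" by (simp add: r_def)
  have FG: "F > 0" "G > 0" using w x r
    by (auto simp: F_def G_def intro!: add_pos_nonneg)
  define D where "D = 1 + w * b\<^sup>2 + x * k\<^sup>2 * a\<^sup>2"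
  have D: "D > 0" using w x by (auto simp: D_def intro!: add_pos_nonneg)
  define c where "c = sqrt F * sqrt G * exp (w * y\<^sup>2 / (2 * F) + x * z\<^sup>2 / (2 * G))"
  have c: "c \<ge> 0" using FG by (simp add: c_def)
  define p where "p = - (w * b\<^sup>2 + x * k\<^sup>2 * a\<^sup>2) / 2"
  have p: "1 - 2 * p = D" "p < 1/2" using D by (auto simp: p_def D_def field_simps)
  define q0 m where "q0 = w * b * y + x * k * a * z" and "m = a * b * (x * k\<^sup>2 - w)"
  have fac: "lratio N (a\<^sup>2 + b\<^sup>2) (a * u + b * v) y * lratio N' (k\<^sup>2 * (a\<^sup>2 + b\<^sup>2)) (k * (a * v - b * u)) z
     = c * exp (- w / 2 * (y - a * u)\<^sup>2 - x / 2 * (z + k * b * u)\<^sup>2) *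
       exp (p * v\<^sup>2 + (q0 + m * u) * v)" for u v
  proof -
    have "y\<^sup>2 / (2 * (N + r)) = w * y\<^sup>2 / (2 * F)" "1 + r / N = F"
      using w FG unfolding Nw F_def by (auto simp: field_simps)
    moreover have "z\<^sup>2 / (2 * (N' + k\<^sup>2 * r)) = x * z\<^sup>2 / (2 * G)" "1 + k\<^sup>2 * r / N' = G"
      using x FG unfolding Nx G_def by (auto simp: field_simps)
    moreover have "(y - (a * u + b * v))\<^sup>2 / (2 * N) + (z - k * (a * v - b * u))\<^sup>2 / (2 * N')
       = w / 2 * (y - a * u)\<^sup>2 + x / 2 * (z + k * b * u)\<^sup>2 - (p * v\<^sup>2 + (q0 + m * u) * v)"
      unfolding Nw Nx p_def q0_def m_def by (simp add: field_simps power2_eq_square)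
    ultimately show ?thesis
      unfolding lratio_def c_def r_def[symmetric]
      by (simp add: exp_add[symmetric] exp_diff[symmetric] mult.assoc[symmetric])
  qed
  have inner: "(\<integral>\<^sup>+v. ennreal (lratio N (a\<^sup>2 + b\<^sup>2) (a * u + b * v) y *
       lratio N' (k\<^sup>2 * (a\<^sup>2 + b\<^sup>2)) (k * (a * v - b * u)) z) \<partial>std_normal)
     = ennreal (c * exp (- w / 2 * (y - a * u)\<^sup>2 - x / 2 * (z + k * b * u)\<^sup>2)
        * (exp ((q0 + m * u)\<^sup>2 / (2 * D)) / sqrt D))" for u
    unfolding fac by (subst std_normal_cmult_exp_quadratic[OF _ p(2)]) (use c in \<open>auto simp: p(1)\<close>)
  define p' q' where "p' = - (w * a\<^sup>2 + x * k\<^sup>2 * b\<^sup>2) / 2 + m\<^sup>2 / (2 * D)"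
    and "q' = (w * a * y * G - x * k * b * z * F) / D"
  \<comment> \<open>Determinant of the 2 by 2 quadratic form in \<open>(u, v)\<close>, whose
    off-diagonal entry is \<open>- m\<close>. Its eigenvectors are \<open>(a, b)\<close> and
    \<open>(-b, a)\<close>, with eigenvalues \<open>F\<close> and \<open>G\<close>.\<close>
  have key: "(1 + w * a\<^sup>2 + x * k\<^sup>2 * b\<^sup>2) * D - m\<^sup>2 = F * G"
    unfolding D_def m_def F_def G_def r_def by (simp add: algebra_simps power2_eq_square)
  have p': "1 - 2 * p' = F * G / D"
    unfolding key[symmetric] p'_def using D by (simp add: field_simps)
  have "0 < 1 - 2 * p'" unfolding p' using D FG by simp
  then have p'2: "p' < 1/2" by simp
  have q': "w * a * y - x * k * b * z + q0 * m / D = q'"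
  proof -
    have "(w * a * y - x * k * b * z) * D + q0 * m = w * a * y * G - x * k * b * z * F"
      unfolding D_def m_def q0_def F_def G_def r_def by (simp add: algebra_simps power2_eq_square)
    then show ?thesis unfolding q'_def using D by (simp add: field_simps)
  qed
  have outer: "- w / 2 * (y - a * u)\<^sup>2 - x / 2 * (z + k * b * u)\<^sup>2 + (q0 + m * u)\<^sup>2 / (2 * D)
     = (- w * y\<^sup>2 / 2 - x * z\<^sup>2 / 2 + q0\<^sup>2 / (2 * D)) + (p' * u\<^sup>2 + q' * u)" for u
    unfolding q'[symmetric] p'_def using D
    by (simp add: divide_simps) (simp add: algebra_simps power2_eq_square)
  \<comment> \<open>The exponent that remains after both integrations is the negative of the one in
    \<open>c\<close>, so everything cancels to 1.\<close>
  have fin: "(- w * y\<^sup>2 / 2 - x * z\<^sup>2 / 2 + q0\<^sup>2 / (2 * D)) + q'\<^sup>2 / (2 * (F * G / D))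
      = - (w * y\<^sup>2 / (2 * F) + x * z\<^sup>2 / (2 * G))"
  proof -
    have "q'\<^sup>2 / (2 * (F * G / D)) = (w * a * y * G - x * k * b * z * F)\<^sup>2 / (2 * F * G * D)"
      unfolding q'_def using D FG by (simp add: power2_eq_square)
    moreover have "(- w * y\<^sup>2 - x * z\<^sup>2) * (F * G * D) + q0\<^sup>2 * (F * G) + (w * a * y * G - x * k * b * z * F)\<^sup>2
       = - (w * y\<^sup>2 * G + x * z\<^sup>2 * F) * D"
      unfolding D_def q0_def F_def G_def r_def by algebra
    ultimately show ?thesis using D FG
      by (simp add: divide_simps) (simp add: algebra_simps)
  qed
  have "(\<integral>\<^sup>+u. \<integral>\<^sup>+v. ennreal (lratio N (a\<^sup>2 + b\<^sup>2) (a * u + b * v) y *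
       lratio N' (k\<^sup>2 * (a\<^sup>2 + b\<^sup>2)) (k * (a * v - b * u)) z) \<partial>std_normal \<partial>std_normal)
    = (\<integral>\<^sup>+u. ennreal ((c / sqrt D * exp (- w * y\<^sup>2 / 2 - x * z\<^sup>2 / 2 + q0\<^sup>2 / (2 * D))) *
         exp (p' * u\<^sup>2 + q' * u)) \<partial>std_normal)"
    unfolding inner
  proof (intro nn_integral_cong arg_cong[where f = ennreal])
    fix u
    show "c * exp (- w / 2 * (y - a * u)\<^sup>2 - x / 2 * (z + k * b * u)\<^sup>2)
        * (exp ((q0 + m * u)\<^sup>2 / (2 * D)) / sqrt D)
      = (c / sqrt D * exp (- w * y\<^sup>2 / 2 - x * z\<^sup>2 / 2 + q0\<^sup>2 / (2 * D))) *
         exp (p' * u\<^sup>2 + q' * u)"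
      using arg_cong[OF outer[of u], of exp] by (simp only: exp_add) simp
  qed
  also have "\<dots> = ennreal (c / sqrt D * exp (- w * y\<^sup>2 / 2 - x * z\<^sup>2 / 2 + q0\<^sup>2 / (2 * D)) *
      (exp (q'\<^sup>2 / (2 * (F * G / D))) / sqrt (F * G / D)))"
    using c D by (subst std_normal_cmult_exp_quadratic[OF _ p'2]) (auto simp: p')
  also have "c / sqrt D * exp (- w * y\<^sup>2 / 2 - x * z\<^sup>2 / 2 + q0\<^sup>2 / (2 * D)) *
      (exp (q'\<^sup>2 / (2 * (F * G / D))) / sqrt (F * G / D)) = 1"
  proof -
    have "exp (- w * y\<^sup>2 / 2 - x * z\<^sup>2 / 2 + q0\<^sup>2 / (2 * D)) * exp (q'\<^sup>2 / (2 * (F * G / D)))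
      = exp (- (w * y\<^sup>2 / (2 * F) + x * z\<^sup>2 / (2 * G)))"
      by (simp only: exp_add[symmetric] fin)
    moreover have "c = sqrt F * sqrt G / exp (- (w * y\<^sup>2 / (2 * F) + x * z\<^sup>2 / (2 * G)))"
      by (simp only: c_def exp_minus divide_inverse inverse_inverse_eq)
    moreover define e where "e = exp (- (w * y\<^sup>2 / (2 * F) + x * z\<^sup>2 / (2 * G)))"
    moreover have "e > 0" by (simp add: e_def)
    ultimately show ?thesis using D FG
      by (simp add: real_sqrt_divide real_sqrt_mult mult.assoc[symmetric])
  qed
  finally show ?thesis by simp
qed

section \<open>Random coding for two transmitters\<close>

lemma measurable_uncurry_comp:
  assumes "(\<lambda>(a, b). f a b) \<in> measurable (M1 \<Otimes>\<^sub>M M2) N" "g \<in> measurable L M1" "h \<in> measurable L M2"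
  shows "(\<lambda>x. f (g x) (h x)) \<in> measurable L N"
  using measurable_compose[OF measurable_Pair[OF assms(2,3)] assms(1)] by simp

lemma nn_integral_PiM_component:
  assumes "prob_space M" "i \<in> I" and [measurable]: "f \<in> borel_measurable M"
  shows "(\<integral>\<^sup>+x. f (x i) \<partial>PiM I (\<lambda>_. M)) = (\<integral>\<^sup>+a. f a \<partial>M)"
proof -
  interpret prob_space M by fact
  interpret product_prob_space "\<lambda>_. M" I ..
  have "(\<integral>\<^sup>+a. f a \<partial>M) = (\<integral>\<^sup>+a. f a \<partial>distr (PiM I (\<lambda>_. M)) M (\<lambda>x. x i))"
    using PiM_component[OF assms(2)] by simp
  also have "\<dots> = (\<integral>\<^sup>+x. f (x i) \<partial>PiM I (\<lambda>_. M))"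
    using assms(2) by (subst nn_integral_distr) auto
  finally show ?thesis ..
qed

lemma nn_integral_PiM_two_components:
  assumes M: "prob_space M" and "i \<in> I" "j \<in> I" "i \<noteq> j" "finite I"
    and f: "(\<lambda>(a, b). f a b) \<in> borel_measurable (M \<Otimes>\<^sub>M M)"
  shows "(\<integral>\<^sup>+x. f (x i) (x j) \<partial>PiM I (\<lambda>_. M)) = (\<integral>\<^sup>+a. \<integral>\<^sup>+b. f a b \<partial>M \<partial>M)"
proof -
  interpret prob_space M by fact
  interpret product_prob_space "\<lambda>_. M" I ..
  note f' [measurable] = measurable_uncurry_comp[OF f]
  define J where "J = I - {i}"
  have J: "I = insert i J" "i \<notin> J" "finite J" "j \<in> J" using assms by (auto simp: J_def)
  have "(\<integral>\<^sup>+x. f (x i) (x j) \<partial>PiM I (\<lambda>_. M))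
     = (\<integral>\<^sup>+y. \<integral>\<^sup>+x. f ((x(i := y)) i) ((x(i := y)) j) \<partial>PiM J (\<lambda>_. M) \<partial>M)"
    unfolding J(1) using J(2-4)
    by (subst product_nn_integral_insert_rev) auto
  also have "\<dots> = (\<integral>\<^sup>+y. \<integral>\<^sup>+x. f y (x j) \<partial>PiM J (\<lambda>_. M) \<partial>M)"
    using assms(4) by simp
  also have "\<dots> = (\<integral>\<^sup>+y. \<integral>\<^sup>+b. f y b \<partial>M \<partial>M)"
    using J by (intro nn_integral_cong nn_integral_PiM_component M) auto
  finally show ?thesis .
qed

lemma (in prob_space) nn_integral_less_imp_ex:
  assumes "(\<integral>\<^sup>+x. f x \<partial>M) < D"
  obtains x where "x \<in> space M" "f x < D"
proof -
  have "\<exists>x\<in>space M. f x < D"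
  proof (rule ccontr)
    assume "\<not> ?thesis"
    then have "(\<integral>\<^sup>+x. D \<partial>M) \<le> (\<integral>\<^sup>+x. f x \<partial>M)"
      by (intro nn_integral_mono) (auto simp: not_less)
    then show False using assms by (simp add: emeasure_space_1)
  qed
  then show thesis using that by blast
qed

lemma (in prob_space) nn_integral_le_const:
  "(\<And>x. x \<in> space M \<Longrightarrow> f x \<le> c) \<Longrightarrow> (\<integral>\<^sup>+x. f x \<partial>M) \<le> c"
  using nn_integral_mono[of M f "\<lambda>_. c"] by (simp add: emeasure_space_1)

lemma nn_integral_triple:
  assumes "prob_space L2" "prob_space L3"
    and f [measurable]: "f \<in> borel_measurable (L1 \<Otimes>\<^sub>M L2 \<Otimes>\<^sub>M L3)"
  shows "(\<integral>\<^sup>+x. f x \<partial>(L1 \<Otimes>\<^sub>M L2 \<Otimes>\<^sub>M L3)) = (\<integral>\<^sup>+x. \<integral>\<^sup>+y. \<integral>\<^sup>+z. f (x, y, z) \<partial>L3 \<partial>L2 \<partial>L1)"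
proof -
  interpret L2: prob_space L2 by fact
  interpret L3: prob_space L3 by fact
  interpret L23: pair_prob_space L2 L3 ..
  have "(\<integral>\<^sup>+x. f x \<partial>(L1 \<Otimes>\<^sub>M L2 \<Otimes>\<^sub>M L3)) = (\<integral>\<^sup>+x. \<integral>\<^sup>+p. f (x, p) \<partial>(L2 \<Otimes>\<^sub>M L3) \<partial>L1)"
    by (intro L23.nn_integral_fst[symmetric] f)
  also have "\<dots> = (\<integral>\<^sup>+x. \<integral>\<^sup>+y. \<integral>\<^sup>+z. f (x, y, z) \<partial>L3 \<partial>L2 \<partial>L1)"
    by (intro nn_integral_cong L3.nn_integral_fst[symmetric]) measurable
  finally show ?thesis .
qed

text \<open>\<open>A\<close> and \<open>B\<close> are the laws of single codewords and
  \<open>W\<close> is the law of all noise. The scores \<open>e12\<close>, \<open>e1\<close>,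
  \<open>e2\<close> detect pairs wrong in both messages, only in the first, only in the second; all
  that is asked of them is mean at most 1 over the wrong codewords at a fixed output.
  \<open>q\<close> majorizes the indicator that the true pair fails a threshold. It is a function
  and not just a probability because its mean under the selected codebook is needed later for the
  energies.\<close>

locale mac_ensemble =
  A: prob_space A + B: prob_space B + W: prob_space W
  for A :: "'a measure" and B :: "'b measure" and W :: "'w measure" +
  fixes Y :: "'y measure" and out :: "'a \<Rightarrow> 'b \<Rightarrow> 'w \<Rightarrow> 'y"
    and e12 e1 e2 :: "'a \<Rightarrow> 'b \<Rightarrow> 'y \<Rightarrow> ennreal"
    and q :: "'a \<Rightarrow> 'b \<Rightarrow> 'w \<Rightarrow> ennreal"
    and t12 t1 t2 :: real
  assumes out: "(\<lambda>(a, b, w). out a b w) \<in> measurable (A \<Otimes>\<^sub>M B \<Otimes>\<^sub>M W) Y"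
    and e12: "(\<lambda>(a, b, y). e12 a b y) \<in> borel_measurable (A \<Otimes>\<^sub>M B \<Otimes>\<^sub>M Y)"
    and e1: "(\<lambda>(a, b, y). e1 a b y) \<in> borel_measurable (A \<Otimes>\<^sub>M B \<Otimes>\<^sub>M Y)"
    and e2: "(\<lambda>(a, b, y). e2 a b y) \<in> borel_measurable (A \<Otimes>\<^sub>M B \<Otimes>\<^sub>M Y)"
    and q: "(\<lambda>(a, b, w). q a b w) \<in> borel_measurable (A \<Otimes>\<^sub>M B \<Otimes>\<^sub>M W)"
    and int_e12: "y \<in> space Y \<Longrightarrow> (\<integral>\<^sup>+a. \<integral>\<^sup>+b. e12 a b y \<partial>B \<partial>A) \<le> 1"
    and int_e1: "b \<in> space B \<Longrightarrow> y \<in> space Y \<Longrightarrow> (\<integral>\<^sup>+a. e1 a b y \<partial>A) \<le> 1"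
    and int_e2: "a \<in> space A \<Longrightarrow> y \<in> space Y \<Longrightarrow> (\<integral>\<^sup>+b. e2 a b y \<partial>B) \<le> 1"
    and thr_pos: "0 < t12" "0 < t1" "0 < t2"
    and q_ge_1: "a \<in> space A \<Longrightarrow> b \<in> space B \<Longrightarrow> w \<in> space W \<Longrightarrow>
      e12 a b (out a b w) < ennreal t12 \<or> e1 a b (out a b w) < ennreal t1 \<or>
      e2 a b (out a b w) < ennreal t2 \<Longrightarrow> 1 \<le> q a b w"
begin

definition accept :: "'a \<Rightarrow> 'b \<Rightarrow> 'y \<Rightarrow> bool" where
  "accept a b y \<longleftrightarrow> ennreal t12 \<le> e12 a b y \<and> ennreal t1 \<le> e1 a b y \<and> ennreal t2 \<le> e2 a b y"

text \<open>If this fails, the sent pair is the only accepted one, so any decoder that outputs an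
  accepted pair is correct. The choice of the decoder can thus be postponed.\<close>

definition ambiguous :: "nat \<Rightarrow> nat \<Rightarrow> (nat \<Rightarrow> 'a) \<Rightarrow> (nat \<Rightarrow> 'b) \<Rightarrow> nat \<Rightarrow> nat \<Rightarrow> 'y \<Rightarrow> bool" where
  "ambiguous M1 M2 c1 c2 m1 m2 y \<longleftrightarrow> \<not> accept (c1 m1) (c2 m2) y \<or>
     (\<exists>m1'<M1. \<exists>m2'<M2. (m1', m2') \<noteq> (m1, m2) \<and> accept (c1 m1') (c2 m2') y)"

lemma out_comp [measurable]:
  assumes "f \<in> measurable L A" "g \<in> measurable L B" "h \<in> measurable L W"
  shows "(\<lambda>x. out (f x) (g x) (h x)) \<in> measurable L Y"
  using measurable_compose[OF measurable_Pair[OF assms(1) measurable_Pair[OF assms(2,3)]] out] by simp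

lemma e12_comp [measurable]:
  assumes "f \<in> measurable L A" "g \<in> measurable L B" "h \<in> measurable L Y"
  shows "(\<lambda>x. e12 (f x) (g x) (h x)) \<in> borel_measurable L"
  using measurable_compose[OF measurable_Pair[OF assms(1) measurable_Pair[OF assms(2,3)]] e12] by simp

lemma e1_comp [measurable]:
  assumes "f \<in> measurable L A" "g \<in> measurable L B" "h \<in> measurable L Y"
  shows "(\<lambda>x. e1 (f x) (g x) (h x)) \<in> borel_measurable L"
  using measurable_compose[OF measurable_Pair[OF assms(1) measurable_Pair[OF assms(2,3)]] e1] by simp

lemma e2_comp [measurable]:
  assumes "f \<in> measurable L A" "g \<in> measurable L B" "h \<in> measurable L Y"
  shows "(\<lambda>x. e2 (f x) (g x) (h x)) \<in> borel_measurable L"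
  using measurable_compose[OF measurable_Pair[OF assms(1) measurable_Pair[OF assms(2,3)]] e2] by simp

lemma q_comp [measurable]:
  assumes "f \<in> measurable L A" "g \<in> measurable L B" "h \<in> measurable L W"
  shows "(\<lambda>x. q (f x) (g x) (h x)) \<in> borel_measurable L"
  using measurable_compose[OF measurable_Pair[OF assms(1) measurable_Pair[OF assms(2,3)]] q] by simp

lemma out_space: "a \<in> space A \<Longrightarrow> b \<in> space B \<Longrightarrow> w \<in> space W \<Longrightarrow> out a b w \<in> space Y"
  using measurable_space[OF out, of "(a, b, w)"] by (simp add: space_pair_measure)

lemma accept_comp [measurable]:
  assumes [measurable]: "f \<in> measurable L A" "g \<in> measurable L B" "h \<in> measurable L Y"
  shows "Measurable.pred L (\<lambda>x. accept (f x) (g x) (h x))"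
  unfolding accept_def by measurable

text \<open>Union bound with Markov's inequality built in: an accepted wrong pair is wrong in one or
  both messages, and the score belonging to that case, divided by its threshold, is then at least
  1.\<close>

lemma of_bool_ambiguous_le:
  assumes "c1 m1 \<in> space A" "c2 m2 \<in> space B" "w \<in> space W"
    and "m1 < M1" "m2 < M2"
  defines "y \<equiv> out (c1 m1) (c2 m2) w"
  shows "of_bool (ambiguous M1 M2 c1 c2 m1 m2 y) \<le> q (c1 m1) (c2 m2) w
    + (\<Sum>m1'\<in>{..<M1} - {m1}. e1 (c1 m1') (c2 m2) y / ennreal t1)
    + (\<Sum>m2'\<in>{..<M2} - {m2}. e2 (c1 m1) (c2 m2') y / ennreal t2)
    + (\<Sum>m1'\<in>{..<M1} - {m1}. \<Sum>m2'\<in>{..<M2} - {m2}. e12 (c1 m1') (c2 m2') y / ennreal t12)"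
    (is "_ \<le> ?q + ?S1 + ?S2 + ?S12")
proof (cases "ambiguous M1 M2 c1 c2 m1 m2 y")
  case True
  have div: "1 \<le> e / ennreal t" if "ennreal t \<le> e" "0 < t" for e :: ennreal and t :: real
    using divide_right_mono_ennreal[OF that(1), of "ennreal t"] that(2)
    by (simp add: ennreal_divide_self)
  have "1 \<le> ?q \<or> 1 \<le> ?S1 \<or> 1 \<le> ?S2 \<or> 1 \<le> ?S12"
  proof (cases "accept (c1 m1) (c2 m2) y")
    case False
    then show ?thesis
      using q_ge_1[OF assms(1-3)] by (auto simp: accept_def y_def not_le)
  next
    case acc: True
    then obtain m1' m2' where m: "m1' < M1" "m2' < M2" "(m1', m2') \<noteq> (m1, m2)"
      and ok: "accept (c1 m1') (c2 m2') y"
      using True unfolding ambiguous_def by blast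
    consider "m1' \<noteq> m1" "m2' = m2" | "m1' = m1" "m2' \<noteq> m2" | "m1' \<noteq> m1" "m2' \<noteq> m2"
      using m(3) by auto
    then show ?thesis
    proof cases
      case 1
      have "e1 (c1 m1') (c2 m2) y / ennreal t1 \<le> ?S1"
        using 1 m by (intro member_le_sum) auto
      moreover have "1 \<le> e1 (c1 m1') (c2 m2) y / ennreal t1"
        using ok 1 thr_pos by (intro div) (auto simp: accept_def)
      ultimately show ?thesis by (meson order_trans)
    next
      case 2
      have "e2 (c1 m1) (c2 m2') y / ennreal t2 \<le> ?S2"
        using 2 m by (intro member_le_sum) auto
      moreover have "1 \<le> e2 (c1 m1) (c2 m2') y / ennreal t2"
        using ok 2 thr_pos by (intro div) (auto simp: accept_def)
      ultimately show ?thesis by (meson order_trans)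
    next
      case 3
      have "e12 (c1 m1') (c2 m2') y / ennreal t12
          \<le> (\<Sum>m2'\<in>{..<M2} - {m2}. e12 (c1 m1') (c2 m2') y / ennreal t12)"
        using 3 m by (intro member_le_sum) auto
      also have "\<dots> \<le> ?S12"
        using 3 m by (intro member_le_sum[where f = "\<lambda>m1'. \<Sum>m2'\<in>{..<M2} - {m2}. e12 (c1 m1') (c2 m2') y / ennreal t12"]) auto
      finally have "e12 (c1 m1') (c2 m2') y / ennreal t12 \<le> ?S12" .
      moreover have "1 \<le> e12 (c1 m1') (c2 m2') y / ennreal t12"
        using ok 3 thr_pos by (intro div) (auto simp: accept_def)
      ultimately show ?thesis by (meson order_trans)
    qed
  qed
  moreover have "?q \<le> ?q + ?S1 + ?S2 + ?S12" "?S1 \<le> ?q + ?S1 + ?S2 + ?S12"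
    "?S2 \<le> ?q + ?S1 + ?S2 + ?S12" "?S12 \<le> ?q + ?S1 + ?S2 + ?S12"
    by (auto simp: add_increasing add_increasing2 add.assoc)
  ultimately show ?thesis using True by (auto intro: order_trans)
qed simp


text \<open>The wrong codeword is independent of the output, so by Fubini it can be integrated
  first, with the output held fixed. The codeword of user 2 occurs both in the score and in the
  output, which is why \<open>int_e1\<close> is demanded for each fixed \<open>b\<close>. The next
  two lemmas follow the same pattern.\<close>

lemma cross_e1:
  assumes m: "m1 < (M1::nat)" "m2 < (M2::nat)" "m1' < M1" "m1' \<noteq> m1"
  shows "(\<integral>\<^sup>+c1. \<integral>\<^sup>+c2. \<integral>\<^sup>+w. e1 (c1 m1') (c2 m2) (out (c1 m1) (c2 m2) w) \<partial>W
     \<partial>PiM {..<M2} (\<lambda>_. B) \<partial>PiM {..<M1} (\<lambda>_. A)) \<le> 1" (is "?L \<le> 1")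
proof -
  interpret AB: pair_sigma_finite A B ..
  interpret AW: pair_sigma_finite A W ..
  have "?L = (\<integral>\<^sup>+c1. \<integral>\<^sup>+b. \<integral>\<^sup>+w. e1 (c1 m1') b (out (c1 m1) b w) \<partial>W \<partial>B \<partial>PiM {..<M1} (\<lambda>_. A))"
  proof (intro nn_integral_cong)
    fix c1 assume "c1 \<in> space (PiM {..<M1} (\<lambda>_. A))"
    then have [measurable]: "c1 m1 \<in> space A" "c1 m1' \<in> space A"
      using m by (auto simp: space_PiM PiE_iff)
    show "(\<integral>\<^sup>+c2. \<integral>\<^sup>+w. e1 (c1 m1') (c2 m2) (out (c1 m1) (c2 m2) w) \<partial>W \<partial>PiM {..<M2} (\<lambda>_. B))
      = (\<integral>\<^sup>+b. \<integral>\<^sup>+w. e1 (c1 m1') b (out (c1 m1) b w) \<partial>W \<partial>B)"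
      using m by (intro nn_integral_PiM_component[OF B.prob_space_axioms,
        where f = "\<lambda>b. \<integral>\<^sup>+w. e1 (c1 m1') b (out (c1 m1) b w) \<partial>W"]) auto
  qed
  also have "\<dots> = (\<integral>\<^sup>+a. \<integral>\<^sup>+a'. \<integral>\<^sup>+b. \<integral>\<^sup>+w. e1 a' b (out a b w) \<partial>W \<partial>B \<partial>A \<partial>A)"
    using m by (intro nn_integral_PiM_two_components[OF A.prob_space_axioms,
        where f = "\<lambda>a a'. \<integral>\<^sup>+b. \<integral>\<^sup>+w. e1 a' b (out a b w) \<partial>W \<partial>B"]) auto
  also have "\<dots> \<le> 1"
  proof (rule A.nn_integral_le_const)
    fix a assume [measurable]: "a \<in> space A"
    have "(\<integral>\<^sup>+a'. \<integral>\<^sup>+b. \<integral>\<^sup>+w. e1 a' b (out a b w) \<partial>W \<partial>B \<partial>A)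
      = (\<integral>\<^sup>+b. \<integral>\<^sup>+a'. \<integral>\<^sup>+w. e1 a' b (out a b w) \<partial>W \<partial>A \<partial>B)"
      by (intro AB.Fubini'[symmetric]) measurable
    also have "\<dots> \<le> 1"
    proof (rule B.nn_integral_le_const)
      fix b assume [measurable]: "b \<in> space B"
      have "(\<integral>\<^sup>+a'. \<integral>\<^sup>+w. e1 a' b (out a b w) \<partial>W \<partial>A) = (\<integral>\<^sup>+w. \<integral>\<^sup>+a'. e1 a' b (out a b w) \<partial>A \<partial>W)"
        by (intro AW.Fubini'[symmetric]) measurable
      also have "\<dots> \<le> 1"
        using \<open>a \<in> space A\<close> \<open>b \<in> space B\<close>
        by (intro W.nn_integral_le_const int_e1 out_space)
      finally show "(\<integral>\<^sup>+a'. \<integral>\<^sup>+w. e1 a' b (out a b w) \<partial>W \<partial>A) \<le> 1" .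
    qed
    finally show "(\<integral>\<^sup>+a'. \<integral>\<^sup>+b. \<integral>\<^sup>+w. e1 a' b (out a b w) \<partial>W \<partial>B \<partial>A) \<le> 1" .
  qed
  finally show ?thesis .
qed

lemma cross_e2:
  assumes m: "m1 < (M1::nat)" "m2 < (M2::nat)" "m2' < M2" "m2' \<noteq> m2"
  shows "(\<integral>\<^sup>+c1. \<integral>\<^sup>+c2. \<integral>\<^sup>+w. e2 (c1 m1) (c2 m2') (out (c1 m1) (c2 m2) w) \<partial>W
     \<partial>PiM {..<M2} (\<lambda>_. B) \<partial>PiM {..<M1} (\<lambda>_. A)) \<le> 1" (is "?L \<le> 1")
proof -
  interpret BW: pair_sigma_finite B W ..
  interpret CA: prob_space "PiM {..<M1} (\<lambda>_. A)" by (intro prob_space_PiM A.prob_space_axioms)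
  show ?thesis
  proof (rule CA.nn_integral_le_const)
    fix c1 assume "c1 \<in> space (PiM {..<M1} (\<lambda>_. A))"
    then have a [measurable]: "c1 m1 \<in> space A"
      using m by (auto simp: space_PiM PiE_iff)
    have "(\<integral>\<^sup>+c2. \<integral>\<^sup>+w. e2 (c1 m1) (c2 m2') (out (c1 m1) (c2 m2) w) \<partial>W \<partial>PiM {..<M2} (\<lambda>_. B))
      = (\<integral>\<^sup>+b. \<integral>\<^sup>+b'. \<integral>\<^sup>+w. e2 (c1 m1) b' (out (c1 m1) b w) \<partial>W \<partial>B \<partial>B)"
      using m by (intro nn_integral_PiM_two_components[OF B.prob_space_axioms,
        where f = "\<lambda>b b'. \<integral>\<^sup>+w. e2 (c1 m1) b' (out (c1 m1) b w) \<partial>W"]) auto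
    also have "\<dots> \<le> 1"
    proof (rule B.nn_integral_le_const)
      fix b assume b [measurable]: "b \<in> space B"
      have "(\<integral>\<^sup>+b'. \<integral>\<^sup>+w. e2 (c1 m1) b' (out (c1 m1) b w) \<partial>W \<partial>B)
        = (\<integral>\<^sup>+w. \<integral>\<^sup>+b'. e2 (c1 m1) b' (out (c1 m1) b w) \<partial>B \<partial>W)"
        by (intro BW.Fubini'[symmetric]) measurable
      also have "\<dots> \<le> 1"
        using a b by (intro W.nn_integral_le_const int_e2 out_space)
      finally show "(\<integral>\<^sup>+b'. \<integral>\<^sup>+w. e2 (c1 m1) b' (out (c1 m1) b w) \<partial>W \<partial>B) \<le> 1" .
    qed
    finally show "(\<integral>\<^sup>+c2. \<integral>\<^sup>+w. e2 (c1 m1) (c2 m2') (out (c1 m1) (c2 m2) w) \<partial>W \<partial>PiM {..<M2} (\<lambda>_. B)) \<le> 1" .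
  qed
qed

lemma cross_e12:
  assumes m: "m1 < (M1::nat)" "m2 < (M2::nat)" "m1' < M1" "m2' < M2" "m1' \<noteq> m1" "m2' \<noteq> m2"
  shows "(\<integral>\<^sup>+c1. \<integral>\<^sup>+c2. \<integral>\<^sup>+w. e12 (c1 m1') (c2 m2') (out (c1 m1) (c2 m2) w) \<partial>W
     \<partial>PiM {..<M2} (\<lambda>_. B) \<partial>PiM {..<M1} (\<lambda>_. A)) \<le> 1" (is "?L \<le> 1")
proof -
  interpret AB: pair_sigma_finite A B ..
  interpret AW: pair_sigma_finite A W ..
  interpret BW: pair_sigma_finite B W ..
  have "?L = (\<integral>\<^sup>+c1. \<integral>\<^sup>+b. \<integral>\<^sup>+b'. \<integral>\<^sup>+w. e12 (c1 m1') b' (out (c1 m1) b w) \<partial>W \<partial>B \<partial>B \<partial>PiM {..<M1} (\<lambda>_. A))"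
  proof (intro nn_integral_cong)
    fix c1 assume "c1 \<in> space (PiM {..<M1} (\<lambda>_. A))"
    then have [measurable]: "c1 m1 \<in> space A" "c1 m1' \<in> space A"
      using m by (auto simp: space_PiM PiE_iff)
    show "(\<integral>\<^sup>+c2. \<integral>\<^sup>+w. e12 (c1 m1') (c2 m2') (out (c1 m1) (c2 m2) w) \<partial>W \<partial>PiM {..<M2} (\<lambda>_. B))
      = (\<integral>\<^sup>+b. \<integral>\<^sup>+b'. \<integral>\<^sup>+w. e12 (c1 m1') b' (out (c1 m1) b w) \<partial>W \<partial>B \<partial>B)"
      using m by (intro nn_integral_PiM_two_components[OF B.prob_space_axioms,
        where f = "\<lambda>b b'. \<integral>\<^sup>+w. e12 (c1 m1') b' (out (c1 m1) b w) \<partial>W"]) auto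
  qed
  also have "\<dots> = (\<integral>\<^sup>+a. \<integral>\<^sup>+a'. \<integral>\<^sup>+b. \<integral>\<^sup>+b'. \<integral>\<^sup>+w. e12 a' b' (out a b w) \<partial>W \<partial>B \<partial>B \<partial>A \<partial>A)"
    using m by (intro nn_integral_PiM_two_components[OF A.prob_space_axioms,
        where f = "\<lambda>a a'. \<integral>\<^sup>+b. \<integral>\<^sup>+b'. \<integral>\<^sup>+w. e12 a' b' (out a b w) \<partial>W \<partial>B \<partial>B"]) auto
  also have "\<dots> \<le> 1"
  proof (rule A.nn_integral_le_const)
    fix a assume a [measurable]: "a \<in> space A"
    have "(\<integral>\<^sup>+a'. \<integral>\<^sup>+b. \<integral>\<^sup>+b'. \<integral>\<^sup>+w. e12 a' b' (out a b w) \<partial>W \<partial>B \<partial>B \<partial>A)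
      = (\<integral>\<^sup>+b. \<integral>\<^sup>+a'. \<integral>\<^sup>+b'. \<integral>\<^sup>+w. e12 a' b' (out a b w) \<partial>W \<partial>B \<partial>A \<partial>B)"
      by (intro AB.Fubini'[symmetric]) measurable
    also have "\<dots> \<le> 1"
    proof (rule B.nn_integral_le_const)
      fix b assume b [measurable]: "b \<in> space B"
      have "(\<integral>\<^sup>+a'. \<integral>\<^sup>+b'. \<integral>\<^sup>+w. e12 a' b' (out a b w) \<partial>W \<partial>B \<partial>A)
         = (\<integral>\<^sup>+a'. \<integral>\<^sup>+w. \<integral>\<^sup>+b'. e12 a' b' (out a b w) \<partial>B \<partial>W \<partial>A)"
        by (intro nn_integral_cong BW.Fubini'[symmetric]) measurable
      also have "\<dots> = (\<integral>\<^sup>+w. \<integral>\<^sup>+a'. \<integral>\<^sup>+b'. e12 a' b' (out a b w) \<partial>B \<partial>A \<partial>W)"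
        by (intro AW.Fubini'[symmetric]) measurable
      also have "\<dots> \<le> 1"
        using a b by (intro W.nn_integral_le_const int_e12 out_space)
      finally show "(\<integral>\<^sup>+a'. \<integral>\<^sup>+b'. \<integral>\<^sup>+w. e12 a' b' (out a b w) \<partial>W \<partial>B \<partial>A) \<le> 1" .
    qed
    finally show "(\<integral>\<^sup>+a'. \<integral>\<^sup>+b. \<integral>\<^sup>+b'. \<integral>\<^sup>+w. e12 a' b' (out a b w) \<partial>W \<partial>B \<partial>B \<partial>A) \<le> 1" .
  qed
  finally show ?thesis .
qed

lemma true_pair_q:
  assumes m: "m1 < (M1::nat)" "m2 < (M2::nat)"
  shows "(\<integral>\<^sup>+c1. \<integral>\<^sup>+c2. \<integral>\<^sup>+w. q (c1 m1) (c2 m2) w \<partial>W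
     \<partial>PiM {..<M2} (\<lambda>_. B) \<partial>PiM {..<M1} (\<lambda>_. A)) = (\<integral>\<^sup>+a. \<integral>\<^sup>+b. \<integral>\<^sup>+w. q a b w \<partial>W \<partial>B \<partial>A)" (is "?L = _")
proof -
  have "?L = (\<integral>\<^sup>+c1. \<integral>\<^sup>+b. \<integral>\<^sup>+w. q (c1 m1) b w \<partial>W \<partial>B \<partial>PiM {..<M1} (\<lambda>_. A))"
  proof (intro nn_integral_cong)
    fix c1 assume "c1 \<in> space (PiM {..<M1} (\<lambda>_. A))"
    then have [measurable]: "c1 m1 \<in> space A"
      using m by (auto simp: space_PiM PiE_iff)
    show "(\<integral>\<^sup>+c2. \<integral>\<^sup>+w. q (c1 m1) (c2 m2) w \<partial>W \<partial>PiM {..<M2} (\<lambda>_. B))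
      = (\<integral>\<^sup>+b. \<integral>\<^sup>+w. q (c1 m1) b w \<partial>W \<partial>B)"
      using m by (intro nn_integral_PiM_component[OF B.prob_space_axioms,
        where f = "\<lambda>b. \<integral>\<^sup>+w. q (c1 m1) b w \<partial>W"]) auto
  qed
  also have "\<dots> = (\<integral>\<^sup>+a. \<integral>\<^sup>+b. \<integral>\<^sup>+w. q a b w \<partial>W \<partial>B \<partial>A)"
    using m by (intro nn_integral_PiM_component[OF A.prob_space_axioms,
        where f = "\<lambda>a. \<integral>\<^sup>+b. \<integral>\<^sup>+w. q a b w \<partial>W \<partial>B"]) auto
  finally show ?thesis .
qed


text \<open>The mean over random codebooks is below \<open>D\<close>, so some codebook does at least
  as well. The conclusion keeps \<open>q\<close> next to the error indicator, and this is the source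
  of \<open>2 * Q\<close>: one copy bounds the failure of the true pair, the other is passed on for
  the energy constraint.\<close>

lemma random_coding:
  assumes Q: "(\<integral>\<^sup>+a. \<integral>\<^sup>+b. \<integral>\<^sup>+w. q a b w \<partial>W \<partial>B \<partial>A) \<le> ennreal Q" "0 \<le> Q"
    and M: "1 \<le> M1" "1 \<le> M2"
    and D: "2 * Q + real M1 / t1 + real M2 / t2 + real M1 * real M2 / t12 < D"
  obtains c1 c2 where "\<And>m. c1 m \<in> space A" "\<And>m. c2 m \<in> space B"
    "(\<Sum>m1<M1. \<Sum>m2<M2. \<integral>\<^sup>+w. of_bool (ambiguous M1 M2 c1 c2 m1 m2 (out (c1 m1) (c2 m2) w))
        + q (c1 m1) (c2 m2) w \<partial>W) \<le> ennreal (real M1 * real M2 * D)"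
proof -
  let ?CA = "PiM {..<M1} (\<lambda>_. A)" and ?CB = "PiM {..<M2} (\<lambda>_. B)"
  interpret CA: prob_space ?CA by (intro prob_space_PiM A.prob_space_axioms)
  interpret CB: prob_space ?CB by (intro prob_space_PiM B.prob_space_axioms)
  let ?P = "?CA \<Otimes>\<^sub>M ?CB \<Otimes>\<^sub>M W"
  define G where "G m1 m2 = (\<lambda>(c1, c2, w). let y = out (c1 m1) (c2 m2) w in
      q (c1 m1) (c2 m2) w + q (c1 m1) (c2 m2) w
    + (\<Sum>m1'\<in>{..<M1} - {m1}. e1 (c1 m1') (c2 m2) y / ennreal t1)
    + (\<Sum>m2'\<in>{..<M2} - {m2}. e2 (c1 m1) (c2 m2') y / ennreal t2)
    + (\<Sum>m1'\<in>{..<M1} - {m1}. \<Sum>m2'\<in>{..<M2} - {m2}. e12 (c1 m1') (c2 m2') y / ennreal t12))"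
    for m1 m2
  define D0 where "D0 = 2 * Q + real M1 / t1 + real M2 / t2 + real M1 * real M2 / t12"
  have D0: "0 \<le> D0" using Q(2) thr_pos by (simp add: D0_def)
  have ms: "(\<lambda>(c1, c2, w). q (c1 m1) (c2 m2) w) \<in> borel_measurable ?P"
    "(\<lambda>(c1, c2, w). e1 (c1 m1') (c2 m2) (out (c1 m1) (c2 m2) w)) \<in> borel_measurable ?P"
    "(\<lambda>(c1, c2, w). e2 (c1 m1) (c2 m2') (out (c1 m1) (c2 m2) w)) \<in> borel_measurable ?P"
    "(\<lambda>(c1, c2, w). e12 (c1 m1') (c2 m2') (out (c1 m1) (c2 m2) w)) \<in> borel_measurable ?P"
    if m: "m1 < M1" "m2 < M2" "m1' < M1" "m2' < M2" for m1 m2 m1' m2'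
  proof -
    have [measurable]: "(\<lambda>c. c m1) \<in> measurable ?CA A" "(\<lambda>c. c m1') \<in> measurable ?CA A"
      "(\<lambda>c. c m2) \<in> measurable ?CB B" "(\<lambda>c. c m2') \<in> measurable ?CB B"
      using m by (auto intro: measurable_component_singleton)
    show "(\<lambda>(c1, c2, w). q (c1 m1) (c2 m2) w) \<in> borel_measurable ?P"
      "(\<lambda>(c1, c2, w). e1 (c1 m1') (c2 m2) (out (c1 m1) (c2 m2) w)) \<in> borel_measurable ?P"
      "(\<lambda>(c1, c2, w). e2 (c1 m1) (c2 m2') (out (c1 m1) (c2 m2) w)) \<in> borel_measurable ?P"
      "(\<lambda>(c1, c2, w). e12 (c1 m1') (c2 m2') (out (c1 m1) (c2 m2) w)) \<in> borel_measurable ?P"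
      by measurable
  qed
  note triple = nn_integral_triple[OF CB.prob_space_axioms W.prob_space_axioms]
  have G_eq: "G m1 m2 = (\<lambda>p. (case p of (c1, c2, w) \<Rightarrow> q (c1 m1) (c2 m2) w)
     + (case p of (c1, c2, w) \<Rightarrow> q (c1 m1) (c2 m2) w)
    + (\<Sum>m1'\<in>{..<M1} - {m1}. (case p of (c1, c2, w) \<Rightarrow> e1 (c1 m1') (c2 m2) (out (c1 m1) (c2 m2) w)) / ennreal t1)
    + (\<Sum>m2'\<in>{..<M2} - {m2}. (case p of (c1, c2, w) \<Rightarrow> e2 (c1 m1) (c2 m2') (out (c1 m1) (c2 m2) w)) / ennreal t2)
    + (\<Sum>m1'\<in>{..<M1} - {m1}. \<Sum>m2'\<in>{..<M2} - {m2}.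
        (case p of (c1, c2, w) \<Rightarrow> e12 (c1 m1') (c2 m2') (out (c1 m1) (c2 m2) w)) / ennreal t12))" for m1 m2
    by (auto simp: G_def Let_def fun_eq_iff)
  have G_meas: "G m1 m2 \<in> borel_measurable ?P" if m: "m1 < M1" "m2 < M2" for m1 m2
    unfolding G_eq by (intro borel_measurable_add borel_measurable_sum borel_measurable_divide_ennreal
        borel_measurable_const ms) (use m in auto)
  have frac: "ennreal (1 / t) = 1 / ennreal t" if "0 < t" for t
    using that by (simp add: divide_ennreal[symmetric])
  have G_int: "(\<integral>\<^sup>+p. G m1 m2 p \<partial>?P) \<le> ennreal D0" if m: "m1 < M1" "m2 < M2" for m1 m2
  proof -
    have i1: "(\<integral>\<^sup>+p. (case p of (c1, c2, w) \<Rightarrow> e1 (c1 m1') (c2 m2) (out (c1 m1) (c2 m2) w)) \<partial>?P) \<le> 1"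
      if "m1' \<in> {..<M1} - {m1}" for m1'
      using cross_e1[of m1 M1 m2 M2 m1'] m that by (subst triple) (auto intro: ms)
    have i2: "(\<integral>\<^sup>+p. (case p of (c1, c2, w) \<Rightarrow> e2 (c1 m1) (c2 m2') (out (c1 m1) (c2 m2) w)) \<partial>?P) \<le> 1"
      if "m2' \<in> {..<M2} - {m2}" for m2'
      using cross_e2[of m1 M1 m2 M2 m2'] m that by (subst triple) (auto intro: ms)
    have i12: "(\<integral>\<^sup>+p. (case p of (c1, c2, w) \<Rightarrow> e12 (c1 m1') (c2 m2') (out (c1 m1) (c2 m2) w)) \<partial>?P) \<le> 1"
      if "m1' \<in> {..<M1} - {m1}" "m2' \<in> {..<M2} - {m2}" for m1' m2'
      using cross_e12[of m1 M1 m2 M2 m1' m2'] m that by (subst triple) (auto intro: ms)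
    have iq: "(\<integral>\<^sup>+p. (case p of (c1, c2, w) \<Rightarrow> q (c1 m1) (c2 m2) w) \<partial>?P) \<le> ennreal Q"
      using true_pair_q[OF m] Q(1) ms(1)[OF m m] by (subst triple) auto
    define f1 f2 f12 f0 where "f1 i p = (case p of (c1, c2, w) \<Rightarrow> e1 (c1 i) (c2 m2) (out (c1 m1) (c2 m2) w))"
      and "f2 j p = (case p of (c1, c2, w) \<Rightarrow> e2 (c1 m1) (c2 j) (out (c1 m1) (c2 m2) w))"
      and "f12 i j p = (case p of (c1, c2, w) \<Rightarrow> e12 (c1 i) (c2 j) (out (c1 m1) (c2 m2) w))"
      and "f0 p = (case p of (c1, c2, w) \<Rightarrow> q (c1 m1) (c2 m2) w)"
    for i j p
    have f: "f0 \<in> borel_measurable ?P" "i < M1 \<Longrightarrow> f1 i \<in> borel_measurable ?P"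
      "j < M2 \<Longrightarrow> f2 j \<in> borel_measurable ?P"
      "i < M1 \<Longrightarrow> j < M2 \<Longrightarrow> f12 i j \<in> borel_measurable ?P" for i j
      using ms[OF m] m unfolding f0_def f1_def f2_def f12_def by blast+
    have s1: "(\<integral>\<^sup>+p. (\<Sum>i\<in>{..<M1} - {m1}. f1 i p / ennreal t1) \<partial>?P) = (\<Sum>i\<in>{..<M1} - {m1}. (\<integral>\<^sup>+p. f1 i p \<partial>?P) / ennreal t1)"
      by (subst nn_integral_sum) (auto intro!: borel_measurable_divide_ennreal sum.cong nn_integral_divide f)
    have s2: "(\<integral>\<^sup>+p. (\<Sum>i\<in>{..<M2} - {m2}. f2 i p / ennreal t2) \<partial>?P) = (\<Sum>i\<in>{..<M2} - {m2}. (\<integral>\<^sup>+p. f2 i p \<partial>?P) / ennreal t2)"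
      by (subst nn_integral_sum) (auto intro!: borel_measurable_divide_ennreal sum.cong nn_integral_divide f)
    have s12': "(\<integral>\<^sup>+p. (\<Sum>j\<in>{..<M2} - {m2}. f12 i j p / ennreal t12) \<partial>?P)
        = (\<Sum>j\<in>{..<M2} - {m2}. (\<integral>\<^sup>+p. f12 i j p \<partial>?P) / ennreal t12)" if "i < M1" for i
      using that by (subst nn_integral_sum) (auto intro!: borel_measurable_divide_ennreal sum.cong nn_integral_divide f)
    have s12: "(\<integral>\<^sup>+p. (\<Sum>i\<in>{..<M1} - {m1}. \<Sum>j\<in>{..<M2} - {m2}. f12 i j p / ennreal t12) \<partial>?P)
        = (\<Sum>i\<in>{..<M1} - {m1}. \<Sum>j\<in>{..<M2} - {m2}. (\<integral>\<^sup>+p. f12 i j p \<partial>?P) / ennreal t12)"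
      by (subst nn_integral_sum)
        (auto intro!: borel_measurable_divide_ennreal borel_measurable_sum sum.cong s12' f)
    have sm: "(\<lambda>p. \<Sum>i\<in>{..<M1} - {m1}. f1 i p / ennreal t1) \<in> borel_measurable ?P"
      "(\<lambda>p. \<Sum>i\<in>{..<M2} - {m2}. f2 i p / ennreal t2) \<in> borel_measurable ?P"
      "(\<lambda>p. \<Sum>i\<in>{..<M1} - {m1}. \<Sum>j\<in>{..<M2} - {m2}. f12 i j p / ennreal t12) \<in> borel_measurable ?P"
      by (auto intro!: borel_measurable_sum borel_measurable_divide_ennreal f)
    have "(\<integral>\<^sup>+p. G m1 m2 p \<partial>?P) = (\<integral>\<^sup>+p. f0 p \<partial>?P) + (\<integral>\<^sup>+p. f0 p \<partial>?P)
      + (\<Sum>i\<in>{..<M1} - {m1}. (\<integral>\<^sup>+p. f1 i p \<partial>?P) / ennreal t1)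
      + (\<Sum>i\<in>{..<M2} - {m2}. (\<integral>\<^sup>+p. f2 i p \<partial>?P) / ennreal t2)
      + (\<Sum>i\<in>{..<M1} - {m1}. \<Sum>j\<in>{..<M2} - {m2}. (\<integral>\<^sup>+p. f12 i j p \<partial>?P) / ennreal t12)"
      unfolding G_eq f0_def[symmetric] f1_def[symmetric] f2_def[symmetric] f12_def[symmetric]
        s1[symmetric] s2[symmetric] s12[symmetric]
      using sm f(1) by (simp add: nn_integral_add)
    also have "\<dots> \<le> ennreal Q + ennreal Q + (\<Sum>m1'\<in>{..<M1} - {m1}. 1 / ennreal t1)
       + (\<Sum>m2'\<in>{..<M2} - {m2}. 1 / ennreal t2)
       + (\<Sum>m1'\<in>{..<M1} - {m1}. \<Sum>m2'\<in>{..<M2} - {m2}. 1 / ennreal t12)"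
      unfolding f0_def f1_def f2_def f12_def
      by (intro add_mono sum_mono divide_right_mono_ennreal i1 i2 i12 iq)
    also have "\<dots> = ennreal (Q + Q + (\<Sum>m1'\<in>{..<M1} - {m1}. 1 / t1)
       + (\<Sum>m2'\<in>{..<M2} - {m2}. 1 / t2)
       + (\<Sum>m1'\<in>{..<M1} - {m1}. \<Sum>m2'\<in>{..<M2} - {m2}. 1 / t12))"
    proof -
      have "ennreal (2 * Q) = ennreal Q + ennreal Q"
        using Q(2) by (simp flip: ennreal_plus)
      then show ?thesis
        using thr_pos Q(2) by (simp add: frac[symmetric] ennreal_plus sum_nonneg del: sum_constant)
    qed
    also have "\<dots> \<le> ennreal D0"
    proof (intro ennreal_leI)
      have c: "real (M1 - 1) * (1 / t1) \<le> real M1 / t1" "real (M2 - 1) * (1 / t2) \<le> real M2 / t2"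
        using thr_pos by (auto simp: field_simps)
      have "real (M1 - 1) * real (M2 - 1) \<le> real M1 * real M2"
        by (intro mult_mono) auto
      then have "real (M1 - 1) * (real (M2 - 1) * (1 / t12)) \<le> real M1 * real M2 / t12"
        using thr_pos by (simp add: field_simps)
      with c show "Q + Q + (\<Sum>m1'\<in>{..<M1} - {m1}. 1 / t1)
       + (\<Sum>m2'\<in>{..<M2} - {m2}. 1 / t2)
       + (\<Sum>m1'\<in>{..<M1} - {m1}. \<Sum>m2'\<in>{..<M2} - {m2}. 1 / t12) \<le> D0"
        using m by (simp add: D0_def)
    qed
    finally show ?thesis .
  qed
  define H where "H p = (\<Sum>m1<M1. \<Sum>m2<M2. G m1 m2 p)" for p
  have H_meas: "H \<in> borel_measurable ?P"
    unfolding H_def by (intro borel_measurable_sum G_meas) auto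
  have "(\<integral>\<^sup>+p. H p \<partial>?P) = (\<Sum>m1<M1. \<Sum>m2<M2. \<integral>\<^sup>+p. G m1 m2 p \<partial>?P)"
    unfolding H_def
    by (subst nn_integral_sum, (intro borel_measurable_sum G_meas; auto; fail),
        intro sum.cong refl nn_integral_sum G_meas) auto
  also have "\<dots> \<le> (\<Sum>m1<M1. \<Sum>m2<M2. ennreal D0)"
    by (intro sum_mono G_int) auto
  also have "\<dots> = ennreal (real M1 * real M2 * D0)"
    using D0 by (simp add: ennreal_mult ennreal_of_nat_eq_real_of_nat mult.assoc)
  also have "\<dots> < ennreal (real M1 * real M2 * D)"
  proof (intro ennreal_lessI)
    have "D0 < D" using D by (simp add: D0_def)
    then show "0 < real M1 * real M2 * D" "real M1 * real M2 * D0 < real M1 * real M2 * D"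
      using M D0 by auto
  qed
  finally have "(\<integral>\<^sup>+c1. \<integral>\<^sup>+c2. \<integral>\<^sup>+w. H (c1, c2, w) \<partial>W \<partial>?CB \<partial>?CA) < ennreal (real M1 * real M2 * D)"
    by (subst (asm) triple[OF H_meas])
  then obtain c1 where c1: "c1 \<in> space ?CA"
    "(\<integral>\<^sup>+c2. \<integral>\<^sup>+w. H (c1, c2, w) \<partial>W \<partial>?CB) < ennreal (real M1 * real M2 * D)"
    by (rule CA.nn_integral_less_imp_ex)
  from c1(2) obtain c2 where c2: "c2 \<in> space ?CB"
    "(\<integral>\<^sup>+w. H (c1, c2, w) \<partial>W) < ennreal (real M1 * real M2 * D)"
    by (rule CB.nn_integral_less_imp_ex)
  have s1: "c1 m \<in> space A" if "m < M1" for m using c1(1) that by (auto simp: space_PiM PiE_iff)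
  have s2: "c2 m \<in> space B" if "m < M2" for m using c2(1) that by (auto simp: space_PiM PiE_iff)
  have Gw: "(\<lambda>w. G m1 m2 (c1, c2, w)) \<in> borel_measurable W" if "m1 < M1" "m2 < M2" for m1 m2
    using measurable_compose[OF measurable_Pair[OF measurable_const[OF c1(1)]
      measurable_Pair[OF measurable_const[OF c2(1)] measurable_ident]] G_meas[OF that]] by simp
  have "(\<Sum>m1<M1. \<Sum>m2<M2. \<integral>\<^sup>+w. of_bool (ambiguous M1 M2 c1 c2 m1 m2 (out (c1 m1) (c2 m2) w))
        + q (c1 m1) (c2 m2) w \<partial>W) \<le> (\<Sum>m1<M1. \<Sum>m2<M2. \<integral>\<^sup>+w. G m1 m2 (c1, c2, w) \<partial>W)"
  proof (intro sum_mono nn_integral_mono)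
    fix m1 m2 w assume *: "m1 \<in> {..<M1}" "m2 \<in> {..<M2}" "w \<in> space W"
    then show "of_bool (ambiguous M1 M2 c1 c2 m1 m2 (out (c1 m1) (c2 m2) w))
        + q (c1 m1) (c2 m2) w \<le> G m1 m2 (c1, c2, w)"
      using add_right_mono[OF of_bool_ambiguous_le[of c1 m1 c2 m2 w M1 M2], of "q (c1 m1) (c2 m2) w"] s1 s2
      by (simp add: G_def Let_def add_ac)
  qed
  also have "\<dots> = (\<integral>\<^sup>+w. H (c1, c2, w) \<partial>W)"
    unfolding H_def
    by (subst nn_integral_sum, (intro borel_measurable_sum Gw; auto; fail),
        intro sum.cong refl nn_integral_sum[symmetric] Gw) auto
  also have "\<dots> \<le> ennreal (real M1 * real M2 * D)" using c2(2) by simp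
  finally have bound: "(\<Sum>m1<M1. \<Sum>m2<M2. \<integral>\<^sup>+w. of_bool (ambiguous M1 M2 c1 c2 m1 m2 (out (c1 m1) (c2 m2) w))
        + q (c1 m1) (c2 m2) w \<partial>W) \<le> ennreal (real M1 * real M2 * D)" .
  \<comment> \<open>Points of the product space are codewords only at indices below
    \<open>M1\<close> and \<open>M2\<close>. Larger indices are redirected to codeword 0, so that
    \<open>c1 m\<close> and \<open>c2 m\<close> lie in the right space for every natural number
    \<open>m\<close>.\<close>
  define c1' c2' where "c1' m = c1 (if m < M1 then m else 0)" and "c2' m = c2 (if m < M2 then m else 0)" for m
  have "ambiguous M1 M2 c1' c2' m1 m2 y = ambiguous M1 M2 c1 c2 m1 m2 y" if "m1 < M1" "m2 < M2" for m1 m2 y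
    using that by (auto simp: ambiguous_def c1'_def c2'_def)
  with bound have "(\<Sum>m1<M1. \<Sum>m2<M2. \<integral>\<^sup>+w. of_bool (ambiguous M1 M2 c1' c2' m1 m2 (out (c1' m1) (c2' m2) w))
        + q (c1' m1) (c2' m2) w \<partial>W) \<le> ennreal (real M1 * real M2 * D)"
    by (simp add: c1'_def c2'_def)
  then show thesis using s1 s2 M by (intro that[of c1' c2']) (auto simp: c1'_def c2'_def)
qed

end

section \<open>Normal variables in blocks\<close>

lemma prob_space_noise_space: "prob_space (noise_space n)"
  unfolding noise_space_def by (intro prob_space_PiM prob_space_std_normal)

lemma noise_space_component:
  "i < n \<Longrightarrow> (\<lambda>x. x i) \<in> borel_measurable (noise_space n)"
  unfolding noise_space_def
  using measurable_component_singleton[of i "{..<n}" "\<lambda>_. std_normal"] by simp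

text \<open>The pairs of coordinates \<open>k\<close> and \<open>K + k\<close> are disjoint, hence
  independent. Splitting the index set at \<open>K\<close> makes the first entries of all blocks the
  outer integral and the second entries the inner one.\<close>

lemma nn_integral_noise_blocks:
  fixes F :: "nat \<Rightarrow> real \<Rightarrow> real \<Rightarrow> ennreal"
  assumes F: "\<And>k. k < K \<Longrightarrow> (\<lambda>(u, v). F k u v) \<in> borel_measurable (borel \<Otimes>\<^sub>M borel)"
    and n: "2 * K \<le> n"
  shows "(\<integral>\<^sup>+x. (\<Prod>k<K. F k (x k) (x (K + k))) \<partial>noise_space n)
    = (\<Prod>k<K. \<integral>\<^sup>+u. \<integral>\<^sup>+v. F k u v \<partial>std_normal \<partial>std_normal)"
proof -
  interpret S: prob_space std_normal by (rule prob_space_std_normal)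
  interpret P: product_prob_space "\<lambda>_. std_normal" UNIV ..
  note Fm = measurable_uncurry_comp[OF F]
  let ?P = "\<lambda>I. PiM I (\<lambda>_. std_normal)"
  have comp: "(\<lambda>x. x i) \<in> borel_measurable (?P I)" if "i \<in> I" for i :: nat and I
    using measurable_component_singleton[of i I "\<lambda>_. std_normal", OF that] by simp
  have split: "{..<n} = {..<K} \<union> {K..<n}" using n by auto
  have "(\<integral>\<^sup>+x. (\<Prod>k<K. F k (x k) (x (K + k))) \<partial>noise_space n)
    = (\<integral>\<^sup>+x. \<integral>\<^sup>+y. (\<Prod>k<K. F k (merge {..<K} {K..<n} (x, y) k) (merge {..<K} {K..<n} (x, y) (K + k)))
        \<partial>?P {K..<n} \<partial>?P {..<K})"
    unfolding noise_space_def split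
    by (intro P.product_nn_integral_fold borel_measurable_prod_ennreal Fm comp) (use n in auto)
  also have "\<dots> = (\<integral>\<^sup>+x. \<integral>\<^sup>+y. (\<Prod>k<K. F k (x k) (y (K + k))) \<partial>?P {K..<n} \<partial>?P {..<K})"
    using n by (intro nn_integral_cong prod.cong) (auto simp: merge_def)
  also have "\<dots> = (\<integral>\<^sup>+x. (\<Prod>k<K. \<integral>\<^sup>+v. F k (x k) v \<partial>std_normal) \<partial>?P {..<K})"
  proof (intro nn_integral_cong)
    fix x :: "nat \<Rightarrow> real"
    \<comment> \<open>The factor 1 beyond \<open>2 * K\<close> extends the product to all of
      \<open>{K..<n}\<close>; those coordinates integrate to 1.\<close>
    define f where "f j = (if j < 2 * K then F (j - K) (x (j - K)) else (\<lambda>_. 1))" for j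
    have fm: "f j \<in> borel_measurable std_normal" if "K \<le> j" for j
      using that by (auto simp: f_def intro!: Fm)
    have eq: "(\<Prod>k<K. G (K + k)) = (\<Prod>j\<in>{K..<n}. G j)" if "\<And>j. j \<in> {2*K..<n} \<Longrightarrow> G j = 1" for G :: "nat \<Rightarrow> ennreal"
    proof -
      have "(\<Prod>j\<in>{K..<n}. G j) = (\<Prod>j\<in>{K..<2 * K}. G j)"
        using n that by (intro prod.mono_neutral_right) auto
      also have "\<dots> = (\<Prod>k<K. G (K + k))"
        by (rule prod.reindex_bij_witness[of _ "\<lambda>k. K + k" "\<lambda>j. j - K"]) auto
      finally show ?thesis ..
    qed
    have "(\<integral>\<^sup>+y. (\<Prod>k<K. F k (x k) (y (K + k))) \<partial>?P {K..<n}) = (\<integral>\<^sup>+y. (\<Prod>j\<in>{K..<n}. f j (y j)) \<partial>?P {K..<n})"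
      by (intro nn_integral_cong, subst eq[symmetric]) (auto simp: f_def)
    also have "\<dots> = (\<Prod>j\<in>{K..<n}. \<integral>\<^sup>+v. f j v \<partial>std_normal)"
      by (intro P.product_nn_integral_prod fm) auto
    also have "\<dots> = (\<Prod>k<K. \<integral>\<^sup>+v. F k (x k) v \<partial>std_normal)"
      by (subst eq[symmetric]) (auto simp: f_def S.emeasure_space_1[simplified])
    finally show "(\<integral>\<^sup>+y. (\<Prod>k<K. F k (x k) (y (K + k))) \<partial>?P {K..<n}) = (\<Prod>k<K. \<integral>\<^sup>+v. F k (x k) v \<partial>std_normal)" .
  qed
  also have "\<dots> = (\<Prod>k<K. \<integral>\<^sup>+u. \<integral>\<^sup>+v. F k u v \<partial>std_normal \<partial>std_normal)"
    using F by (intro P.product_nn_integral_prod S.borel_measurable_nn_integral)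
      (auto cong: measurable_cong_sets)
  finally show ?thesis .
qed

text \<open>Linear forms in the seven independent normals of a block: \<open>a\<close>, \<open>b\<close> are the codewords of the
  two users, \<open>g\<close> the channel noise and \<open>h\<close> the feedback noise.\<close>

type_synonym coeffs = "real \<times> real \<times> real \<times> real \<times> real \<times> real \<times> real"

fun block_form :: "coeffs \<Rightarrow> nat \<Rightarrow> (nat \<Rightarrow> real) \<Rightarrow> (nat \<Rightarrow> real) \<Rightarrow> (nat \<Rightarrow> real) \<Rightarrow> (nat \<Rightarrow> real) \<Rightarrow> nat \<Rightarrow> real" where
  "block_form (c0, c1, c2, c3, c4, c5, c6) K a b g h k =
     c0 * a k + c1 * a (K + k) + c2 * b k + c3 * b (K + k) + c4 * g k + c5 * g (K + k) + c6 * h k"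

text \<open>Variance of the linear form when its seven variables are independent standard
  normals.\<close>

fun sqnorm :: "coeffs \<Rightarrow> real" where
  "sqnorm (c0, c1, c2, c3, c4, c5, c6) = c0\<^sup>2 + c1\<^sup>2 + c2\<^sup>2 + c3\<^sup>2 + c4\<^sup>2 + c5\<^sup>2 + c6\<^sup>2"

lemma sqnorm_nonneg: "0 \<le> sqnorm c"
  by (cases c) simp

text \<open>Both signs of \<open>s\<close> occur: positive for upper tails of energies, negative for
  lower tails.\<close>

lemma double_mult_less_one_mono:
  fixes s v v' :: real
  assumes "2 * s * v < 1" "v' \<le> v" "0 \<le> v'"
  shows "2 * s * v' < 1"
proof (cases "0 \<le> s")
  case True
  then have "2 * s * v' \<le> 2 * s * v" using assms by (intro mult_left_mono) auto
  then show ?thesis using assms(1) by linarith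
next
  case False
  then have "2 * s * v' \<le> 0" using assms by (simp add: mult_nonpos_nonneg)
  then show ?thesis by linarith
qed

lemma nn_integral_noise_gauss_mgf:
  assumes "2 * s * (v + (c\<^sup>2 + d\<^sup>2)) < 1" "0 \<le> v" "2 * K \<le> n"
  shows "(\<integral>\<^sup>+x. (\<Prod>k<K. ennreal (gauss_mgf s v (y k + c * x k + d * x (K + k)))) \<partial>noise_space n)
    = (\<Prod>k<K. ennreal (gauss_mgf s (v + (c\<^sup>2 + d\<^sup>2)) (y k)))"
proof -
  note mono = double_mult_less_one_mono[OF assms(1)]
  have 1: "2 * s * v < 1" "2 * s * (v + d\<^sup>2) < 1" "2 * s * ((v + d\<^sup>2) + c\<^sup>2) < 1"
    using assms(2) by (auto intro!: mono)
  have "(\<integral>\<^sup>+x. (\<Prod>k<K. ennreal (gauss_mgf s v (y k + c * x k + d * x (K + k)))) \<partial>noise_space n)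
    = (\<Prod>k<K. \<integral>\<^sup>+u. \<integral>\<^sup>+w. ennreal (gauss_mgf s v (y k + c * u + d * w)) \<partial>std_normal \<partial>std_normal)"
    by (rule nn_integral_noise_blocks[where F = "\<lambda>k u w. ennreal (gauss_mgf s v (y k + c * u + d * w))"])
       (auto simp: split_beta' assms)
  also have "\<dots> = (\<Prod>k<K. ennreal (gauss_mgf s (v + (c\<^sup>2 + d\<^sup>2)) (y k)))"
  proof -
    have "v + (c\<^sup>2 + d\<^sup>2) = v + d\<^sup>2 + c\<^sup>2" by simp
    then show ?thesis
      by (simp only: nn_integral_gauss_mgf[OF 1(1,2)] nn_integral_gauss_mgf[OF 1(2,3)])
  qed
  finally show ?thesis .
qed

text \<open>Moment generating function of a scaled chi-square variable with \<open>K\<close> degrees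
  of freedom, since the forms of different blocks are independent normals of variance
  \<open>sqnorm c\<close>.\<close>

lemma nn_integral_block_forms:
  assumes s: "2 * s * sqnorm c < 1" and n: "2 * K \<le> n"
  shows "(\<integral>\<^sup>+a. \<integral>\<^sup>+b. \<integral>\<^sup>+g. \<integral>\<^sup>+h. ennreal (exp (s * (\<Sum>k<K. (block_form c K a b g h k)\<^sup>2)))
     \<partial>noise_space n \<partial>noise_space n \<partial>noise_space n \<partial>noise_space n)
   = ennreal ((1 / sqrt (1 - 2 * s * sqnorm c)) ^ K)"
proof -
  obtain c0 c1 c2 c3 c4 c5 c6 where c: "c = (c0, c1, c2, c3, c4, c5, c6)" by (cases c) auto
  note mono = double_mult_less_one_mono[OF s]
  note m = nn_integral_noise_gauss_mgf[OF mono _ n]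
  have "(\<integral>\<^sup>+a. \<integral>\<^sup>+b. \<integral>\<^sup>+g. \<integral>\<^sup>+h. ennreal (exp (s * (\<Sum>k<K. (block_form c K a b g h k)\<^sup>2)))
     \<partial>noise_space n \<partial>noise_space n \<partial>noise_space n \<partial>noise_space n)
   = (\<integral>\<^sup>+a. \<integral>\<^sup>+b. \<integral>\<^sup>+g. \<integral>\<^sup>+h. (\<Prod>k<K. ennreal (gauss_mgf s 0
       ((0 + c0 * a k + c1 * a (K + k) + c2 * b k + c3 * b (K + k) + c4 * g k + c5 * g (K + k)) + c6 * h k + 0 * h (K + k))))
     \<partial>noise_space n \<partial>noise_space n \<partial>noise_space n \<partial>noise_space n)"
    by (simp add: c sum_distrib_left exp_sum prod_ennreal[symmetric] gauss_mgf_0)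
  \<comment> \<open>The leading \<open>0\<close> and the coefficient 0 of \<open>h (K + k)\<close>
    in the preceding integrand give all four vectors the same shape. One lemma then removes them in
    the order \<open>h\<close>, \<open>g\<close>, \<open>b\<close>, \<open>a\<close>, collecting
    variance.\<close>
  also have "\<dots> = (\<Prod>k<K. ennreal (gauss_mgf s (0 + (c6\<^sup>2 + 0\<^sup>2) + (c4\<^sup>2 + c5\<^sup>2) + (c2\<^sup>2 + c3\<^sup>2) + (c0\<^sup>2 + c1\<^sup>2)) 0))"
    by ((subst m; (simp add: c; fail)?)+)
  also have "0 + (c6\<^sup>2 + 0\<^sup>2) + (c4\<^sup>2 + c5\<^sup>2) + (c2\<^sup>2 + c3\<^sup>2) + (c0\<^sup>2 + c1\<^sup>2) = sqnorm c"
    by (simp add: c)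
  finally show ?thesis
    using s by (simp add: gauss_mgf_def ennreal_power)
qed

text \<open>The logarithms of both expressions vanish at \<open>t = 0\<close> with slope - \<eta>,
  so small \<open>t\<close> works. The explicit choice makes 2 t equal to \<eta> / (2 (1 + \<eta>)),
  half the bound that the first inequality requires after applying 1 + x \<le> exp x; the second is
  then satisfied as well.\<close>

lemma chernoff_rates:
  fixes \<eta> :: real
  assumes "0 < \<eta>"
  obtains t where "0 < t" "t < 1/2" "exp (- t * (1 + \<eta>)) / sqrt (1 - 2 * t) < 1"
    "exp (t * (1 - \<eta>)) / sqrt (1 + 2 * t) < 1"
proof -
  define t where "t = \<eta> / (4 * (1 + \<eta>))"
  have t: "0 < t" "t < 1/4" "4 * t * (1 + \<eta>) = \<eta>"
    using assms by (auto simp: t_def field_simps)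
  have "1 / (1 - 2 * t) = 1 + 2 * t / (1 - 2 * t)" using t by (simp add: field_simps)
  also have "\<dots> \<le> exp (2 * t / (1 - 2 * t))" by (rule exp_ge_add_one_self)
  also have "\<dots> < exp (2 * (t * (1 + \<eta>)))"
  proof -
    have "1 < (1 + \<eta>) * (1 - 2 * t)" using t assms by (simp add: algebra_simps)
    then have "t * 1 < t * ((1 + \<eta>) * (1 - 2 * t))" using t by (intro mult_strict_left_mono)
    then have "t / (1 - 2 * t) < t * (1 + \<eta>)" using t by (simp add: pos_divide_less_eq mult.assoc)
    then show ?thesis by simp
  qed
  finally have "1 / (1 - 2 * t) < (exp (t * (1 + \<eta>)))\<^sup>2"
    by (simp add: power2_eq_square flip: exp_add)
  then have "1 / (exp (t * (1 + \<eta>)))\<^sup>2 < 1 - 2 * t" using t by (simp add: field_simps)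
  then have "(exp (- t * (1 + \<eta>)))\<^sup>2 < 1 - 2 * t" by (simp add: exp_minus divide_inverse power_inverse)
  then have "exp (- t * (1 + \<eta>)) < sqrt (1 - 2 * t)" by (intro real_less_rsqrt)
  then have u: "exp (- t * (1 + \<eta>)) / sqrt (1 - 2 * t) < 1" using t by simp
  have "2 * (t * (1 - \<eta>)) < 2 * t / (1 + 2 * t)"
  proof -
    have "(1 - \<eta>) * (1 + 2 * t) < 1"
    proof -
      have "4 * t + 4 * (t * \<eta>) = \<eta>" using t(3) by (simp add: algebra_simps)
      moreover have "0 < t * \<eta>" using t assms by simp
      ultimately show ?thesis using t by (simp add: algebra_simps)
    qed
    then have "t * ((1 - \<eta>) * (1 + 2 * t)) < t * 1" using t by (intro mult_strict_left_mono)
    then have "t * (1 - \<eta>) < t / (1 + 2 * t)" using t by (simp add: pos_less_divide_eq mult.assoc)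
    then show ?thesis by simp
  qed
  then have "exp (2 * (t * (1 - \<eta>))) < exp (2 * t / (1 + 2 * t))" by simp
  also have "\<dots> \<le> 1 + 2 * t"
  proof -
    have "1 / (1 + 2 * t) = 1 + (- (2 * t / (1 + 2 * t)))" using t by (simp add: field_simps)
    also have "\<dots> \<le> exp (- (2 * t / (1 + 2 * t)))" by (rule exp_ge_add_one_self)
    finally show ?thesis using t by (simp add: exp_minus field_simps)
  qed
  finally have "(exp (t * (1 - \<eta>)))\<^sup>2 < 1 + 2 * t"
    by (simp add: power2_eq_square flip: exp_add)
  then have "exp (t * (1 - \<eta>)) < sqrt (1 + 2 * t)" by (intro real_less_rsqrt)
  then have "exp (t * (1 - \<eta>)) / sqrt (1 + 2 * t) < 1" using t by simp
  with u t show thesis by (intro that[of t]) auto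
qed

text \<open>The logarithm of the product is \<open>K * ln (1 + v / N) / 2\<close> plus output energy
  over \<open>2 * (N + v)\<close> minus noise energy over \<open>2 * N\<close>. The last two would
  cancel at their means, and each typicality bound costs \<open>K * \<eta> / 2\<close>.\<close>

lemma prod_lratio_ge:
  fixes N v \<eta> :: real
  assumes N: "0 < N" "0 \<le> v"
    and noise: "(\<Sum>k<K. (y k - x k)\<^sup>2) \<le> N * (real K * (1 + \<eta>))"
    and sig: "(N + v) * (real K * (1 - \<eta>)) \<le> (\<Sum>k<K. (y k)\<^sup>2)"
  shows "exp (real K * (ln (1 + v / N) / 2 - \<eta>)) \<le> (\<Prod>k<K. lratio N v (x k) (y k))"
proof -
  have pos: "0 < 1 + v / N" using N by (simp add: add_pos_nonneg)
  have "(\<Prod>k<K. lratio N v (x k) (y k))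
     = exp (real K * (ln (1 + v / N) / 2)) * exp ((\<Sum>k<K. (y k)\<^sup>2) / (2 * (N + v)) - (\<Sum>k<K. (y k - x k)\<^sup>2) / (2 * N))"
  proof -
    have "sqrt (1 + v / N) ^ K = exp (real K * (ln (1 + v / N) / 2))"
      using pos by (simp add: exp_of_nat_mult ln_sqrt[symmetric])
    moreover have "(\<Sum>k<K. (y k)\<^sup>2 / (2 * (N + v)) - (y k - x k)\<^sup>2 / (2 * N))
       = (\<Sum>k<K. (y k)\<^sup>2) / (2 * (N + v)) - (\<Sum>k<K. (y k - x k)\<^sup>2) / (2 * N)"
      by (simp add: sum_subtractf sum_divide_distrib)
    ultimately show ?thesis
      unfolding lratio_def prod.distrib by (simp add: exp_sum[symmetric])
  qed
  moreover have "- (real K * \<eta>) \<le> (\<Sum>k<K. (y k)\<^sup>2) / (2 * (N + v)) - (\<Sum>k<K. (y k - x k)\<^sup>2) / (2 * N)"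
  proof -
    have "(\<Sum>k<K. (y k - x k)\<^sup>2) / (2 * N) \<le> real K * (1 + \<eta>) / 2"
      using noise N by (simp add: field_simps)
    moreover have "real K * (1 - \<eta>) / 2 \<le> (\<Sum>k<K. (y k)\<^sup>2) / (2 * (N + v))"
      using sig N by (simp add: field_simps)
    ultimately show ?thesis by (simp add: algebra_simps)
  qed
  ultimately show ?thesis
    by (simp add: exp_add[symmetric] algebra_simps)
qed

section \<open>The two-slot feedback scheme\<close>

text \<open>Block \<open>k < K\<close> consists of the times \<open>k\<close> and \<open>K + k\<close>. The entries \<open>k\<close> and \<open>K + k\<close> of a codeword
  are the symbol sent in both slots and the fresh symbol of the second slot; \<open>b1\<close> and \<open>b2\<close> satisfy
  \<open>a1 b1 + a2 b2 = 0\<close>. The parameters \<open>\<eta>\<close> and \<open>t\<close> are the typicality slack and the Chernoff exponent.\<close>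

locale fb_scheme =
  fixes N s a1 a2 d1 d2 \<kappa> \<alpha> \<eta> t :: real and n :: nat
  assumes N: "0 < N" and s: "0 \<le> s" and a: "0 < a1" "0 < a2" and d: "0 < d1" "0 < d2"
    and \<eta>: "0 < \<eta>" and t: "0 < t" "t < 1/2"
begin

text \<open>For odd \<open>n\<close> one channel use is left over, and both transmitters are silent
  in it.\<close>

abbreviation K :: nat where "K \<equiv> n div 2"
abbreviation b1 :: real where "b1 \<equiv> - (\<kappa> * a2)"
abbreviation b2 :: real where "b2 \<equiv> \<kappa> * a1"
abbreviation \<Omega> :: "(nat \<Rightarrow> real) measure" where "\<Omega> \<equiv> noise_space n"
abbreviation Y :: "(nat \<Rightarrow> real) measure" where "Y \<equiv> PiM {..<n} (\<lambda>_. borel)"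

definition N' :: real where "N' = N + \<alpha>\<^sup>2 * s"

lemma N'_pos: "0 < N'"
  using N s by (simp add: N'_def add_pos_nonneg)

definition first_slot :: "(nat \<Rightarrow> real) \<Rightarrow> (nat \<Rightarrow> real) \<Rightarrow> (nat \<Rightarrow> real) \<Rightarrow> nat \<Rightarrow> real" where
  "first_slot a b g i = a1 * a i + a2 * b i + sqrt N * g i"

definition in1 :: "(nat \<Rightarrow> real) \<Rightarrow> nat \<Rightarrow> real" where
  "in1 a i = (if i < K then a1 * a i else if i < 2 * K then b1 * a (i - K) + d1 * a i else 0)"

definition in2 :: "(nat \<Rightarrow> real) \<Rightarrow> (nat \<Rightarrow> real) \<Rightarrow> nat \<Rightarrow> real" where
  "in2 b v i = (if i < K then a2 * b i
     else if i < 2 * K then b2 * b (i - K) + d2 * b i + \<alpha> * v (i - K) else 0)"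

text \<open>Closed form of the feedback recursion. It exists because the only outputs ever fed back
  are those of the first half, which do not depend on feedback; \<open>chan_out_code\<close> proves
  the agreement with the channel model.\<close>

definition chan :: "(nat \<Rightarrow> real) \<Rightarrow> (nat \<Rightarrow> real) \<Rightarrow> (nat \<Rightarrow> real) \<times> (nat \<Rightarrow> real) \<Rightarrow> nat \<Rightarrow> real" where
  "chan a b w = (\<lambda>i\<in>{..<n}. in1 a i
     + in2 b (\<lambda>j. first_slot a b (fst w) j + sqrt s * snd w j) i + sqrt N * fst w i)"

text \<open>The scores of the individual users discard what the second slot tells about the first symbols.
  This keeps the integrals one-dimensional, and only the sum rate has to be exact.\<close>

definition score1 :: "(nat \<Rightarrow> real) \<Rightarrow> (nat \<Rightarrow> real) \<Rightarrow> (nat \<Rightarrow> real) \<Rightarrow> real" where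
  "score1 a b y = (\<Prod>k<K. lratio N (a1\<^sup>2) (a1 * a k) (y k - a2 * b k) *
     lratio N' (d1\<^sup>2) (d1 * a (K + k)) (y (K + k) - \<alpha> * y k - b1 * a k - b2 * b k - d2 * b (K + k)))"

definition score2 :: "(nat \<Rightarrow> real) \<Rightarrow> (nat \<Rightarrow> real) \<Rightarrow> (nat \<Rightarrow> real) \<Rightarrow> real" where
  "score2 a b y = (\<Prod>k<K. lratio N (a2\<^sup>2) (a2 * b k) (y k - a1 * a k) *
     lratio N' (d2\<^sup>2) (d2 * b (K + k)) (y (K + k) - \<alpha> * y k - b1 * a k - b2 * b k - d1 * a (K + k)))"

text \<open>The first term of the second signal is \<open>b1 * a k + b2 * b k\<close>. Subtracting
  \<open>\<alpha> * y k\<close> leaves a sum independent of the first-slot output, so this product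
  is the full likelihood ratio of the block.\<close>

definition score12 :: "(nat \<Rightarrow> real) \<Rightarrow> (nat \<Rightarrow> real) \<Rightarrow> (nat \<Rightarrow> real) \<Rightarrow> real" where
  "score12 a b y = (\<Prod>k<K. lratio N (a1\<^sup>2 + a2\<^sup>2) (a1 * a k + a2 * b k) (y k) *
     lratio N' (\<kappa>\<^sup>2 * (a1\<^sup>2 + a2\<^sup>2) + d1\<^sup>2 + d2\<^sup>2)
       (\<kappa> * (a1 * b k - a2 * a k) + d1 * a (K + k) + d2 * b (K + k)) (y (K + k) - \<alpha> * y k))"

section \<open>Measurability and means of the scores\<close>

lemma measurable_on_triple:
  fixes F :: "nat \<Rightarrow> real \<Rightarrow> real \<Rightarrow> real \<Rightarrow> real \<Rightarrow> real \<Rightarrow> real \<Rightarrow> real"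
  assumes "\<And>k f1 f2 f3 f4 f5 f6 L. f1 \<in> borel_measurable L \<Longrightarrow> f2 \<in> borel_measurable L \<Longrightarrow>
    f3 \<in> borel_measurable L \<Longrightarrow> f4 \<in> borel_measurable L \<Longrightarrow> f5 \<in> borel_measurable L \<Longrightarrow>
    f6 \<in> borel_measurable L \<Longrightarrow>
    (\<lambda>x :: (nat \<Rightarrow> real) \<times> (nat \<Rightarrow> real) \<times> (nat \<Rightarrow> real). F k (f1 x) (f2 x) (f3 x) (f4 x) (f5 x) (f6 x)) \<in> borel_measurable L"
  shows "(\<lambda>(a, b, y). ennreal (\<Prod>k<K. F k (a k) (a (K + k)) (b k) (b (K + k)) (y k) (y (K + k))))
    \<in> borel_measurable (\<Omega> \<Otimes>\<^sub>M \<Omega> \<Otimes>\<^sub>M Y)"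
proof -
  have "(\<lambda>p. ennreal (\<Prod>k<K. F k (fst p k) (fst p (K + k)) (fst (snd p) k) (fst (snd p) (K + k))
      (snd (snd p) k) (snd (snd p) (K + k)))) \<in> borel_measurable (\<Omega> \<Otimes>\<^sub>M \<Omega> \<Otimes>\<^sub>M Y)"
  proof (intro measurable_compose[OF _ measurable_ennreal] borel_measurable_prod assms)
    fix k assume "k \<in> {..<K}"
    then have *: "k < n" "K + k < n" by auto
    note [measurable] = noise_space_component[OF *(1)] noise_space_component[OF *(2)]
      measurable_component_singleton[of k "{..<n}" "\<lambda>_. borel :: real measure"]
      measurable_component_singleton[of "K + k" "{..<n}" "\<lambda>_. borel :: real measure"]
    from * have [measurable]: "k \<in> {..<n}" "K + k \<in> {..<n}" by auto
    show "(\<lambda>p. fst p k) \<in> borel_measurable (\<Omega> \<Otimes>\<^sub>M \<Omega> \<Otimes>\<^sub>M Y)"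
      "(\<lambda>p. fst p (K + k)) \<in> borel_measurable (\<Omega> \<Otimes>\<^sub>M \<Omega> \<Otimes>\<^sub>M Y)"
      "(\<lambda>p. fst (snd p) k) \<in> borel_measurable (\<Omega> \<Otimes>\<^sub>M \<Omega> \<Otimes>\<^sub>M Y)"
      "(\<lambda>p. fst (snd p) (K + k)) \<in> borel_measurable (\<Omega> \<Otimes>\<^sub>M \<Omega> \<Otimes>\<^sub>M Y)"
      "(\<lambda>p. snd (snd p) k) \<in> borel_measurable (\<Omega> \<Otimes>\<^sub>M \<Omega> \<Otimes>\<^sub>M Y)"
      "(\<lambda>p. snd (snd p) (K + k)) \<in> borel_measurable (\<Omega> \<Otimes>\<^sub>M \<Omega> \<Otimes>\<^sub>M Y)"
      by measurable
  qed
  then show ?thesis by (simp add: split_beta')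
qed

lemma score_measurable:
  "(\<lambda>(a, b, y). ennreal (score12 a b y)) \<in> borel_measurable (\<Omega> \<Otimes>\<^sub>M \<Omega> \<Otimes>\<^sub>M Y)"
  "(\<lambda>(a, b, y). ennreal (score1 a b y)) \<in> borel_measurable (\<Omega> \<Otimes>\<^sub>M \<Omega> \<Otimes>\<^sub>M Y)"
  "(\<lambda>(a, b, y). ennreal (score2 a b y)) \<in> borel_measurable (\<Omega> \<Otimes>\<^sub>M \<Omega> \<Otimes>\<^sub>M Y)"
  unfolding score12_def score1_def score2_def
  by (rule measurable_on_triple, (intro borel_measurable_times lratio_measurable borel_measurable_diff
    borel_measurable_add borel_measurable_const; assumption))+

lemma chan_measurable: "(\<lambda>(a, b, w). chan a b w) \<in> measurable (\<Omega> \<Otimes>\<^sub>M \<Omega> \<Otimes>\<^sub>M (\<Omega> \<Otimes>\<^sub>M \<Omega>)) Y"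
proof -
  have "(\<lambda>p. chan (fst p) (fst (snd p)) (snd (snd p))) \<in> measurable (\<Omega> \<Otimes>\<^sub>M \<Omega> \<Otimes>\<^sub>M (\<Omega> \<Otimes>\<^sub>M \<Omega>)) Y"
    unfolding chan_def
  proof (rule measurable_restrict)
    fix i assume "i \<in> {..<n}"
    then have *: "i < n" "i - K < n" by auto
    note [measurable] = noise_space_component[OF *(1)] noise_space_component[OF *(2)]
    show "(\<lambda>p. in1 (fst p) i + in2 (fst (snd p)) (\<lambda>j. first_slot (fst p) (fst (snd p)) (fst (snd (snd p))) j
        + sqrt s * snd (snd (snd p)) j) i + sqrt N * fst (snd (snd p)) i)
      \<in> borel_measurable (\<Omega> \<Otimes>\<^sub>M \<Omega> \<Otimes>\<^sub>M (\<Omega> \<Otimes>\<^sub>M \<Omega>))"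
      unfolding in1_def in2_def first_slot_def by (cases "i < K"; cases "i < 2 * K"; simp; measurable)
  qed
  then show ?thesis by (simp add: split_beta')
qed

text \<open>The inner integral is 1 at every output, so that output may depend on \<open>u\<close>.
  This is what allows a user's own old symbol to be subtracted in its second-slot score.\<close>

lemma nn_integral_lratio_chain:
  assumes "0 < M" "0 < M'"
  shows "(\<integral>\<^sup>+u. \<integral>\<^sup>+v. ennreal (lratio M (c\<^sup>2) (c * u) y * lratio M' (c'\<^sup>2) (c' * v) (f u)) \<partial>std_normal \<partial>std_normal) = 1"
  using assms
  by (simp add: ennreal_mult lratio_nonneg nn_integral_cmult nn_integral_lratio_single)

lemma int_score1: "(\<integral>\<^sup>+a. ennreal (score1 a b y) \<partial>\<Omega>) = 1"
proof -
  let ?F = "\<lambda>k u v. ennreal (lratio N (a1\<^sup>2) (a1 * u) (y k - a2 * b k) *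
     lratio N' (d1\<^sup>2) (d1 * v) (y (K + k) - \<alpha> * y k - b1 * u - b2 * b k - d2 * b (K + k)))"
  have "(\<integral>\<^sup>+a. ennreal (score1 a b y) \<partial>\<Omega>) = (\<integral>\<^sup>+a. (\<Prod>k<K. ?F k (a k) (a (K + k))) \<partial>\<Omega>)"
    unfolding score1_def using N N'_pos by (subst prod_ennreal) (auto simp: lratio_nonneg)
  also have "\<dots> = (\<Prod>k<K. \<integral>\<^sup>+u. \<integral>\<^sup>+v. ?F k u v \<partial>std_normal \<partial>std_normal)"
    by (rule nn_integral_noise_blocks) (auto simp: split_beta')
  also have "\<dots> = 1"
    using N N'_pos by (simp only: nn_integral_lratio_chain prod.neutral_const)
  finally show ?thesis .
qed

lemma int_score2: "(\<integral>\<^sup>+b. ennreal (score2 a b y) \<partial>\<Omega>) = 1"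
proof -
  let ?F = "\<lambda>k u v. ennreal (lratio N (a2\<^sup>2) (a2 * u) (y k - a1 * a k) *
     lratio N' (d2\<^sup>2) (d2 * v) (y (K + k) - \<alpha> * y k - b1 * a k - b2 * u - d1 * a (K + k)))"
  have "(\<integral>\<^sup>+b. ennreal (score2 a b y) \<partial>\<Omega>) = (\<integral>\<^sup>+b. (\<Prod>k<K. ?F k (b k) (b (K + k))) \<partial>\<Omega>)"
    unfolding score2_def using N N'_pos by (subst prod_ennreal) (auto simp: lratio_nonneg)
  also have "\<dots> = (\<Prod>k<K. \<integral>\<^sup>+u. \<integral>\<^sup>+v. ?F k u v \<partial>std_normal \<partial>std_normal)"
    by (rule nn_integral_noise_blocks) (auto simp: split_beta')
  also have "\<dots> = 1"
    using N N'_pos by (simp only: nn_integral_lratio_chain prod.neutral_const)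
  finally show ?thesis .
qed

text \<open>The fresh symbols \<open>v'\<close> and \<open>u'\<close> are averaged out first; each
  moves its variance from the signal to the noise of the second ratio. What remains is the
  orthogonal pair, with second noise variance \<open>N' + d2^2 + d1^2\<close>.\<close>

lemma int_score12_letter:
  "(\<integral>\<^sup>+u. \<integral>\<^sup>+u'. \<integral>\<^sup>+v. \<integral>\<^sup>+v'. ennreal (lratio N (a1\<^sup>2 + a2\<^sup>2) (a1 * u + a2 * v) y *
     lratio N' (\<kappa>\<^sup>2 * (a1\<^sup>2 + a2\<^sup>2) + d1\<^sup>2 + d2\<^sup>2) (\<kappa> * (a1 * v - a2 * u) + d1 * u' + d2 * v') z)
    \<partial>std_normal \<partial>std_normal \<partial>std_normal \<partial>std_normal) = 1" (is "?L = 1")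
proof -
  interpret S: prob_space std_normal by (rule prob_space_std_normal)
  interpret SS: pair_sigma_finite std_normal std_normal ..
  define r where "r = a1\<^sup>2 + a2\<^sup>2"
  have r: "0 \<le> r" by (simp add: r_def)
  have pos: "0 < N'" "0 < N' + d2\<^sup>2" "0 < N' + d2\<^sup>2 + d1\<^sup>2" "0 \<le> \<kappa>\<^sup>2 * r + d1\<^sup>2" "0 \<le> \<kappa>\<^sup>2 * r" "0 \<le> \<kappa>\<^sup>2 * r + d1\<^sup>2 + d2\<^sup>2"
    using N'_pos r by (auto intro!: add_pos_nonneg)
  have "?L = (\<integral>\<^sup>+u. \<integral>\<^sup>+u'. \<integral>\<^sup>+v. ennreal (lratio N r (a1 * u + a2 * v) y) *
     ennreal (lratio (N' + d2\<^sup>2) (\<kappa>\<^sup>2 * r + d1\<^sup>2) (\<kappa> * (a1 * v - a2 * u) + d1 * u') z)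
    \<partial>std_normal \<partial>std_normal \<partial>std_normal)"
    unfolding r_def[symmetric] using N r pos
    by (simp add: ennreal_mult lratio_nonneg nn_integral_cmult nn_integral_lratio[OF pos(1,4)])
  also have "\<dots> = (\<integral>\<^sup>+u. \<integral>\<^sup>+v. \<integral>\<^sup>+u'. ennreal (lratio N r (a1 * u + a2 * v) y) *
     ennreal (lratio (N' + d2\<^sup>2) (\<kappa>\<^sup>2 * r + d1\<^sup>2) (\<kappa> * (a1 * v - a2 * u) + d1 * u') z)
    \<partial>std_normal \<partial>std_normal \<partial>std_normal)"
    by (intro nn_integral_cong SS.Fubini') (simp add: split_beta')
  also have "\<dots> = (\<integral>\<^sup>+u. \<integral>\<^sup>+v. ennreal (lratio N r (a1 * u + a2 * v) y *
     lratio (N' + d2\<^sup>2 + d1\<^sup>2) (\<kappa>\<^sup>2 * r) (\<kappa> * (a1 * v - a2 * u)) z)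
    \<partial>std_normal \<partial>std_normal)"
    using N r pos by (simp add: ennreal_mult lratio_nonneg nn_integral_cmult nn_integral_lratio[OF pos(2,5)])
  also have "\<dots> = 1"
    unfolding r_def by (rule nn_integral_lratio_orthogonal[OF N pos(3)])
  finally show ?thesis .
qed

lemma int_score12: "(\<integral>\<^sup>+a. \<integral>\<^sup>+b. ennreal (score12 a b y) \<partial>\<Omega> \<partial>\<Omega>) = 1"
proof -
  interpret S: prob_space std_normal by (rule prob_space_std_normal)
  let ?F = "\<lambda>k u u' v v'. ennreal (lratio N (a1\<^sup>2 + a2\<^sup>2) (a1 * u + a2 * v) (y k) *
     lratio N' (\<kappa>\<^sup>2 * (a1\<^sup>2 + a2\<^sup>2) + d1\<^sup>2 + d2\<^sup>2) (\<kappa> * (a1 * v - a2 * u) + d1 * u' + d2 * v') (y (K + k) - \<alpha> * y k))"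
  have "0 \<le> \<kappa>\<^sup>2 * (a1\<^sup>2 + a2\<^sup>2) + d1\<^sup>2 + d2\<^sup>2" by simp
  then have "(\<integral>\<^sup>+a. \<integral>\<^sup>+b. ennreal (score12 a b y) \<partial>\<Omega> \<partial>\<Omega>)
    = (\<integral>\<^sup>+a. \<integral>\<^sup>+b. (\<Prod>k<K. ?F k (a k) (a (K + k)) (b k) (b (K + k))) \<partial>\<Omega> \<partial>\<Omega>)"
    unfolding score12_def using N N'_pos by (subst prod_ennreal) (auto simp: lratio_nonneg)
  also have "\<dots> = (\<integral>\<^sup>+a. (\<Prod>k<K. \<integral>\<^sup>+v. \<integral>\<^sup>+v'. ?F k (a k) (a (K + k)) v v' \<partial>std_normal \<partial>std_normal) \<partial>\<Omega>)"
    by (intro nn_integral_cong nn_integral_noise_blocks) (auto simp: split_beta')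
  also have "\<dots> = (\<Prod>k<K. \<integral>\<^sup>+u. \<integral>\<^sup>+u'. \<integral>\<^sup>+v. \<integral>\<^sup>+v'. ?F k u u' v v' \<partial>std_normal \<partial>std_normal \<partial>std_normal \<partial>std_normal)"
    by (rule nn_integral_noise_blocks[where F = "\<lambda>k u u'. \<integral>\<^sup>+v. \<integral>\<^sup>+v'. ?F k u u' v v' \<partial>std_normal \<partial>std_normal"])
      (auto simp: split_beta')
  also have "\<dots> = 1"
    by (simp only: int_score12_letter prod.neutral_const)
  finally show ?thesis .
qed

end

section \<open>Typical behaviour of the true codewords\<close>

lemma card_six_le: "card {x1, x2, x3, x4, x5, x6} \<le> 6"
  using card_length[of "[x1, x2, x3, x4, x5, x6]"] by simp

context fb_scheme
begin

text \<open>The forms whose empirical energy must not be too large (noises and channel inputs) and those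
  whose empirical energy must not be too small (outputs, possibly with one user removed).\<close>

definition Up :: "coeffs set" where
  "Up = {(0, 0, 0, 0, sqrt N, 0, 0), (0, 0, 0, 0, 0, sqrt N, \<alpha> * sqrt s),
         (a1, 0, 0, 0, 0, 0, 0), (b1, d1, 0, 0, 0, 0, 0), (0, 0, a2, 0, 0, 0, 0),
         (\<alpha> * a1, 0, b2 + \<alpha> * a2, d2, \<alpha> * sqrt N, 0, \<alpha> * sqrt s)}"

definition Lo :: "coeffs set" where
  "Lo = {(a1, 0, a2, 0, sqrt N, 0, 0), (b1, d1, b2, d2, 0, sqrt N, \<alpha> * sqrt s),
         (a1, 0, 0, 0, sqrt N, 0, 0), (0, d1, 0, 0, 0, sqrt N, \<alpha> * sqrt s),
         (0, 0, a2, 0, sqrt N, 0, 0), (0, 0, 0, d2, 0, sqrt N, \<alpha> * sqrt s)}"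

definition form_sum :: "coeffs \<Rightarrow> (nat \<Rightarrow> real) \<Rightarrow> (nat \<Rightarrow> real) \<Rightarrow> (nat \<Rightarrow> real) \<times> (nat \<Rightarrow> real) \<Rightarrow> real" where
  "form_sum c a b w = (\<Sum>k<K. (block_form c K a b (fst w) (snd w) k)\<^sup>2)"

text \<open>\<open>over\<close> and \<open>under\<close> majorize the indicators of too large and
  too small energy. Exponentials are used because their means are explicit and because
  \<open>over\<close> also dominates the excess energy itself, which an indicator does not.\<close>

definition over :: "coeffs \<Rightarrow> (nat \<Rightarrow> real) \<Rightarrow> (nat \<Rightarrow> real) \<Rightarrow> (nat \<Rightarrow> real) \<times> (nat \<Rightarrow> real) \<Rightarrow> real" where
  "over c a b w = exp (t * (form_sum c a b w / sqnorm c - real K * (1 + \<eta>)))"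

definition under :: "coeffs \<Rightarrow> (nat \<Rightarrow> real) \<Rightarrow> (nat \<Rightarrow> real) \<Rightarrow> (nat \<Rightarrow> real) \<times> (nat \<Rightarrow> real) \<Rightarrow> real" where
  "under c a b w = exp (- t * (form_sum c a b w / sqnorm c - real K * (1 - \<eta>)))"

definition penalty :: "(nat \<Rightarrow> real) \<Rightarrow> (nat \<Rightarrow> real) \<Rightarrow> (nat \<Rightarrow> real) \<times> (nat \<Rightarrow> real) \<Rightarrow> real" where
  "penalty a b w = (\<Sum>c\<in>Up. over c a b w) + (\<Sum>c\<in>Lo. under c a b w)"

lemma finite_Up: "finite Up" and finite_Lo: "finite Lo"
  by (simp_all add: Up_def Lo_def)

lemma card_Up: "card Up \<le> 6" and card_Lo: "card Lo \<le> 6"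
  by (simp_all only: Up_def Lo_def card_six_le)

lemma sqnorm_eq_0:
  "sqnorm (c0, c1, c2, c3, c4, c5, c6) = 0 \<longleftrightarrow>
    c0 = 0 \<and> c1 = 0 \<and> c2 = 0 \<and> c3 = 0 \<and> c4 = 0 \<and> c5 = 0 \<and> c6 = 0"
  by (auto simp: add_nonneg_eq_0_iff)

lemma sqnorm_pos: "c \<in> Up \<union> Lo \<Longrightarrow> 0 < sqnorm c"
  using N a d sqnorm_nonneg[of c] sqnorm_eq_0
  by (intro le_neq_trans) (auto simp: Up_def Lo_def simp del: sqnorm.simps)

lemma penalty_nonneg: "0 \<le> penalty a b w"
  unfolding penalty_def over_def under_def by (intro add_nonneg_nonneg sum_nonneg) auto

lemma over_le_penalty: "c \<in> Up \<Longrightarrow> over c a b w \<le> penalty a b w"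
proof -
  assume c: "c \<in> Up"
  have "over c a b w \<le> (\<Sum>c\<in>Up. over c a b w)"
    using c by (intro member_le_sum[of c Up "\<lambda>c. over c a b w"]) (auto simp: over_def finite_Up)
  moreover have "0 \<le> (\<Sum>c\<in>Lo. under c a b w)" by (intro sum_nonneg) (simp add: under_def)
  ultimately show ?thesis unfolding penalty_def by linarith
qed

lemma under_le_penalty: "c \<in> Lo \<Longrightarrow> under c a b w \<le> penalty a b w"
proof -
  assume c: "c \<in> Lo"
  have "under c a b w \<le> (\<Sum>c\<in>Lo. under c a b w)"
    using c by (intro member_le_sum[of c Lo "\<lambda>c. under c a b w"]) (auto simp: under_def finite_Lo)
  moreover have "0 \<le> (\<Sum>c\<in>Up. over c a b w)" by (intro sum_nonneg) (simp add: over_def)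
  ultimately show ?thesis unfolding penalty_def by linarith
qed

lemma form_sum_le_of_penalty:
  assumes "penalty a b w < 1" "c \<in> Up"
  shows "form_sum c a b w \<le> sqnorm c * (real K * (1 + \<eta>))"
proof -
  have "over c a b w < 1" using over_le_penalty[OF assms(2)] assms(1) by (meson le_less_trans)
  then have "form_sum c a b w / sqnorm c < real K * (1 + \<eta>)"
    using t by (simp add: over_def mult_less_0_iff)
  then show ?thesis using sqnorm_pos[of c] assms(2) by (simp add: field_simps)
qed

lemma form_sum_ge_of_penalty:
  assumes "penalty a b w < 1" "c \<in> Lo"
  shows "sqnorm c * (real K * (1 - \<eta>)) \<le> form_sum c a b w"
proof -
  have "under c a b w < 1" using under_le_penalty[OF assms(2)] assms(1) by (meson le_less_trans)
  then have "real K * (1 - \<eta>) < form_sum c a b w / sqnorm c"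
    using t by (simp add: under_def zero_less_mult_iff)
  then show ?thesis using sqnorm_pos[of c] assms(2) by (simp add: field_simps)
qed

text \<open>Valid without any typicality assumption: x \<le> exp (t x) / t turns the Chernoff weight
  into a linear bound on the excess energy. Mean energies are thereby controlled on atypical events
  too.\<close>

lemma form_sum_le_penalty:
  assumes "c \<in> Up"
  shows "form_sum c a b w \<le> sqnorm c * (real K * (1 + \<eta>) + penalty a b w / t)"
proof -
  define x where "x = form_sum c a b w / sqnorm c - real K * (1 + \<eta>)"
  have "t * x \<le> exp (t * x)" using exp_ge_add_one_self[of "t * x"] by linarith
  also have "\<dots> \<le> penalty a b w" using over_le_penalty[OF assms, of a b w] by (simp add: over_def x_def)
  finally have "x \<le> penalty a b w / t" using t by (simp add: field_simps)
  then have "form_sum c a b w / sqnorm c \<le> real K * (1 + \<eta>) + penalty a b w / t"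
    by (simp add: x_def)
  then show ?thesis using sqnorm_pos[of c] assms by (simp add: pos_divide_le_eq mult.commute)
qed

lemma form_sum_measurable:
  "(\<lambda>(a, b, w). form_sum c a b w) \<in> borel_measurable (\<Omega> \<Otimes>\<^sub>M \<Omega> \<Otimes>\<^sub>M (\<Omega> \<Otimes>\<^sub>M \<Omega>))"
proof -
  have "(\<lambda>p. form_sum c (fst p) (fst (snd p)) (snd (snd p))) \<in> borel_measurable (\<Omega> \<Otimes>\<^sub>M \<Omega> \<Otimes>\<^sub>M (\<Omega> \<Otimes>\<^sub>M \<Omega>))"
    unfolding form_sum_def
  proof (intro borel_measurable_sum borel_measurable_power)
    fix k assume "k \<in> {..<K}"
    then have *: "k < n" "K + k < n" by auto
    note [measurable] = noise_space_component[OF *(1)] noise_space_component[OF *(2)]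
    show "(\<lambda>p. block_form c K (fst p) (fst (snd p)) (fst (snd (snd p))) (snd (snd (snd p))) k)
      \<in> borel_measurable (\<Omega> \<Otimes>\<^sub>M \<Omega> \<Otimes>\<^sub>M (\<Omega> \<Otimes>\<^sub>M \<Omega>))"
      by (cases c) simp
  qed
  then show ?thesis by (simp add: split_beta')
qed

lemma form_sum_comp [measurable]:
  assumes "f \<in> measurable L \<Omega>" "g \<in> measurable L \<Omega>" "h \<in> measurable L (\<Omega> \<Otimes>\<^sub>M \<Omega>)"
  shows "(\<lambda>x. form_sum c (f x) (g x) (h x)) \<in> borel_measurable L"
  using measurable_compose[OF measurable_Pair[OF assms(1) measurable_Pair[OF assms(2,3)]] form_sum_measurable]
  by simp

lemma nn_integral_exp_form_sum:
  assumes u: "2 * u < 1" and c: "0 < sqnorm c"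
  shows "(\<integral>\<^sup>+a. \<integral>\<^sup>+b. \<integral>\<^sup>+w. ennreal (exp (u * (form_sum c a b w / sqnorm c - z))) \<partial>(\<Omega> \<Otimes>\<^sub>M \<Omega>) \<partial>\<Omega> \<partial>\<Omega>)
    = ennreal (exp (- u * z) * (1 / sqrt (1 - 2 * u)) ^ K)"
proof -
  interpret O: prob_space \<Omega> by (rule prob_space_noise_space)
  interpret OO: pair_prob_space \<Omega> \<Omega> ..
  define v where "v = u / sqnorm c"
  have v: "v * sqnorm c = u" "2 * v * sqnorm c < 1" using c u by (auto simp: v_def)
  have e: "ennreal (exp (u * (form_sum c a b w / sqnorm c - z)))
     = ennreal (exp (- u * z)) * ennreal (exp (v * form_sum c a b w))" for a b w
    using c by (simp add: ennreal_mult[symmetric] exp_add[symmetric] v_def algebra_simps)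
  have "(\<integral>\<^sup>+a. \<integral>\<^sup>+b. \<integral>\<^sup>+w. ennreal (exp (u * (form_sum c a b w / sqnorm c - z))) \<partial>(\<Omega> \<Otimes>\<^sub>M \<Omega>) \<partial>\<Omega> \<partial>\<Omega>)
    = (\<integral>\<^sup>+a. \<integral>\<^sup>+b. ennreal (exp (- u * z)) * (\<integral>\<^sup>+w. ennreal (exp (v * form_sum c a b w)) \<partial>(\<Omega> \<Otimes>\<^sub>M \<Omega>)) \<partial>\<Omega> \<partial>\<Omega>)"
    unfolding e by (intro nn_integral_cong nn_integral_cmult) measurable
  also have "\<dots> = ennreal (exp (- u * z)) * (\<integral>\<^sup>+a. \<integral>\<^sup>+b. \<integral>\<^sup>+w. ennreal (exp (v * form_sum c a b w)) \<partial>(\<Omega> \<Otimes>\<^sub>M \<Omega>) \<partial>\<Omega> \<partial>\<Omega>)"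
    by (subst nn_integral_cmult[symmetric], measurable, intro nn_integral_cong nn_integral_cmult) measurable
  also have "(\<integral>\<^sup>+a. \<integral>\<^sup>+b. \<integral>\<^sup>+w. ennreal (exp (v * form_sum c a b w)) \<partial>(\<Omega> \<Otimes>\<^sub>M \<Omega>) \<partial>\<Omega> \<partial>\<Omega>)
     = (\<integral>\<^sup>+a. \<integral>\<^sup>+b. \<integral>\<^sup>+g. \<integral>\<^sup>+h. ennreal (exp (v * (\<Sum>k<K. (block_form c K a b g h k)\<^sup>2))) \<partial>\<Omega> \<partial>\<Omega> \<partial>\<Omega> \<partial>\<Omega>)"
    by (intro nn_integral_cong, subst O.nn_integral_fst[symmetric], measurable) (simp add: form_sum_def)
  also have "\<dots> = ennreal ((1 / sqrt (1 - 2 * u)) ^ K)"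
    using nn_integral_block_forms[OF v(2), of K n] v(1) by (simp add: mult.assoc)
  finally show ?thesis using u by (simp add: ennreal_mult)
qed

text \<open>Chernoff factors contributed by each block; both are below 1 for the \<open>t\<close>
  supplied by \<open>chernoff_rates\<close>.\<close>

definition rate_over :: real where "rate_over = exp (- t * (1 + \<eta>)) / sqrt (1 - 2 * t)"
definition rate_under :: real where "rate_under = exp (t * (1 - \<eta>)) / sqrt (1 + 2 * t)"

text \<open>Division by \<open>sqnorm c\<close> turns every energy into a standard chi-square
  variable, so all forms in \<open>Up\<close> share one bound and all forms in \<open>Lo\<close>
  another. The factors 6 bound the sizes of the two sets.\<close>

lemma int_penalty:
  "(\<integral>\<^sup>+a. \<integral>\<^sup>+b. \<integral>\<^sup>+w. ennreal (penalty a b w) \<partial>(\<Omega> \<Otimes>\<^sub>M \<Omega>) \<partial>\<Omega> \<partial>\<Omega>) \<le> ennreal (6 * rate_over ^ K + 6 * rate_under ^ K)"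
proof -
  interpret O: prob_space \<Omega> by (rule prob_space_noise_space)
  interpret OO: pair_prob_space \<Omega> \<Omega> ..
  let ?P = "\<Omega> \<Otimes>\<^sub>M \<Omega> \<Otimes>\<^sub>M (\<Omega> \<Otimes>\<^sub>M \<Omega>)"
  note triple = nn_integral_triple[OF O.prob_space_axioms OO.P.prob_space_axioms]
  have mo: "(\<lambda>p. case p of (a, b, w) \<Rightarrow> ennreal (over c a b w)) \<in> borel_measurable ?P" for c
    unfolding over_def by measurable
  have mu: "(\<lambda>p. case p of (a, b, w) \<Rightarrow> ennreal (under c a b w)) \<in> borel_measurable ?P" for c
    unfolding under_def by measurable
  have o: "(\<integral>\<^sup>+p. (case p of (a, b, w) \<Rightarrow> ennreal (over c a b w)) \<partial>?P) = ennreal (rate_over ^ K)" if "c \<in> Up" for c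
    using sqnorm_pos[of c] that t nn_integral_exp_form_sum[of t c "real K * (1 + \<eta>)"]
    by (subst triple[OF mo]) (simp add: over_def rate_over_def power_divide exp_of_nat_mult[symmetric] algebra_simps)
  have u: "(\<integral>\<^sup>+p. (case p of (a, b, w) \<Rightarrow> ennreal (under c a b w)) \<partial>?P) = ennreal (rate_under ^ K)" if "c \<in> Lo" for c
    using sqnorm_pos[of c] that t nn_integral_exp_form_sum[of "- t" c "real K * (1 - \<eta>)"]
    by (subst triple[OF mu]) (simp add: under_def rate_under_def power_divide exp_of_nat_mult[symmetric] algebra_simps)
  have pos: "0 \<le> rate_over" "0 \<le> rate_under" using t by (auto simp: rate_over_def rate_under_def)
  have eq: "(case p of (a, b, w) \<Rightarrow> ennreal (penalty a b w)) =
     (\<Sum>c\<in>Up. (case p of (a, b, w) \<Rightarrow> ennreal (over c a b w))) + (\<Sum>c\<in>Lo. (case p of (a, b, w) \<Rightarrow> ennreal (under c a b w)))" for p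
    unfolding penalty_def by (auto simp: over_def under_def ennreal_plus sum_nonneg sum_ennreal split: prod.split)
  have mp: "(\<lambda>p. case p of (a, b, w) \<Rightarrow> ennreal (penalty a b w)) \<in> borel_measurable ?P"
    unfolding eq by (intro borel_measurable_add borel_measurable_sum mo mu)
  have "(\<integral>\<^sup>+a. \<integral>\<^sup>+b. \<integral>\<^sup>+w. ennreal (penalty a b w) \<partial>(\<Omega> \<Otimes>\<^sub>M \<Omega>) \<partial>\<Omega> \<partial>\<Omega>)
     = (\<integral>\<^sup>+p. (case p of (a, b, w) \<Rightarrow> ennreal (penalty a b w)) \<partial>?P)"
    by (subst triple[OF mp]) simp
  also have "\<dots> = (\<Sum>c\<in>Up. ennreal (rate_over ^ K)) + (\<Sum>c\<in>Lo. ennreal (rate_under ^ K))"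
    unfolding eq
    by (subst nn_integral_add, (intro borel_measurable_sum mo mu)+,
        (subst nn_integral_sum, rule mo mu)+, simp add: o u)
  also have "\<dots> = ennreal (real (card Up) * rate_over ^ K + real (card Lo) * rate_under ^ K)"
    using pos by (simp add: ennreal_plus ennreal_mult ennreal_of_nat_eq_real_of_nat)
  also have "\<dots> \<le> ennreal (6 * rate_over ^ K + 6 * rate_under ^ K)"
    using pos card_Up card_Lo by (intro ennreal_leI add_mono mult_right_mono) auto
  finally show ?thesis .
qed

lemma penalty_measurable: "(\<lambda>(a, b, w). ennreal (penalty a b w)) \<in> borel_measurable (\<Omega> \<Otimes>\<^sub>M \<Omega> \<Otimes>\<^sub>M (\<Omega> \<Otimes>\<^sub>M \<Omega>))"
  unfolding penalty_def over_def under_def by measurable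

section \<open>The scores of the transmitted pair\<close>

lemma chan_first: "k < K \<Longrightarrow> chan a b w k = a1 * a k + a2 * b k + sqrt N * fst w k"
  by (auto simp: chan_def in1_def in2_def)

lemma chan_second:
  "k < K \<Longrightarrow> chan a b w (K + k) = b1 * a k + d1 * a (K + k) + (b2 * b k + d2 * b (K + k)
     + \<alpha> * (chan a b w k + sqrt s * snd w k)) + sqrt N * fst w (K + k)"
  by (auto simp: chan_first) (auto simp: chan_def in1_def in2_def first_slot_def)

text \<open>Every score is a product of two single-slot products, and \<open>prod_lratio_ge\<close>
  applies to each: the noise is bounded above through \<open>Up\<close>, the output after removal of
  what the score treats as known is bounded below through \<open>Lo\<close>. Two factors account for
  the loss \<open>2 * \<eta>\<close>.\<close>

lemma scores_ge:
  assumes p: "penalty a b w < 1"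
  defines "y \<equiv> chan a b w"
  shows "exp (real K * (ln (1 + a1\<^sup>2 / N) / 2 + ln (1 + d1\<^sup>2 / N') / 2 - 2 * \<eta>)) \<le> score1 a b y"
    and "exp (real K * (ln (1 + a2\<^sup>2 / N) / 2 + ln (1 + d2\<^sup>2 / N') / 2 - 2 * \<eta>)) \<le> score2 a b y"
    and "exp (real K * (ln (1 + (a1\<^sup>2 + a2\<^sup>2) / N) / 2 +
       ln (1 + (\<kappa>\<^sup>2 * (a1\<^sup>2 + a2\<^sup>2) + d1\<^sup>2 + d2\<^sup>2) / N') / 2 - 2 * \<eta>)) \<le> score12 a b y"
proof -
  note up = form_sum_le_of_penalty[OF p, unfolded form_sum_def]
  note lo = form_sum_ge_of_penalty[OF p, unfolded form_sum_def]
  have sq: "(sqrt N)\<^sup>2 = N" "(\<alpha> * sqrt s)\<^sup>2 = \<alpha>\<^sup>2 * s" using N s by (auto simp: power_mult_distrib)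
  have two: "exp (real K * (x + x' - 2 * \<eta>)) = exp (real K * (x - \<eta>)) * exp (real K * (x' - \<eta>))" for x x'
    by (simp add: exp_add[symmetric] algebra_simps)
  have y1: "y k = a1 * a k + a2 * b k + sqrt N * fst w k" if "k < K" for k
    using that by (simp add: y_def chan_first)
  \<comment> \<open>The receiver knows \<open>y k\<close>, so the fed-back output cancels exactly
    and only the feedback noise survives.\<close>
  have y2: "y (K + k) - \<alpha> * y k = b1 * a k + d1 * a (K + k) + b2 * b k + d2 * b (K + k)
     + sqrt N * fst w (K + k) + \<alpha> * sqrt s * snd w k" if "k < K" for k
    unfolding y_def chan_second[OF that] by (simp add: algebra_simps)
  have na: "(\<Sum>k<K. (sqrt N * fst w k)\<^sup>2) \<le> N * (real K * (1 + \<eta>))"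
    using up[of "(0, 0, 0, 0, sqrt N, 0, 0)"] by (simp add: Up_def sq)
  have nb: "(\<Sum>k<K. (sqrt N * fst w (K + k) + \<alpha> * sqrt s * snd w k)\<^sup>2) \<le> N' * (real K * (1 + \<eta>))"
    using up[of "(0, 0, 0, 0, 0, sqrt N, \<alpha> * sqrt s)"] by (simp add: Up_def sq N'_def)
  have nd1: "sqnorm (0, d1, 0, 0, 0, sqrt N, \<alpha> * sqrt s) = N' + d1\<^sup>2"
    and nd2: "sqnorm (0, 0, 0, d2, 0, sqrt N, \<alpha> * sqrt s) = N' + d2\<^sup>2"
    by (simp_all add: sq N'_def del: power_mult_distrib)
  note pge = prod_lratio_ge[OF N] prod_lratio_ge[OF N'_pos]
  show "exp (real K * (ln (1 + a1\<^sup>2 / N) / 2 + ln (1 + d1\<^sup>2 / N') / 2 - 2 * \<eta>)) \<le> score1 a b y"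
    unfolding score1_def prod.distrib two
  proof (intro mult_mono pge prod_nonneg)
    show "(\<Sum>k<K. (y k - a2 * b k - a1 * a k)\<^sup>2) \<le> N * (real K * (1 + \<eta>))"
      using na by (simp add: y1)
    show "(\<Sum>k<K. (y (K + k) - \<alpha> * y k - b1 * a k - b2 * b k - d2 * b (K + k) - d1 * a (K + k))\<^sup>2)
      \<le> N' * (real K * (1 + \<eta>))"
      using nb by (simp add: y2)
    show "(N + a1\<^sup>2) * (real K * (1 - \<eta>)) \<le> (\<Sum>k<K. (y k - a2 * b k)\<^sup>2)"
      using lo[of "(a1, 0, 0, 0, sqrt N, 0, 0)"] by (simp add: Lo_def sq y1 add_ac)
    show "(N' + d1\<^sup>2) * (real K * (1 - \<eta>)) \<le> (\<Sum>k<K. (y (K + k) - \<alpha> * y k - b1 * a k - b2 * b k - d2 * b (K + k))\<^sup>2)"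
      using lo[of "(0, d1, 0, 0, 0, sqrt N, \<alpha> * sqrt s)"] by (simp add: Lo_def nd1 y2 add.assoc del: sqnorm.simps)
  qed (use N N'_pos in \<open>auto simp: lratio_nonneg\<close>)
  show "exp (real K * (ln (1 + a2\<^sup>2 / N) / 2 + ln (1 + d2\<^sup>2 / N') / 2 - 2 * \<eta>)) \<le> score2 a b y"
    unfolding score2_def prod.distrib two
  proof (intro mult_mono pge prod_nonneg)
    show "(\<Sum>k<K. (y k - a1 * a k - a2 * b k)\<^sup>2) \<le> N * (real K * (1 + \<eta>))"
      using na by (simp add: y1)
    show "(\<Sum>k<K. (y (K + k) - \<alpha> * y k - b1 * a k - b2 * b k - d1 * a (K + k) - d2 * b (K + k))\<^sup>2)
      \<le> N' * (real K * (1 + \<eta>))"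
      using nb by (simp add: y2)
    show "(N + a2\<^sup>2) * (real K * (1 - \<eta>)) \<le> (\<Sum>k<K. (y k - a1 * a k)\<^sup>2)"
      using lo[of "(0, 0, a2, 0, sqrt N, 0, 0)"] by (simp add: Lo_def sq y1 add_ac)
    show "(N' + d2\<^sup>2) * (real K * (1 - \<eta>)) \<le> (\<Sum>k<K. (y (K + k) - \<alpha> * y k - b1 * a k - b2 * b k - d1 * a (K + k))\<^sup>2)"
      using lo[of "(0, 0, 0, d2, 0, sqrt N, \<alpha> * sqrt s)"] by (simp add: Lo_def nd2 y2 add.assoc del: sqnorm.simps)
  qed (use N N'_pos in \<open>auto simp: lratio_nonneg\<close>)
  have nonneg: "0 \<le> \<kappa>\<^sup>2 * (a1\<^sup>2 + a2\<^sup>2) + d1\<^sup>2 + d2\<^sup>2" by simp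
  show "exp (real K * (ln (1 + (a1\<^sup>2 + a2\<^sup>2) / N) / 2 +
       ln (1 + (\<kappa>\<^sup>2 * (a1\<^sup>2 + a2\<^sup>2) + d1\<^sup>2 + d2\<^sup>2) / N') / 2 - 2 * \<eta>)) \<le> score12 a b y"
    unfolding score12_def prod.distrib two
  proof (intro mult_mono pge prod_nonneg nonneg)
    show "(\<Sum>k<K. (y k - (a1 * a k + a2 * b k))\<^sup>2) \<le> N * (real K * (1 + \<eta>))"
      using na by (simp add: y1)
    have z: "y (K + k) - \<alpha> * y k - (\<kappa> * (a1 * b k - a2 * a k) + d1 * a (K + k) + d2 * b (K + k))
       = sqrt N * fst w (K + k) + \<alpha> * sqrt s * snd w k" if "k < K" for k
      unfolding y2[OF that] by (simp add: algebra_simps)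
    show "(\<Sum>k<K. (y (K + k) - \<alpha> * y k - (\<kappa> * (a1 * b k - a2 * a k) + d1 * a (K + k) + d2 * b (K + k)))\<^sup>2)
      \<le> N' * (real K * (1 + \<eta>))"
      using nb by (simp add: z)
    show "(N + (a1\<^sup>2 + a2\<^sup>2)) * (real K * (1 - \<eta>)) \<le> (\<Sum>k<K. (y k)\<^sup>2)"
      using lo[of "(a1, 0, a2, 0, sqrt N, 0, 0)"] by (simp add: Lo_def sq y1 add_ac)
    \<comment> \<open>Here the old symbols contribute b1^2 + b2^2 = \<kappa>^2 (a1^2 + a2^2), the
      variance used in \<open>score12\<close>.\<close>
    have "sqnorm (b1, d1, b2, d2, 0, sqrt N, \<alpha> * sqrt s) = N' + (\<kappa>\<^sup>2 * (a1\<^sup>2 + a2\<^sup>2) + d1\<^sup>2 + d2\<^sup>2)"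
      using s by (simp add: sq N'_def power_mult_distrib algebra_simps)
    then show "(N' + (\<kappa>\<^sup>2 * (a1\<^sup>2 + a2\<^sup>2) + d1\<^sup>2 + d2\<^sup>2)) * (real K * (1 - \<eta>)) \<le> (\<Sum>k<K. (y (K + k) - \<alpha> * y k)\<^sup>2)"
      using lo[of "(b1, d1, b2, d2, 0, sqrt N, \<alpha> * sqrt s)"] by (simp add: Lo_def y2 add.assoc del: sqnorm.simps)
  qed (use N N'_pos nonneg in \<open>auto simp: lratio_nonneg\<close>)
qed

end

section \<open>Codes from codebooks\<close>

lemma sets_code_space:
  "sets (code_space c n) = sets (count_space UNIV \<Otimes>\<^sub>M (noise_space n \<Otimes>\<^sub>M noise_space n))"
  unfolding code_space_def by (intro sets_pair_measure_cong) auto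

lemma code_space_measurable:
  assumes "\<And>m. f m \<in> measurable (noise_space n \<Otimes>\<^sub>M noise_space n) L"
  shows "(\<lambda>\<omega>. f (fst \<omega>) (snd \<omega>)) \<in> measurable (code_space c n) L"
  unfolding measurable_cong_sets[OF sets_code_space refl]
  using assms by (intro measurable_pair_measure_countable1) auto

lemma prob_space_code_space:
  assumes "1 \<le> nmsg1 c" "1 \<le> nmsg2 c"
  shows "prob_space (code_space c n)"
proof -
  interpret O: prob_space "noise_space n" by (rule prob_space_noise_space)
  interpret OO: pair_prob_space "noise_space n" "noise_space n" ..
  interpret U: prob_space "uniform_measure (count_space UNIV) ({..<nmsg1 c} \<times> {..<nmsg2 c})"
    using assms by (intro prob_space_uniform_measure) (auto simp: emeasure_count_space_finite ennreal_mult_eq_top_iff)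
  interpret UOO: pair_prob_space "uniform_measure (count_space UNIV) ({..<nmsg1 c} \<times> {..<nmsg2 c})"
    "noise_space n \<Otimes>\<^sub>M noise_space n" ..
  show ?thesis unfolding code_space_def by (rule UOO.P.prob_space_axioms)
qed

lemma nn_integral_code_space:
  assumes f: "\<And>m. f m \<in> borel_measurable (noise_space n \<Otimes>\<^sub>M noise_space n)"
    and M: "1 \<le> nmsg1 c" "1 \<le> nmsg2 c"
  shows "(\<integral>\<^sup>+\<omega>. f (fst \<omega>) (snd \<omega>) \<partial>code_space c n) =
    (\<Sum>m1<nmsg1 c. \<Sum>m2<nmsg2 c. \<integral>\<^sup>+w. f (m1, m2) w \<partial>(noise_space n \<Otimes>\<^sub>M noise_space n))
      / ennreal (real (nmsg1 c) * real (nmsg2 c))"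
proof -
  interpret O: prob_space "noise_space n" by (rule prob_space_noise_space)
  interpret OO: pair_prob_space "noise_space n" "noise_space n" ..
  let ?B = "{..<nmsg1 c} \<times> {..<nmsg2 c}"
  let ?U = "uniform_measure (count_space UNIV) ?B"
  let ?W = "noise_space n \<Otimes>\<^sub>M noise_space n"
  have "(\<integral>\<^sup>+\<omega>. f (fst \<omega>) (snd \<omega>) \<partial>code_space c n) = (\<integral>\<^sup>+m. \<integral>\<^sup>+w. f m w \<partial>?W \<partial>?U)"
    using OO.P.nn_integral_fst[of "\<lambda>\<omega>. f (fst \<omega>) (snd \<omega>)" ?U]
      code_space_measurable[of f n borel c, OF f] unfolding code_space_def by simp
  also have "\<dots> = (\<integral>\<^sup>+m. (\<integral>\<^sup>+w. f m w \<partial>?W) * indicator ?B m \<partial>count_space UNIV) / emeasure (count_space UNIV) ?B"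
    by (subst nn_integral_uniform_measure) auto
  also have "(\<integral>\<^sup>+m. (\<integral>\<^sup>+w. f m w \<partial>?W) * indicator ?B m \<partial>count_space UNIV) = (\<Sum>m\<in>?B. \<integral>\<^sup>+w. f m w \<partial>?W)"
    by (subst nn_integral_count_space_indicator[symmetric]) (auto simp: nn_integral_count_space_finite)
  also have "\<dots> = (\<Sum>m1<nmsg1 c. \<Sum>m2<nmsg2 c. \<integral>\<^sup>+w. f (m1, m2) w \<partial>?W)"
    by (subst sum.cartesian_product) (auto intro!: sum.cong)
  also have "emeasure (count_space UNIV) ?B = ennreal (real (nmsg1 c) * real (nmsg2 c))"
    by (subst emeasure_count_space_finite) (auto simp: card_cartesian_product ennreal_of_nat_eq_real_of_nat)
  finally show ?thesis .
qed

context fb_scheme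
begin

definition code :: "nat \<Rightarrow> nat \<Rightarrow> (nat \<Rightarrow> nat \<Rightarrow> real) \<Rightarrow> (nat \<Rightarrow> nat \<Rightarrow> real) \<Rightarrow> ((nat \<Rightarrow> real) \<Rightarrow> nat \<times> nat) \<Rightarrow> fbcode" where
  "code M1 M2 c1 c2 dc = \<lparr>nmsg1 = M1, nmsg2 = M2, enc1 = (\<lambda>i m. in1 (c1 m) i),
     enc2 = (\<lambda>i m v. in2 (c2 m) v i), dec = dc\<rparr>"

text \<open>Causality: the only feedback value read at time \<open>i\<close> is that of time
  \<open>i - K\<close>, which precedes \<open>i\<close> and lies in the first half.\<close>

lemma in2_cong:
  assumes "\<And>j. j < i \<Longrightarrow> j < K \<Longrightarrow> v j = v' j"
  shows "in2 b v i = in2 b v' i"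
  using assms by (auto simp: in2_def)

text \<open>Induction on time. The prefix already known to agree with \<open>chan\<close> determines
  the next input by \<open>in2_cong\<close>, since \<open>chan\<close> and \<open>first_slot\<close>
  coincide on the first half.\<close>

lemma chan_out_code:
  "i \<le> n \<Longrightarrow> chan_out (code M1 M2 c1 c2 dc) N s m1 m2 g h i = restrict (chan (c1 m1) (c2 m2) (g, h)) {..<i}"
proof (induction i)
  case (Suc i)
  let ?y = "chan (c1 m1) (c2 m2) (g, h)"
  have IH: "chan_out (code M1 M2 c1 c2 dc) N s m1 m2 g h i = restrict ?y {..<i}"
    by (rule Suc.IH[OF Suc_leD[OF Suc.prems]])
  have "in2 (c2 m2) (restrict (\<lambda>j. restrict ?y {..<i} j + sqrt s * h j) {..<i}) i
      = in2 (c2 m2) (\<lambda>j. first_slot (c1 m1) (c2 m2) g j + sqrt s * h j) i"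
    by (rule in2_cong) (auto simp: chan_first first_slot_def)
  then have "chan_out (code M1 M2 c1 c2 dc) N s m1 m2 g h (Suc i) = (restrict ?y {..<i})(i := ?y i)"
    unfolding chan_out.simps IH Let_def using Suc.prems by (simp add: code_def chan_def)
  also have "\<dots> = restrict ?y {..<Suc i}"
    by (auto simp: restrict_def fun_eq_iff)
  finally show ?case .
qed (simp add: restrict_def)

lemma chan_out_code_n:
  "chan_out (code M1 M2 c1 c2 dc) N s m1 m2 g h n = chan (c1 m1) (c2 m2) (g, h)"
  by (subst chan_out_code) (auto simp: chan_def restrict_def fun_eq_iff)

lemma input2_code:
  assumes "i < n"
  shows "input2 (code M1 M2 c1 c2 dc) N s m1 m2 g h i
    = in2 (c2 m2) (\<lambda>j. first_slot (c1 m1) (c2 m2) g j + sqrt s * h j) i"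
proof -
  have "input2 (code M1 M2 c1 c2 dc) N s m1 m2 g h i
    = in2 (c2 m2) (restrict (\<lambda>j. restrict (chan (c1 m1) (c2 m2) (g, h)) {..<i} j + sqrt s * h j) {..<i}) i"
    using assms by (simp add: input2_def chan_out_code) (simp add: code_def)
  also have "\<dots> = in2 (c2 m2) (\<lambda>j. first_slot (c1 m1) (c2 m2) g j + sqrt s * h j) i"
    by (rule in2_cong) (auto simp: chan_first first_slot_def)
  finally show ?thesis .
qed

lemma sum_slots:
  fixes f :: "nat \<Rightarrow> real"
  assumes "\<And>i. 2 * K \<le> i \<Longrightarrow> f i = 0"
  shows "(\<Sum>i<n. f i) = (\<Sum>k<K. f k) + (\<Sum>k<K. f (K + k))"
proof -
  have "(\<Sum>i<n. f i) = (\<Sum>i\<in>{..<K} \<union> {K..<2 * K}. f i)"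
    using assms by (intro sum.mono_neutral_right) auto
  also have "\<dots> = (\<Sum>k<K. f k) + (\<Sum>i\<in>{K..<2 * K}. f i)"
    by (intro sum.union_disjoint) auto
  also have "(\<Sum>i\<in>{K..<2 * K}. f i) = (\<Sum>k<K. f (K + k))"
    by (rule sum.reindex_bij_witness[of _ "\<lambda>k. K + k" "\<lambda>j. j - K"]) auto
  finally show ?thesis .
qed

section \<open>Energy spent per block\<close>

definition pow1 :: real where "pow1 = a1\<^sup>2 + (b1\<^sup>2 + d1\<^sup>2)"
text \<open>The fed-back output is expanded into symbols and noise. It contains the old symbol of
  transmitter 2, hence the combined coefficient \<open>b2 + \<alpha> * a2\<close>, where a negative
  \<kappa> produces the saving.\<close>

definition pow2 :: real where
  "pow2 = a2\<^sup>2 + ((\<alpha> * a1)\<^sup>2 + (b2 + \<alpha> * a2)\<^sup>2 + d2\<^sup>2 + \<alpha>\<^sup>2 * N + \<alpha>\<^sup>2 * s)"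

lemma pow_nonneg: "0 \<le> pow1" "0 \<le> pow2"
  using N s by (auto simp: pow1_def pow2_def)

lemma energy1_le: "(\<Sum>i<n. (in1 a i)\<^sup>2) \<le> pow1 * (real K * (1 + \<eta>) + penalty a b w / t)"
proof -
  have "(\<Sum>i<n. (in1 a i)\<^sup>2) = (\<Sum>k<K. (in1 a k)\<^sup>2) + (\<Sum>k<K. (in1 a (K + k))\<^sup>2)"
    by (rule sum_slots) (simp add: in1_def)
  also have "\<dots> = form_sum (a1, 0, 0, 0, 0, 0, 0) a b w + form_sum (b1, d1, 0, 0, 0, 0, 0) a b w"
    by (simp add: form_sum_def in1_def)
  also have "\<dots> \<le> sqnorm (a1, 0, 0, 0, 0, 0, 0) * (real K * (1 + \<eta>) + penalty a b w / t)
      + sqnorm (b1, d1, 0, 0, 0, 0, 0) * (real K * (1 + \<eta>) + penalty a b w / t)"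
    by (intro add_mono form_sum_le_penalty) (simp_all add: Up_def)
  also have "\<dots> = pow1 * (real K * (1 + \<eta>) + penalty a b w / t)"
    by (simp only: distrib_right[symmetric]) (simp add: pow1_def)
  finally show ?thesis .
qed

lemma energy2_le:
  "(\<Sum>i<n. (in2 b (\<lambda>j. first_slot a b (fst w) j + sqrt s * snd w j) i)\<^sup>2)
    \<le> pow2 * (real K * (1 + \<eta>) + penalty a b w / t)"
proof -
  let ?v = "\<lambda>j. first_slot a b (fst w) j + sqrt s * snd w j"
  have sq: "(\<alpha> * sqrt N)\<^sup>2 = \<alpha>\<^sup>2 * N" "(\<alpha> * sqrt s)\<^sup>2 = \<alpha>\<^sup>2 * s" using N s by (auto simp: power_mult_distrib)
  have "(\<Sum>i<n. (in2 b ?v i)\<^sup>2) = (\<Sum>k<K. (in2 b ?v k)\<^sup>2) + (\<Sum>k<K. (in2 b ?v (K + k))\<^sup>2)"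
    by (rule sum_slots) (simp add: in2_def)
  also have "\<dots> = form_sum (0, 0, a2, 0, 0, 0, 0) a b w
      + form_sum (\<alpha> * a1, 0, b2 + \<alpha> * a2, d2, \<alpha> * sqrt N, 0, \<alpha> * sqrt s) a b w"
    unfolding form_sum_def
    by (intro arg_cong2[where f = "(+)"] sum.cong arg_cong[where f = "\<lambda>x. x\<^sup>2"] refl)
       (auto simp: in2_def first_slot_def distrib_left distrib_right mult.assoc)
  also have "\<dots> \<le> sqnorm (0, 0, a2, 0, 0, 0, 0) * (real K * (1 + \<eta>) + penalty a b w / t)
      + sqnorm (\<alpha> * a1, 0, b2 + \<alpha> * a2, d2, \<alpha> * sqrt N, 0, \<alpha> * sqrt s) * (real K * (1 + \<eta>) + penalty a b w / t)"
    by (intro add_mono form_sum_le_penalty) (simp_all add: Up_def)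
  also have "\<dots> = pow2 * (real K * (1 + \<eta>) + penalty a b w / t)"
    by (simp only: distrib_right[symmetric]) (simp add: pow2_def sq)
  finally show ?thesis .
qed


text \<open>Nats per block, that is per two channel uses; hence the factor 2 in front of the rates
  below.\<close>

definition info1 :: real where "info1 = ln (1 + a1\<^sup>2 / N) / 2 + ln (1 + d1\<^sup>2 / N') / 2"
definition info2 :: real where "info2 = ln (1 + a2\<^sup>2 / N) / 2 + ln (1 + d2\<^sup>2 / N') / 2"
definition info12 :: real where
  "info12 = ln (1 + (a1\<^sup>2 + a2\<^sup>2) / N) / 2 + ln (1 + (\<kappa>\<^sup>2 * (a1\<^sup>2 + a2\<^sup>2) + d1\<^sup>2 + d2\<^sup>2) / N') / 2"

lemma mac_ensemble_scheme:
  "mac_ensemble \<Omega> \<Omega> (\<Omega> \<Otimes>\<^sub>M \<Omega>) Y chan (\<lambda>a b y. ennreal (score12 a b y)) (\<lambda>a b y. ennreal (score1 a b y))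
     (\<lambda>a b y. ennreal (score2 a b y)) (\<lambda>a b w. ennreal (penalty a b w))
     (exp (real K * (info12 - 2 * \<eta>))) (exp (real K * (info1 - 2 * \<eta>))) (exp (real K * (info2 - 2 * \<eta>)))"
proof -
  interpret O: prob_space \<Omega> by (rule prob_space_noise_space)
  interpret OO: pair_prob_space \<Omega> \<Omega> ..
  show ?thesis
  proof
    fix a b w
    assume *: "ennreal (score12 a b (chan a b w)) < ennreal (exp (real K * (info12 - 2 * \<eta>))) \<or>
      ennreal (score1 a b (chan a b w)) < ennreal (exp (real K * (info1 - 2 * \<eta>))) \<or>
      ennreal (score2 a b (chan a b w)) < ennreal (exp (real K * (info2 - 2 * \<eta>)))"
    have "1 \<le> penalty a b w"
    proof (rule ccontr)
      assume "\<not> 1 \<le> penalty a b w"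
      then have "penalty a b w < 1" by simp
      from scores_ge[OF this, folded info1_def info2_def info12_def, THEN ennreal_leI] * show False
        by (auto simp: not_le[symmetric])
    qed
    then show "1 \<le> ennreal (penalty a b w)" using ennreal_leI by fastforce
  qed (simp_all add: chan_measurable score_measurable penalty_measurable int_score1 int_score2 int_score12)
qed

text \<open>\<open>D\<close> bounds the mean of error indicator plus \<open>penalty\<close> for one
  codebook. The same number therefore appears as error bound and, divided by \<open>t\<close>, in
  both energy budgets.\<close>

lemma exists_code:
  assumes M: "1 \<le> M1" "1 \<le> M2"
    and D: "2 * (6 * rate_over ^ K + 6 * rate_under ^ K) + real M1 / exp (real K * (info1 - 2 * \<eta>))
      + real M2 / exp (real K * (info2 - 2 * \<eta>)) + real M1 * real M2 / exp (real K * (info12 - 2 * \<eta>)) < D"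
    and P: "pow1 * (real K * (1 + \<eta>) + D / t) \<le> real n * P1" "pow2 * (real K * (1 + \<eta>) + D / t) \<le> real n * P2"
  obtains c where "valid_code c n P1 P2 N s" "nmsg1 c = M1" "nmsg2 c = M2" "err_prob c N s n \<le> D"
proof -
  interpret O: prob_space \<Omega> by (rule prob_space_noise_space)
  interpret OO: pair_prob_space \<Omega> \<Omega> ..
  interpret E: mac_ensemble \<Omega> \<Omega> "\<Omega> \<Otimes>\<^sub>M \<Omega>" Y chan "\<lambda>a b y. ennreal (score12 a b y)" "\<lambda>a b y. ennreal (score1 a b y)"
     "\<lambda>a b y. ennreal (score2 a b y)" "\<lambda>a b w. ennreal (penalty a b w)"
     "exp (real K * (info12 - 2 * \<eta>))" "exp (real K * (info1 - 2 * \<eta>))" "exp (real K * (info2 - 2 * \<eta>))"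
    by (rule mac_ensemble_scheme)
  have rates: "0 \<le> rate_over" "0 \<le> rate_under" using t by (auto simp: rate_over_def rate_under_def)
  have D0: "0 \<le> D"
  proof -
    have "0 \<le> 2 * (6 * rate_over ^ K + 6 * rate_under ^ K) + real M1 / exp (real K * (info1 - 2 * \<eta>))
      + real M2 / exp (real K * (info2 - 2 * \<eta>)) + real M1 * real M2 / exp (real K * (info12 - 2 * \<eta>))"
      using rates by (intro add_nonneg_nonneg mult_nonneg_nonneg) auto
    then show ?thesis using D by linarith
  qed
  from rates have "0 \<le> 6 * rate_over ^ K + 6 * rate_under ^ K" by simp
  from E.random_coding[OF int_penalty this M D] obtain c1 c2
    where c1: "\<And>m. c1 m \<in> space \<Omega>" and c2: "\<And>m. c2 m \<in> space \<Omega>"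
      and bound: "(\<Sum>m1<M1. \<Sum>m2<M2. \<integral>\<^sup>+w. of_bool (E.ambiguous M1 M2 c1 c2 m1 m2 (chan (c1 m1) (c2 m2) w))
        + ennreal (penalty (c1 m1) (c2 m2) w) \<partial>(\<Omega> \<Otimes>\<^sub>M \<Omega>)) \<le> ennreal (real M1 * real M2 * D)"
    by blast
  \<comment> \<open>The first accepted pair in a fixed enumeration. \<open>LEAST\<close> over
    natural numbers keeps the decoder measurable; its value when no pair is accepted does not
    matter, because such outputs count as ambiguous.\<close>
  define dc where "dc y = prod_decode (LEAST j. fst (prod_decode j) < M1 \<and> snd (prod_decode j) < M2 \<and>
     E.accept (c1 (fst (prod_decode j))) (c2 (snd (prod_decode j))) y)" for y
  define c where "c = code M1 M2 c1 c2 dc"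
  have n12: "nmsg1 c = M1" "nmsg2 c = M2" by (auto simp: c_def code_def)
  then have nm: "1 \<le> nmsg1 c" "1 \<le> nmsg2 c" using M by auto
  interpret C: prob_space "code_space c n" by (rule prob_space_code_space[OF nm])
  note [measurable] = c1 c2
  have dc_meas [measurable]: "dc \<in> measurable Y (count_space UNIV)"
    unfolding dc_def by measurable
  have dc_eq: "dc y = (m1, m2)" if "m1 < M1" "m2 < M2" "\<not> E.ambiguous M1 M2 c1 c2 m1 m2 y" for m1 m2 y
  proof -
    let ?Q = "\<lambda>j. fst (prod_decode j) < M1 \<and> snd (prod_decode j) < M2 \<and>
      E.accept (c1 (fst (prod_decode j))) (c2 (snd (prod_decode j))) y"
    have "?Q j \<longleftrightarrow> j = prod_encode (m1, m2)" for j
    proof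
      assume "?Q j"
      then have "prod_decode j = (m1, m2)"
        using that(3) unfolding E.ambiguous_def by (metis prod.collapse)
      then show "j = prod_encode (m1, m2)" by (metis prod_decode_inverse)
    next
      assume "j = prod_encode (m1, m2)"
      then show "?Q j" using that by (auto simp: E.ambiguous_def)
    qed
    then have "(LEAST j. ?Q j) = prod_encode (m1, m2)" by (auto intro!: Least_equality)
    then show ?thesis by (simp add: dc_def)
  qed
  define f where "f m w = of_bool (dc (chan (c1 (fst m)) (c2 (snd m)) w) \<noteq> m)
     + ennreal (penalty (c1 (fst m)) (c2 (snd m)) w)" for m w
  have f_meas: "f m \<in> borel_measurable (\<Omega> \<Otimes>\<^sub>M \<Omega>)" for m
    unfolding f_def by measurable
  have f_int: "(\<integral>\<^sup>+\<omega>. f (fst \<omega>) (snd \<omega>) \<partial>code_space c n) \<le> ennreal D"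
  proof -
    have "(\<Sum>m1<M1. \<Sum>m2<M2. \<integral>\<^sup>+w. f (m1, m2) w \<partial>(\<Omega> \<Otimes>\<^sub>M \<Omega>)) \<le>
      (\<Sum>m1<M1. \<Sum>m2<M2. \<integral>\<^sup>+w. of_bool (E.ambiguous M1 M2 c1 c2 m1 m2 (chan (c1 m1) (c2 m2) w))
        + ennreal (penalty (c1 m1) (c2 m2) w) \<partial>(\<Omega> \<Otimes>\<^sub>M \<Omega>))"
      unfolding f_def using dc_eq by (intro sum_mono nn_integral_mono add_right_mono) (auto split: split_of_bool)
    also note bound
    finally have "(\<integral>\<^sup>+\<omega>. f (fst \<omega>) (snd \<omega>) \<partial>code_space c n)
       \<le> ennreal (real M1 * real M2 * D) / ennreal (real M1 * real M2)"
      using nn_integral_code_space[of f n c, OF f_meas nm] by (simp add: n12 divide_right_mono_ennreal)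
    also have "\<dots> = ennreal D"
      using M D0 by (subst divide_ennreal) auto
    finally show ?thesis .
  qed
  have err: "err_prob c N s n \<le> D"
  proof -
    let ?S = "{\<omega> \<in> space (code_space c n).
        dec c (chan_out c N s (fst (fst \<omega>)) (snd (fst \<omega>)) (fst (snd \<omega>)) (snd (snd \<omega>)) n) \<noteq> fst \<omega>}"
    show ?thesis
    \<comment> \<open>\<open>measure\<close> is 0 outside the sigma-algebra, so the bound holds in
      either case.\<close>
    proof (cases "?S \<in> sets (code_space c n)")
      case True
      have "emeasure (code_space c n) ?S = (\<integral>\<^sup>+\<omega>. indicator ?S \<omega> \<partial>code_space c n)"
        using True by simp
      also have "\<dots> \<le> (\<integral>\<^sup>+\<omega>. f (fst \<omega>) (snd \<omega>) \<partial>code_space c n)"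
      proof (intro nn_integral_mono)
        fix \<omega>
        have "indicator ?S \<omega> \<le> (of_bool (dc (chan (c1 (fst (fst \<omega>))) (c2 (snd (fst \<omega>))) (snd \<omega>)) \<noteq> fst \<omega>) :: ennreal)"
          by (auto simp: c_def chan_out_code_n indicator_def) (auto simp: code_def)
        also have "\<dots> \<le> f (fst \<omega>) (snd \<omega>)" unfolding f_def by simp
        finally show "indicator ?S \<omega> \<le> f (fst \<omega>) (snd \<omega>)" .
      qed
      also note f_int
      finally show ?thesis unfolding err_prob_def using D0
        by (simp add: C.emeasure_eq_measure)
    next
      case False
      then show ?thesis unfolding err_prob_def using D0 by (simp add: measure_notin_sets)
    qed
  qed
  \<comment> \<open>The pointwise energy bounds are affine in \<open>penalty\<close>, so their means
    follow from the mean of \<open>penalty\<close>, which is at most that of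
    \<open>f\<close>.\<close>
  have pen_int: "(\<integral>\<^sup>+\<omega>. ennreal (\<mu> * (real K * (1 + \<eta>) + penalty (c1 (fst (fst \<omega>))) (c2 (snd (fst \<omega>))) (snd \<omega>) / t)) \<partial>code_space c n)
     \<le> ennreal (\<mu> * (real K * (1 + \<eta>) + D / t))" if "0 \<le> \<mu>" for \<mu>
  proof -
    let ?p = "\<lambda>\<omega>. penalty (c1 (fst (fst \<omega>))) (c2 (snd (fst \<omega>))) (snd \<omega>)"
    have pm [measurable]: "(\<lambda>\<omega>. ennreal (?p \<omega>)) \<in> borel_measurable (code_space c n)"
      by (rule code_space_measurable[where f = "\<lambda>m w. ennreal (penalty (c1 (fst m)) (c2 (snd m)) w)"]) measurable
    have "(\<integral>\<^sup>+\<omega>. ennreal (\<mu> * (real K * (1 + \<eta>) + ?p \<omega> / t)) \<partial>code_space c n)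
      = (\<integral>\<^sup>+\<omega>. ennreal (\<mu> * (real K * (1 + \<eta>))) + ennreal (\<mu> / t) * ennreal (?p \<omega>) \<partial>code_space c n)"
      using that t \<eta> penalty_nonneg
      by (intro nn_integral_cong) (simp add: ennreal_mult[symmetric] ennreal_plus[symmetric] distrib_left del: ennreal_plus)
    also have "\<dots> = ennreal (\<mu> * (real K * (1 + \<eta>))) + ennreal (\<mu> / t) * (\<integral>\<^sup>+\<omega>. ennreal (?p \<omega>) \<partial>code_space c n)"
      by (simp add: nn_integral_add nn_integral_cmult C.emeasure_space_1)
    also have "(\<integral>\<^sup>+\<omega>. ennreal (?p \<omega>) \<partial>code_space c n) \<le> (\<integral>\<^sup>+\<omega>. f (fst \<omega>) (snd \<omega>) \<partial>code_space c n)"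
      unfolding f_def by (intro nn_integral_mono) simp
    also note f_int
    also have "ennreal (\<mu> * (real K * (1 + \<eta>))) + ennreal (\<mu> / t) * ennreal D = ennreal (\<mu> * (real K * (1 + \<eta>) + D / t))"
      using that t \<eta> D0 by (simp add: ennreal_mult[symmetric] ennreal_plus[symmetric] distrib_left del: ennreal_plus)
    finally show ?thesis by (simp add: add_left_mono mult_left_mono)
  qed
  have valid: "valid_code c n P1 P2 N s"
    unfolding valid_code_def
  proof (intro conjI nm allI impI)
    fix i m assume i: "i < n"
    show "enc2 c i m \<in> borel_measurable (PiM {..<i} (\<lambda>_. borel))"
    proof (cases "i < K \<or> \<not> i < 2 * K")
      case True
      then show ?thesis by (auto simp: c_def code_def in2_def)
    next
      case False
      then have "i - K \<in> {..<i}" by auto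
      then show ?thesis using False by (auto simp: c_def code_def in2_def intro!: measurable_component_singleton)
    qed
  next
    show "dec c \<in> measurable (PiM {..<n} (\<lambda>_. borel)) (count_space UNIV)"
      using dc_meas by (simp add: c_def code_def)
  next
    have "(\<Sum>i<n. \<integral>\<^sup>+ \<omega>. ennreal ((enc1 c i (fst (fst \<omega>)))\<^sup>2) \<partial>code_space c n)
      = (\<integral>\<^sup>+ \<omega>. (\<Sum>i<n. ennreal ((enc1 c i (fst (fst \<omega>)))\<^sup>2)) \<partial>code_space c n)"
      by (intro nn_integral_sum[symmetric]
          code_space_measurable[where f = "\<lambda>m w. ennreal ((enc1 c _ (fst m))\<^sup>2)"]) simp
    also have "\<dots> \<le> (\<integral>\<^sup>+\<omega>. ennreal (pow1 * (real K * (1 + \<eta>) + penalty (c1 (fst (fst \<omega>))) (c2 (snd (fst \<omega>))) (snd \<omega>) / t)) \<partial>code_space c n)"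
      by (intro nn_integral_mono) (simp add: c_def code_def sum_ennreal energy1_le ennreal_leI)
    also note pen_int[OF pow_nonneg(1)]
    also have "ennreal (pow1 * (real K * (1 + \<eta>) + D / t)) \<le> ennreal (real n * P1)"
      by (intro ennreal_leI P)
    finally show "(\<Sum>i<n. \<integral>\<^sup>+ \<omega>. ennreal ((enc1 c i (fst (fst \<omega>)))\<^sup>2) \<partial>code_space c n) \<le> ennreal (real n * P1)" .
  next
    let ?x = "\<lambda>i m w. in2 (c2 (snd m)) (\<lambda>j. first_slot (c1 (fst m)) (c2 (snd m)) (fst w) j + sqrt s * snd w j) i"
    have in2_meas: "(\<lambda>w. ennreal ((?x i m w)\<^sup>2)) \<in> borel_measurable (\<Omega> \<Otimes>\<^sub>M \<Omega>)" if "i < n" for i m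
    proof -
      from that have *: "i < n" "i - K < n" by auto
      note [measurable] = noise_space_component[OF *(1)] noise_space_component[OF *(2)]
      show ?thesis unfolding in2_def first_slot_def by (cases "i < K"; cases "i < 2 * K"; simp; measurable)
    qed
    have "(\<Sum>i<n. \<integral>\<^sup>+ \<omega>. ennreal ((input2 c N s (fst (fst \<omega>)) (snd (fst \<omega>)) (fst (snd \<omega>)) (snd (snd \<omega>)) i)\<^sup>2) \<partial>code_space c n)
      = (\<Sum>i<n. \<integral>\<^sup>+ \<omega>. ennreal ((?x i (fst \<omega>) (snd \<omega>))\<^sup>2) \<partial>code_space c n)"
      by (simp add: c_def input2_code)
    also have "\<dots> = (\<integral>\<^sup>+ \<omega>. (\<Sum>i<n. ennreal ((?x i (fst \<omega>) (snd \<omega>))\<^sup>2)) \<partial>code_space c n)"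
      by (intro nn_integral_sum[symmetric]
          code_space_measurable[where f = "\<lambda>m w. ennreal ((?x _ m w)\<^sup>2)"] in2_meas) simp
    also have "\<dots> \<le> (\<integral>\<^sup>+\<omega>. ennreal (pow2 * (real K * (1 + \<eta>) + penalty (c1 (fst (fst \<omega>))) (c2 (snd (fst \<omega>))) (snd \<omega>) / t)) \<partial>code_space c n)"
      by (intro nn_integral_mono) (simp add: sum_ennreal energy2_le ennreal_leI)
    also note pen_int[OF pow_nonneg(2)]
    also have "ennreal (pow2 * (real K * (1 + \<eta>) + D / t)) \<le> ennreal (real n * P2)"
      by (intro ennreal_leI P)
    finally show "(\<Sum>i<n. \<integral>\<^sup>+ \<omega>. ennreal ((input2 c N s (fst (fst \<omega>)) (snd (fst \<omega>)) (fst (snd \<omega>)) (snd (snd \<omega>)) i)\<^sup>2) \<partial>code_space c n)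
      \<le> ennreal (real n * P2)" .
  qed
  show thesis by (rule that[OF valid n12 err])
qed

end

section \<open>Achievable rates\<close>

lemma nat_ceiling_exp_bounds:
  assumes "0 \<le> x"
  shows "exp x \<le> real (nat \<lceil>exp x\<rceil>)" "real (nat \<lceil>exp x\<rceil>) \<le> 2 * exp x"
proof -
  have "1 \<le> exp x" using assms by simp
  then show "exp x \<le> real (nat \<lceil>exp x\<rceil>)" "real (nat \<lceil>exp x\<rceil>) \<le> 2 * exp x" by linarith+
qed

text \<open>From n \<le> 2 (n div 2) + 1: a possible odd channel use costs only the constant factor
  \<open>exp r\<close>, and the exponent can be counted in blocks.\<close>

lemma ratio_exp_bound:
  fixes n :: nat
  assumes "real M \<le> C * exp (real n * r)" "0 \<le> C" "0 \<le> r"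
  shows "real M / exp (real (n div 2) * g) \<le> C * exp r * exp (2 * r - g) ^ (n div 2)"
proof -
  have "real n \<le> 2 * real (n div 2) + 1" by linarith
  then have "real n * r \<le> (2 * real (n div 2) + 1) * r" using assms(3) by (intro mult_right_mono)
  then have "exp (real n * r) \<le> exp (r + real (n div 2) * (2 * r))" by (simp add: algebra_simps)
  then have "real M \<le> C * exp (r + real (n div 2) * (2 * r))"
    using assms(1,2) by (meson mult_left_mono order_trans)
  then have "real M / exp (real (n div 2) * g) \<le> C * exp (r + real (n div 2) * (2 * r)) / exp (real (n div 2) * g)"
    by (intro divide_right_mono) auto
  also have "\<dots> = C * exp (r + real (n div 2) * (2 * r) - real (n div 2) * g)"
    by (simp add: exp_diff)
  also have "\<dots> = C * exp (r + real (n div 2) * (2 * r - g))"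
    by (simp add: algebra_simps)
  also have "\<dots> = C * exp r * exp (2 * r - g) ^ (n div 2)"
    by (simp add: exp_add exp_of_nat_mult)
  finally show ?thesis .
qed

lemma filterlim_div_2: "filterlim (\<lambda>n::nat. n div 2) at_top sequentially"
  unfolding filterlim_at_top
proof
  fix Z :: nat
  show "eventually (\<lambda>n. Z \<le> n div 2) sequentially"
    using eventually_ge_at_top[of "2 * Z"] by eventually_elim auto
qed

lemma tendsto_pow_div_2: "0 \<le> x \<Longrightarrow> x < 1 \<Longrightarrow> (\<lambda>n. C * x ^ (n div 2)) \<longlonglongrightarrow> (0::real)"
  using tendsto_mult_right_zero[OF filterlim_compose[OF LIMSEQ_realpow_zero filterlim_div_2], of x C] by simp

text \<open>All rate and power inequalities are strict, so they survive a small slack \<eta>. Powers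
  are compared with \<open>2 * P1\<close> and \<open>2 * P2\<close> because a block has two channel
  uses.\<close>

lemma achievable_fb_scheme:
  fixes N s a1 a2 d1 d2 \<kappa> \<alpha> P1 P2 r1 r2 :: real
  assumes pos: "0 < N" "0 \<le> s" "0 < a1" "0 < a2" "0 < d1" "0 < d2" and r: "0 \<le> r1" "0 \<le> r2"
    and rate1: "2 * r1 < ln (1 + a1\<^sup>2 / N) / 2 + ln (1 + d1\<^sup>2 / (N + \<alpha>\<^sup>2 * s)) / 2"
    and rate2: "2 * r2 < ln (1 + a2\<^sup>2 / N) / 2 + ln (1 + d2\<^sup>2 / (N + \<alpha>\<^sup>2 * s)) / 2"
    and rate12: "2 * (r1 + r2) < ln (1 + (a1\<^sup>2 + a2\<^sup>2) / N) / 2 +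
      ln (1 + (\<kappa>\<^sup>2 * (a1\<^sup>2 + a2\<^sup>2) + d1\<^sup>2 + d2\<^sup>2) / (N + \<alpha>\<^sup>2 * s)) / 2"
    and pow1: "a1\<^sup>2 + (\<kappa> * a2)\<^sup>2 + d1\<^sup>2 < 2 * P1"
    and pow2: "a2\<^sup>2 + (\<alpha> * a1)\<^sup>2 + (\<kappa> * a1 + \<alpha> * a2)\<^sup>2 + d2\<^sup>2 + \<alpha>\<^sup>2 * N + \<alpha>\<^sup>2 * s < 2 * P2"
  shows "achievable_fb P1 P2 N s r1 r2"
proof -
  define i1 where "i1 = ln (1 + a1\<^sup>2 / N) / 2 + ln (1 + d1\<^sup>2 / (N + \<alpha>\<^sup>2 * s)) / 2"
  define i2 where "i2 = ln (1 + a2\<^sup>2 / N) / 2 + ln (1 + d2\<^sup>2 / (N + \<alpha>\<^sup>2 * s)) / 2"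
  define i12 where "i12 = ln (1 + (a1\<^sup>2 + a2\<^sup>2) / N) / 2 +
      ln (1 + (\<kappa>\<^sup>2 * (a1\<^sup>2 + a2\<^sup>2) + d1\<^sup>2 + d2\<^sup>2) / (N + \<alpha>\<^sup>2 * s)) / 2"
  define p1 where "p1 = a1\<^sup>2 + (\<kappa> * a2)\<^sup>2 + d1\<^sup>2"
  define p2 where "p2 = a2\<^sup>2 + (\<alpha> * a1)\<^sup>2 + (\<kappa> * a1 + \<alpha> * a2)\<^sup>2 + d2\<^sup>2 + \<alpha>\<^sup>2 * N + \<alpha>\<^sup>2 * s"
  have p: "0 \<le> p1" "0 \<le> p2" using pos by (auto simp: p1_def p2_def)
  have ev: "eventually (\<lambda>\<eta>. 2 * r1 < i1 - 2 * \<eta> \<and> 2 * r2 < i2 - 2 * \<eta> \<and> 2 * (r1 + r2) < i12 - 2 * \<eta> \<and>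
      p1 * (1 + \<eta>) < 2 * P1 \<and> p2 * (1 + \<eta>) < 2 * P2 \<and> 0 < \<eta>) (at_right (0::real))"
  proof (intro eventually_conj)
    have "((\<lambda>\<eta>. i - 2 * \<eta>) \<longlongrightarrow> i - 2 * 0) (at_right (0::real))" for i :: real
      by (intro tendsto_intros)
    then show "eventually (\<lambda>\<eta>. 2 * r1 < i1 - 2 * \<eta>) (at_right 0)" "eventually (\<lambda>\<eta>. 2 * r2 < i2 - 2 * \<eta>) (at_right 0)"
      "eventually (\<lambda>\<eta>. 2 * (r1 + r2) < i12 - 2 * \<eta>) (at_right 0)"
      using rate1 rate2 rate12 unfolding i1_def[symmetric] i2_def[symmetric] i12_def[symmetric]
      by (auto intro!: order_tendstoD(1))
    have "((\<lambda>\<eta>. p * (1 + \<eta>)) \<longlongrightarrow> p * (1 + 0)) (at_right (0::real))" for p :: real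
      by (intro tendsto_intros)
    then show "eventually (\<lambda>\<eta>. p1 * (1 + \<eta>) < 2 * P1) (at_right 0)" "eventually (\<lambda>\<eta>. p2 * (1 + \<eta>) < 2 * P2) (at_right 0)"
      using pow1 pow2 unfolding p1_def[symmetric] p2_def[symmetric]
      by (auto intro!: order_tendstoD(2))
    show "eventually (\<lambda>\<eta>. 0 < \<eta>) (at_right (0::real))" by (simp add: eventually_at_right_less)
  qed
  obtain \<eta> where \<eta>: "2 * r1 < i1 - 2 * \<eta>" "2 * r2 < i2 - 2 * \<eta>" "2 * (r1 + r2) < i12 - 2 * \<eta>"
      "p1 * (1 + \<eta>) < 2 * P1" "p2 * (1 + \<eta>) < 2 * P2" "0 < \<eta>"
    using eventually_happens'[OF trivial_limit_at_right_real ev] by blast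
  obtain t where t: "0 < t" "t < 1/2" and "exp (- t * (1 + \<eta>)) / sqrt (1 - 2 * t) < 1"
    "exp (t * (1 - \<eta>)) / sqrt (1 + 2 * t) < 1"
    using chernoff_rates[OF \<eta>(6)] by blast
  moreover define u where "u = exp (- t * (1 + \<eta>)) / sqrt (1 - 2 * t)"
  moreover define l where "l = exp (t * (1 - \<eta>)) / sqrt (1 + 2 * t)"
  ultimately have ul: "0 \<le> u" "u < 1" "0 \<le> l" "l < 1" by auto
  have S: "fb_scheme N s a1 a2 d1 d2 \<eta> t"
    using pos \<eta> t by unfold_locales auto
  define M1 M2 where "M1 n = nat \<lceil>exp (real n * r1)\<rceil>" and "M2 n = nat \<lceil>exp (real n * r2)\<rceil>" for n :: nat
  have M1: "exp (real n * r1) \<le> real (M1 n)" "real (M1 n) \<le> 2 * exp (real n * r1)"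
    and M2: "exp (real n * r2) \<le> real (M2 n)" "real (M2 n) \<le> 2 * exp (real n * r2)" for n
    unfolding M1_def M2_def using r by (intro nat_ceiling_exp_bounds mult_nonneg_nonneg; simp)+
  have M_ge: "1 \<le> M1 n" "1 \<le> M2 n" for n
    using M1(1)[of n] M2(1)[of n] exp_gt_zero[of "real n * r1"] exp_gt_zero[of "real n * r2"] by linarith+
  \<comment> \<open>Each message term decays because twice the rate is below the threshold exponent
    per block; 2 and 4 come from rounding up the message counts. The last summand only makes the
    bound strict.\<close>
  define D where "D n = 2 * (6 * u ^ (n div 2) + 6 * l ^ (n div 2))
     + 2 * exp r1 * exp (2 * r1 - (i1 - 2 * \<eta>)) ^ (n div 2) + 2 * exp r2 * exp (2 * r2 - (i2 - 2 * \<eta>)) ^ (n div 2)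
     + 4 * exp (r1 + r2) * exp (2 * (r1 + r2) - (i12 - 2 * \<eta>)) ^ (n div 2) + 1 / real (Suc n)" for n :: nat
  have D_lim: "D \<longlonglongrightarrow> 0"
  proof -
    have "(\<lambda>n. 2 * (6 * u ^ (n div 2) + 6 * l ^ (n div 2))
     + 2 * exp r1 * exp (2 * r1 - (i1 - 2 * \<eta>)) ^ (n div 2) + 2 * exp r2 * exp (2 * r2 - (i2 - 2 * \<eta>)) ^ (n div 2)
     + 4 * exp (r1 + r2) * exp (2 * (r1 + r2) - (i12 - 2 * \<eta>)) ^ (n div 2) + 1 / real (Suc n))
      \<longlonglongrightarrow> 2 * (0 + 0) + 0 + 0 + 0 + 0"
      using ul \<eta> by (intro tendsto_add tendsto_mult_left tendsto_pow_div_2 LIMSEQ_Suc[OF lim_1_over_n]) auto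
    then show ?thesis unfolding D_def[symmetric] by simp
  qed
  have D_bound: "2 * (6 * u ^ (n div 2) + 6 * l ^ (n div 2)) + real (M1 n) / exp (real (n div 2) * (i1 - 2 * \<eta>))
      + real (M2 n) / exp (real (n div 2) * (i2 - 2 * \<eta>))
      + real (M1 n) * real (M2 n) / exp (real (n div 2) * (i12 - 2 * \<eta>)) < D n" for n
  proof -
    have "real (M1 n) * real (M2 n) \<le> (2 * exp (real n * r1)) * (2 * exp (real n * r2))"
      using M1 M2 by (intro mult_mono) auto
    then have "real (M1 n * M2 n) \<le> 4 * exp (real n * (r1 + r2))"
      by (simp add: distrib_left exp_add)
    from ratio_exp_bound[OF this] r
    have "real (M1 n) * real (M2 n) / exp (real (n div 2) * (i12 - 2 * \<eta>))
      \<le> 4 * exp (r1 + r2) * exp (2 * (r1 + r2) - (i12 - 2 * \<eta>)) ^ (n div 2)" by simp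
    moreover have "real (M1 n) / exp (real (n div 2) * (i1 - 2 * \<eta>)) \<le> 2 * exp r1 * exp (2 * r1 - (i1 - 2 * \<eta>)) ^ (n div 2)"
      using r by (intro ratio_exp_bound M1) auto
    moreover have "real (M2 n) / exp (real (n div 2) * (i2 - 2 * \<eta>)) \<le> 2 * exp r2 * exp (2 * r2 - (i2 - 2 * \<eta>)) ^ (n div 2)"
      using r by (intro ratio_exp_bound M2) auto
    moreover have "0 < 1 / real (Suc n)" by simp
    ultimately show ?thesis unfolding D_def by linarith
  qed
  have power_ok: "eventually (\<lambda>n. q * (real (n div 2) * (1 + \<eta>) + D n / t) \<le> real n * P) sequentially"
    if q: "0 \<le> q" "q * (1 + \<eta>) < 2 * P" for q P
  proof -
    \<comment> \<open>Slack of the power budget per block. The \<open>penalty\<close> term adds at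
      most the constant \<open>q / t\<close> once \<open>D n < 1\<close>, and this is absorbed by
      \<open>e\<close> times the number of blocks for large \<open>n\<close>.\<close>
    define e where "e = 2 * P - q * (1 + \<eta>)"
    have e: "0 < e" "0 < P" using q \<eta>(6) by (auto simp: e_def) (smt (verit) mult_nonneg_nonneg)
    have "filterlim (\<lambda>n. real (n div 2)) at_top sequentially"
      by (rule filterlim_compose[OF filterlim_real_sequentially filterlim_div_2])
    then have "eventually (\<lambda>n. q / t / e \<le> real (n div 2)) sequentially"
      by (simp add: filterlim_at_top)
    moreover have "eventually (\<lambda>n. D n < 1) sequentially"
      using D_lim by (rule order_tendstoD) simp
    ultimately show ?thesis
    proof eventually_elim
      case (elim n)
      have "q * (D n / t) \<le> q / t" using elim(2) q(1) t by (simp add: divide_right_mono mult_left_le)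
      also have "\<dots> \<le> e * real (n div 2)" using elim(1) e by (simp only: pos_divide_le_eq mult.commute)
      finally have "q * (real (n div 2) * (1 + \<eta>) + D n / t) \<le> 2 * real (n div 2) * P"
        by (simp add: e_def algebra_simps)
      also have "\<dots> \<le> real n * P" using e by (intro mult_right_mono) linarith+
      finally show ?case .
    qed
  qed
  define good where "good n c \<longleftrightarrow> valid_code c n P1 P2 N s \<and> nmsg1 c = M1 n \<and> nmsg2 c = M2 n \<and> err_prob c N s n \<le> D n" for n c
  define C where "C n = (SOME c. good n c)" for n
  have C: "eventually (\<lambda>n. good n (C n)) sequentially"
    using power_ok[OF p(1) \<eta>(4)] power_ok[OF p(2) \<eta>(5)]
  proof eventually_elim
    case (elim n)
    interpret F: fb_scheme N s a1 a2 d1 d2 \<kappa> \<alpha> \<eta> t n by (rule S)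
    have eqs: "F.info1 = i1" "F.info2 = i2" "F.info12 = i12" "F.pow1 = p1" "F.pow2 = p2"
      "F.rate_over = u" "F.rate_under = l"
      by (simp_all add: F.info1_def F.info2_def F.info12_def F.pow1_def F.pow2_def F.N'_def
          F.rate_over_def F.rate_under_def i1_def i2_def i12_def p1_def p2_def u_def l_def algebra_simps)
    obtain c where "good n c"
      using F.exists_code[of "M1 n" "M2 n" "D n" P1 P2, unfolded eqs, OF M_ge D_bound elim]
      unfolding good_def by blast
    then show ?case unfolding C_def by (rule someI)
  qed
  show ?thesis
    unfolding achievable_fb_def
  proof (intro allI impI exI[of _ C] conjI)
    fix \<delta> :: real assume \<delta>: "0 < \<delta>"
    show "eventually (\<lambda>n. valid_code (C n) n P1 P2 N s \<and> ln (real (nmsg1 (C n))) / real n > r1 - \<delta> \<and>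
            ln (real (nmsg2 (C n))) / real n > r2 - \<delta>) sequentially"
      using C eventually_gt_at_top[of 0]
    proof eventually_elim
      case (elim n)
      have "real n * r1 \<le> ln (real (M1 n))" "real n * r2 \<le> ln (real (M2 n))"
        using M1(1)[of n] M2(1)[of n] M_ge[of n] by (auto simp: ln_ge_iff)
      then have "r1 \<le> ln (real (M1 n)) / real n" "r2 \<le> ln (real (M2 n)) / real n"
        using elim(2) by (auto simp: field_simps)
      then show ?case using elim(1) \<delta> by (auto simp: good_def)
    qed
    show "(\<lambda>n. err_prob (C n) N s n) \<longlonglongrightarrow> 0"
    proof (rule tendsto_sandwich[OF _ _ tendsto_const D_lim])
      show "eventually (\<lambda>n. 0 \<le> err_prob (C n) N s n) sequentially"
        by (simp add: err_prob_def)
      show "eventually (\<lambda>n. err_prob (C n) N s n \<le> D n) sequentially"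
        using C by eventually_elim (simp add: good_def)
    qed
  qed
qed

text \<open>Scaling the four amplitudes by some \<open>l < 1\<close> close to 1 keeps the strict
  rate inequalities by continuity and makes the power inequalities strict. \<kappa> and \<alpha>
  stay fixed, so the effective noise and the orthogonality of the slots are unchanged.\<close>

lemma achievable_fb_scheme_boundary:
  fixes N s a1 a2 d1 d2 \<kappa> \<alpha> P1 P2 r1 r2 :: real
  assumes pos: "0 < N" "0 \<le> s" "0 < a1" "0 < a2" "0 < d1" "0 < d2" and r: "0 \<le> r1" "0 \<le> r2"
    and rate1: "2 * r1 < ln (1 + a1\<^sup>2 / N) / 2 + ln (1 + d1\<^sup>2 / (N + \<alpha>\<^sup>2 * s)) / 2"
    and rate2: "2 * r2 < ln (1 + a2\<^sup>2 / N) / 2 + ln (1 + d2\<^sup>2 / (N + \<alpha>\<^sup>2 * s)) / 2"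
    and rate12: "2 * (r1 + r2) < ln (1 + (a1\<^sup>2 + a2\<^sup>2) / N) / 2 +
      ln (1 + (\<kappa>\<^sup>2 * (a1\<^sup>2 + a2\<^sup>2) + d1\<^sup>2 + d2\<^sup>2) / (N + \<alpha>\<^sup>2 * s)) / 2"
    and pow1: "a1\<^sup>2 + (\<kappa> * a2)\<^sup>2 + d1\<^sup>2 \<le> 2 * P1"
    and pow2: "a2\<^sup>2 + (\<alpha> * a1)\<^sup>2 + (\<kappa> * a1 + \<alpha> * a2)\<^sup>2 + d2\<^sup>2 + \<alpha>\<^sup>2 * N + \<alpha>\<^sup>2 * s \<le> 2 * P2"
  shows "achievable_fb P1 P2 N s r1 r2"
proof -
  have N': "0 < N + \<alpha>\<^sup>2 * s" using pos by (simp add: add_pos_nonneg)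
  have nn: "0 \<le> a1\<^sup>2 / N" "0 \<le> a2\<^sup>2 / N" "0 \<le> (a1\<^sup>2 + a2\<^sup>2) / N" "0 \<le> d1\<^sup>2 / (N + \<alpha>\<^sup>2 * s)" "0 \<le> d2\<^sup>2 / (N + \<alpha>\<^sup>2 * s)"
    "0 \<le> (\<kappa>\<^sup>2 * (a1\<^sup>2 + a2\<^sup>2) + d1\<^sup>2 + d2\<^sup>2) / (N + \<alpha>\<^sup>2 * s)"
    using pos N' by auto
  have lim: "((\<lambda>l. ln (1 + l\<^sup>2 * x) / 2 + ln (1 + l\<^sup>2 * z) / 2) \<longlongrightarrow> ln (1 + 1\<^sup>2 * x) / 2 + ln (1 + 1\<^sup>2 * z) / 2) (at_left (1::real))"
    if "0 \<le> x" "0 \<le> z" for x z :: real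
    using that by (intro tendsto_intros) auto
  have "eventually (\<lambda>l. 2 * r1 < ln (1 + l\<^sup>2 * (a1\<^sup>2 / N)) / 2 + ln (1 + l\<^sup>2 * (d1\<^sup>2 / (N + \<alpha>\<^sup>2 * s))) / 2 \<and>
      2 * r2 < ln (1 + l\<^sup>2 * (a2\<^sup>2 / N)) / 2 + ln (1 + l\<^sup>2 * (d2\<^sup>2 / (N + \<alpha>\<^sup>2 * s))) / 2 \<and>
      2 * (r1 + r2) < ln (1 + l\<^sup>2 * ((a1\<^sup>2 + a2\<^sup>2) / N)) / 2 +
        ln (1 + l\<^sup>2 * ((\<kappa>\<^sup>2 * (a1\<^sup>2 + a2\<^sup>2) + d1\<^sup>2 + d2\<^sup>2) / (N + \<alpha>\<^sup>2 * s))) / 2 \<and> 0 < l \<and> l < 1) (at_left (1::real))"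
    using rate1 rate2 rate12 nn
    by (intro eventually_conj order_tendstoD(1)[OF lim])
       (auto simp: eventually_at_left[of 0] intro!: exI[of _ 0])
  then obtain l where l: "2 * r1 < ln (1 + l\<^sup>2 * (a1\<^sup>2 / N)) / 2 + ln (1 + l\<^sup>2 * (d1\<^sup>2 / (N + \<alpha>\<^sup>2 * s))) / 2"
      "2 * r2 < ln (1 + l\<^sup>2 * (a2\<^sup>2 / N)) / 2 + ln (1 + l\<^sup>2 * (d2\<^sup>2 / (N + \<alpha>\<^sup>2 * s))) / 2"
      "2 * (r1 + r2) < ln (1 + l\<^sup>2 * ((a1\<^sup>2 + a2\<^sup>2) / N)) / 2 +
        ln (1 + l\<^sup>2 * ((\<kappa>\<^sup>2 * (a1\<^sup>2 + a2\<^sup>2) + d1\<^sup>2 + d2\<^sup>2) / (N + \<alpha>\<^sup>2 * s))) / 2" "0 < l" "l < 1"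
    using eventually_happens'[OF trivial_limit_at_left_real] by blast
  have l2: "l\<^sup>2 < 1" using l(4,5) by (simp add: power_less_one_iff abs_square_less_1)
  show ?thesis
  proof (rule achievable_fb_scheme[of N s "l * a1" "l * a2" "l * d1" "l * d2" r1 r2 \<alpha> \<kappa> P1 P2])
    show "2 * r1 < ln (1 + (l * a1)\<^sup>2 / N) / 2 + ln (1 + (l * d1)\<^sup>2 / (N + \<alpha>\<^sup>2 * s)) / 2"
      using l(1) by (simp add: power_mult_distrib)
    show "2 * r2 < ln (1 + (l * a2)\<^sup>2 / N) / 2 + ln (1 + (l * d2)\<^sup>2 / (N + \<alpha>\<^sup>2 * s)) / 2"
      using l(2) by (simp add: power_mult_distrib)
    show "2 * (r1 + r2) < ln (1 + ((l * a1)\<^sup>2 + (l * a2)\<^sup>2) / N) / 2 +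
      ln (1 + (\<kappa>\<^sup>2 * ((l * a1)\<^sup>2 + (l * a2)\<^sup>2) + (l * d1)\<^sup>2 + (l * d2)\<^sup>2) / (N + \<alpha>\<^sup>2 * s)) / 2"
    proof -
      have "l\<^sup>2 * ((a1\<^sup>2 + a2\<^sup>2) / N) = ((l * a1)\<^sup>2 + (l * a2)\<^sup>2) / N"
        "l\<^sup>2 * ((\<kappa>\<^sup>2 * (a1\<^sup>2 + a2\<^sup>2) + d1\<^sup>2 + d2\<^sup>2) / (N + \<alpha>\<^sup>2 * s))
          = (\<kappa>\<^sup>2 * ((l * a1)\<^sup>2 + (l * a2)\<^sup>2) + (l * d1)\<^sup>2 + (l * d2)\<^sup>2) / (N + \<alpha>\<^sup>2 * s)"
        by (simp_all add: power_mult_distrib distrib_left mult_ac)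
      with l(3) show ?thesis by (simp only:)
    qed
    have scale: "l\<^sup>2 * x < x" if "0 < x" for x using l2 that by simp
    have "(l * a1)\<^sup>2 + (\<kappa> * (l * a2))\<^sup>2 + (l * d1)\<^sup>2 = l\<^sup>2 * (a1\<^sup>2 + (\<kappa> * a2)\<^sup>2 + d1\<^sup>2)"
      by (simp add: power_mult_distrib algebra_simps)
    also have "\<dots> < a1\<^sup>2 + (\<kappa> * a2)\<^sup>2 + d1\<^sup>2" using pos by (intro scale) (auto intro!: add_nonneg_pos)
    finally show "(l * a1)\<^sup>2 + (\<kappa> * (l * a2))\<^sup>2 + (l * d1)\<^sup>2 < 2 * P1" using pow1 by simp
    have "(l * a2)\<^sup>2 + (\<alpha> * (l * a1))\<^sup>2 + (\<kappa> * (l * a1) + \<alpha> * (l * a2))\<^sup>2 + (l * d2)\<^sup>2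
       = l\<^sup>2 * (a2\<^sup>2 + (\<alpha> * a1)\<^sup>2 + (\<kappa> * a1 + \<alpha> * a2)\<^sup>2 + d2\<^sup>2)"
      by (simp add: power2_eq_square algebra_simps)
    also have "\<dots> < a2\<^sup>2 + (\<alpha> * a1)\<^sup>2 + (\<kappa> * a1 + \<alpha> * a2)\<^sup>2 + d2\<^sup>2"
      using pos by (intro scale) (auto intro!: add_nonneg_pos)
    finally show "(l * a2)\<^sup>2 + (\<alpha> * (l * a1))\<^sup>2 + (\<kappa> * (l * a1) + \<alpha> * (l * a2))\<^sup>2 + (l * d2)\<^sup>2 + \<alpha>\<^sup>2 * N + \<alpha>\<^sup>2 * s < 2 * P2"
      using pow2 by simp
  qed (use pos r l in auto)
qed

text \<open>Half of \<delta> pays for the approximating pair, the other half for the code that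
  nearly attains it.\<close>

lemma achievable_fb_closed:
  assumes "\<And>\<delta>. 0 < \<delta> \<Longrightarrow> \<exists>r1 r2. R1 - \<delta> < r1 \<and> R2 - \<delta> < r2 \<and> achievable_fb P1 P2 N s r1 r2"
  shows "achievable_fb P1 P2 N s R1 R2"
  unfolding achievable_fb_def
proof (intro allI impI)
  fix \<delta> :: real assume "0 < \<delta>"
  then have "0 < \<delta> / 2" by simp
  from assms[OF this] obtain r1 r2 where r: "R1 - \<delta> / 2 < r1" "R2 - \<delta> / 2 < r2" and "achievable_fb P1 P2 N s r1 r2"
    by blast
  then obtain C where C: "eventually (\<lambda>n. valid_code (C n) n P1 P2 N s \<and> ln (real (nmsg1 (C n))) / real n > r1 - \<delta> / 2 \<and>
            ln (real (nmsg2 (C n))) / real n > r2 - \<delta> / 2) sequentially" "(\<lambda>n. err_prob (C n) N s n) \<longlonglongrightarrow> 0"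
    using \<open>0 < \<delta> / 2\<close> unfolding achievable_fb_def by blast
  have "eventually (\<lambda>n. valid_code (C n) n P1 P2 N s \<and> ln (real (nmsg1 (C n))) / real n > R1 - \<delta> \<and>
            ln (real (nmsg2 (C n))) / real n > R2 - \<delta>) sequentially"
    using C(1) by eventually_elim (use r in auto)
  with C(2) show "\<exists>C. eventually (\<lambda>n. valid_code (C n) n P1 P2 N s \<and> ln (real (nmsg1 (C n))) / real n > R1 - \<delta> \<and>
            ln (real (nmsg2 (C n))) / real n > R2 - \<delta>) sequentially \<and> (\<lambda>n. err_prob (C n) N s n) \<longlonglongrightarrow> 0"
    by blast
qed

section \<open>Inclusion of the region without feedback\<close>

lemma C_MAC_subset:
  fixes P1 P2 N s :: real
  assumes pos: "P1 > 0" "P2 > 0" "N > 0" "s \<ge> 0"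
  shows "C_MAC P1 P2 N \<subseteq> C_NoisyPartialFB P1 P2 N s"
proof
  fix R assume "R \<in> C_MAC P1 P2 N"
  then obtain R1 R2 where R: "R = (R1, R2)" "0 \<le> R1" "0 \<le> R2" "R1 \<le> 1/2 * ln (1 + P1 / N)"
    "R2 \<le> 1/2 * ln (1 + P2 / N)" "R1 + R2 \<le> 1/2 * ln (1 + (P1 + P2) / N)"
    unfolding C_MAC_def by auto
  have "achievable_fb P1 P2 N s R1 R2"
  proof (rule achievable_fb_closed)
    fix \<delta> :: real assume \<delta>: "0 < \<delta>"
    \<comment> \<open>Chosen so that 0 < e < 1 and both \<open>e * R1\<close> and
      \<open>e * R2\<close> are below \<delta>. Shrinking the rates by \<open>1 - e\<close> makes
      the region's inequalities strict; for a zero rate the strictness comes from the positive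
      right-hand side.\<close>
    define e where "e = \<delta> / (1 + \<delta> + R1 + R2)"
    have e: "0 < e" "e < 1" using \<delta> R by (auto simp: e_def field_simps)
    have "e * R1 < \<delta>" "e * R2 < \<delta>"
      using \<delta> R by (auto simp: e_def field_simps intro!: add_pos_nonneg)
    then have near: "R1 - \<delta> < (1 - e) * R1" "R2 - \<delta> < (1 - e) * R2" by (auto simp: algebra_simps)
    have below: "2 * ((1 - e) * x) < L" if "x \<le> 1/2 * L" "0 < L" for x L
    proof -
      have "2 * ((1 - e) * x) \<le> (1 - e) * L" using that e by (simp add: mult_left_mono)
      also have "\<dots> < L" using that e by (simp add: algebra_simps)
      finally show ?thesis .
    qed
    have lnpos: "0 < ln (1 + x / N)" if "0 < x" for x using that pos by (intro ln_gt_zero) simp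
    have "achievable_fb P1 P2 N s ((1 - e) * R1) ((1 - e) * R2)"
    proof (rule achievable_fb_scheme_boundary[of N s "sqrt P1" "sqrt P2" "sqrt P1" "sqrt P2" _ _ 0 0])
      show "2 * ((1 - e) * R1) < ln (1 + (sqrt P1)\<^sup>2 / N) / 2 + ln (1 + (sqrt P1)\<^sup>2 / (N + 0\<^sup>2 * s)) / 2"
        using below[OF R(4) lnpos] pos by simp
      show "2 * ((1 - e) * R2) < ln (1 + (sqrt P2)\<^sup>2 / N) / 2 + ln (1 + (sqrt P2)\<^sup>2 / (N + 0\<^sup>2 * s)) / 2"
        using below[OF R(5) lnpos] pos by simp
      show "2 * ((1 - e) * R1 + (1 - e) * R2) < ln (1 + ((sqrt P1)\<^sup>2 + (sqrt P2)\<^sup>2) / N) / 2 +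
          ln (1 + (0\<^sup>2 * ((sqrt P1)\<^sup>2 + (sqrt P2)\<^sup>2) + (sqrt P1)\<^sup>2 + (sqrt P2)\<^sup>2) / (N + 0\<^sup>2 * s)) / 2"
        using below[OF R(6) lnpos] pos by (simp add: distrib_left)
    qed (use pos R e in auto)
    with near show "\<exists>r1 r2. R1 - \<delta> < r1 \<and> R2 - \<delta> < r2 \<and> achievable_fb P1 P2 N s r1 r2" by blast
  qed
  then show "R \<in> C_NoisyPartialFB P1 P2 N s" using R by (simp add: C_NoisyPartialFB_def)
qed

section \<open>A rate pair beyond the sum bound\<close>

text \<open>The signals of the two users are correlated over the two slots of a block with opposite signs.
  Transmitter 2 then saves energy of order \<open>\<theta>\<^sup>3\<close> by adding \<open>\<theta>\<^sup>2\<close> times its feedback,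
  while the feedback noise costs only order \<open>\<theta>\<^sup>4\<close>.\<close>

lemma C_MAC_sum_rate_exceeded:
  fixes P1 P2 N s :: real
  assumes pos: "P1 > 0" "P2 > 0" "N > 0" "s \<ge> 0"
  obtains r1 r2 where "0 \<le> r1" "0 \<le> r2" "1/2 * ln (1 + (P1 + P2) / N) < r1 + r2" "achievable_fb P1 P2 N s r1 r2"
proof -
  define S where "S = P1 + P2 + N"
  define L where "L = ln (1 + (P1 + P2) / N)"
  have S: "0 < S" "1 + (P1 + P2) / N = S / N" using pos by (auto simp: S_def field_simps)
  \<comment> \<open>Energies left for fresh symbols in the second slot when \<alpha> = \<theta>^2
    and \<kappa> = - \<theta> sqrt (P1 / P2). User 1 spends \<theta>^2 P1 on its old symbol. User 2
    spends \<theta>^2 P1^2 / P2 - 2 \<theta>^3 P1 + \<theta>^4 (S + s) on old symbol and feedback;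
    the negative term is the saving.\<close>
  define e1 e2 where "e1 \<theta> = (1 - \<theta>\<^sup>2) * P1"
    and "e2 \<theta> = P2 + 2 * \<theta> ^ 3 * P1 - \<theta> ^ 4 * (S + s) - \<theta>\<^sup>2 * P1\<^sup>2 / P2" for \<theta>
  define j where "j \<theta> = (ln (1 + P1 / N) / 2 + ln (1 + e1 \<theta> / (N + (\<theta>\<^sup>2)\<^sup>2 * s)) / 2)
     + (ln (1 + P2 / N) / 2 + ln (1 + e2 \<theta> / (N + (\<theta>\<^sup>2)\<^sup>2 * s)) / 2)" for \<theta>
  \<comment> \<open>The single-user bounds add up to strictly more than the sum bound. By continuity
    this stays true for small \<theta>, so the individual scores may be suboptimal.\<close>
  have "ln (1 + (P1 + P2) / N) < ln ((1 + P1 / N) * (1 + P2 / N))"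
    using pos by (intro ln_less_cancel_iff[THEN iffD2]) (auto simp: field_simps add_pos_pos)
  also have "\<dots> = ln (1 + P1 / N) + ln (1 + P2 / N)"
    using pos by (intro ln_mult_pos) (auto simp: add_pos_pos)
  finally have L_less: "L < ln (1 + P1 / N) + ln (1 + P2 / N)" by (simp add: L_def)
  have lim_e: "(e1 \<longlongrightarrow> (1 - 0\<^sup>2) * P1) (at_right 0)"
    "(e2 \<longlongrightarrow> P2 + 2 * 0 ^ 3 * P1 - 0 ^ 4 * (S + s) - 0\<^sup>2 * P1\<^sup>2 / P2) (at_right 0)"
    unfolding e1_def e2_def using pos by (intro tendsto_intros; simp)+
  have "(j \<longlongrightarrow> (ln (1 + P1 / N) / 2 + ln (1 + ((1 - 0\<^sup>2) * P1) / (N + (0\<^sup>2)\<^sup>2 * s)) / 2)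
     + (ln (1 + P2 / N) / 2 + ln (1 + (P2 + 2 * 0 ^ 3 * P1 - 0 ^ 4 * (S + s) - 0\<^sup>2 * P1\<^sup>2 / P2) / (N + (0\<^sup>2)\<^sup>2 * s)) / 2)) (at_right 0)"
  proof -
    have "0 < 1 + P1 / N" "0 < 1 + P2 / N" using pos by (auto intro!: add_pos_pos)
    then show ?thesis unfolding j_def using pos by (intro tendsto_intros lim_e) auto
  qed
  then have lim_j: "(j \<longlongrightarrow> ln (1 + P1 / N) + ln (1 + P2 / N)) (at_right 0)" by simp
  have "((\<lambda>\<theta>. \<theta> * (S * (N + s))) \<longlongrightarrow> 0 * (S * (N + s))) (at_right 0)" by (intro tendsto_intros)
  then have lim_3: "((\<lambda>\<theta>. \<theta> * (S * (N + s))) \<longlongrightarrow> 0) (at_right 0)" by simp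
  have "eventually (\<lambda>\<theta>. 0 < e1 \<theta> \<and> 0 < e2 \<theta> \<and> L < j \<theta> \<and> \<theta> * (S * (N + s)) < 2 * N * P1 \<and> 0 < \<theta>) (at_right 0)"
    using lim_e pos
    by (intro eventually_conj order_tendstoD(1)[OF lim_j L_less] order_tendstoD(2)[OF lim_3])
       (auto intro!: order_tendstoD(1) simp: eventually_at_right_less)
  then obtain \<theta> where \<theta>: "0 < e1 \<theta>" "0 < e2 \<theta>" "L < j \<theta>" "\<theta> * (S * (N + s)) < 2 * N * P1" "0 < \<theta>"
    using eventually_happens'[OF trivial_limit_at_right_real] by blast
  define \<kappa> where "\<kappa> = - \<theta> * sqrt P1 / sqrt P2"
  have k2: "\<kappa>\<^sup>2 = \<theta>\<^sup>2 * P1 / P2" using pos by (simp add: \<kappa>_def power_mult_distrib power_divide)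
  have k: "\<kappa> * sqrt P2 = - \<theta> * sqrt P1" "\<kappa> * sqrt P1 = - \<theta> * P1 / sqrt P2"
    using pos by (auto simp: \<kappa>_def mult.assoc)
  have N': "0 < N + (\<theta>\<^sup>2)\<^sup>2 * s" using pos by (simp add: add_pos_nonneg)
  define i1 where "i1 = ln (1 + P1 / N) / 2 + ln (1 + e1 \<theta> / (N + (\<theta>\<^sup>2)\<^sup>2 * s)) / 2"
  define i2 where "i2 = ln (1 + P2 / N) / 2 + ln (1 + e2 \<theta> / (N + (\<theta>\<^sup>2)\<^sup>2 * s)) / 2"
  define i12 where "i12 = ln (1 + (P1 + P2) / N) / 2 + ln (1 + (\<kappa>\<^sup>2 * (P1 + P2) + e1 \<theta> + e2 \<theta>) / (N + (\<theta>\<^sup>2)\<^sup>2 * s)) / 2"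
  have i_pos: "0 < i1" "0 < i2" using pos \<theta> N' by (auto simp: i1_def i2_def intro!: add_pos_pos ln_gt_zero)
  have j: "j \<theta> = i1 + i2" by (simp add: j_def i1_def i2_def)
  \<comment> \<open>The second-order terms cancel: what the users pay for correlation returns as
    \<kappa>^2 (P1 + P2).\<close>
  have sum_e: "\<kappa>\<^sup>2 * (P1 + P2) + e1 \<theta> + e2 \<theta> = P1 + P2 + 2 * \<theta> ^ 3 * P1 - \<theta> ^ 4 * (S + s)"
    unfolding k2 e1_def e2_def using pos by (simp add: field_simps power2_eq_square)
  have "L < i12"
  proof -
    \<comment> \<open>After cross-multiplication the gain 2 \<theta>^3 P1 N has to exceed the loss
      \<theta>^4 S (N + s) from feedback energy and feedback noise. This is the smallness condition
      imposed on \<theta>.\<close>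
    have "S / N < (S + 2 * \<theta> ^ 3 * P1 - \<theta> ^ 4 * S) / (N + (\<theta>\<^sup>2)\<^sup>2 * s)"
    proof -
      have "\<theta> ^ 3 * (\<theta> * (S * (N + s))) < \<theta> ^ 3 * (2 * N * P1)"
        using \<theta>(4,5) by (intro mult_strict_left_mono) auto
      then have "S * (N + (\<theta>\<^sup>2)\<^sup>2 * s) < (S + 2 * \<theta> ^ 3 * P1 - \<theta> ^ 4 * S) * N"
        by (simp add: algebra_simps power2_eq_square eval_nat_numeral)
      then show ?thesis using pos N' by (simp add: frac_less_eq frac_less pos_divide_less_eq pos_less_divide_eq divide_simps)
    qed
    also have "\<dots> = 1 + (\<kappa>\<^sup>2 * (P1 + P2) + e1 \<theta> + e2 \<theta>) / (N + (\<theta>\<^sup>2)\<^sup>2 * s)"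
    proof -
      have "S + 2 * \<theta> ^ 3 * P1 - \<theta> ^ 4 * S = (N + (\<theta>\<^sup>2)\<^sup>2 * s) + (\<kappa>\<^sup>2 * (P1 + P2) + e1 \<theta> + e2 \<theta>)"
        unfolding sum_e by (simp add: S_def algebra_simps power2_eq_square eval_nat_numeral)
      then show ?thesis using N' by (simp add: add_divide_distrib)
    qed
    finally have "ln (S / N) < ln (1 + (\<kappa>\<^sup>2 * (P1 + P2) + e1 \<theta> + e2 \<theta>) / (N + (\<theta>\<^sup>2)\<^sup>2 * s))"
      using S pos by (subst ln_less_cancel_iff) (auto intro: less_trans[of 0 "S / N"])
    then show ?thesis by (simp add: i12_def L_def S(2))
  qed
  with \<theta>(3) obtain T where T: "L < T" "T < i12" "T < i1 + i2"
    using dense[of L "min i12 (i1 + i2)"] by (auto simp: j)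
  have L0: "0 < L" unfolding L_def using pos by (intro ln_gt_zero) simp
  \<comment> \<open>Splitting \<open>T / 2\<close> in the ratio of \<open>i1\<close> to
    \<open>i2\<close> meets both individual bounds at once, because
    \<open>T < i1 + i2\<close>.\<close>
  define r1 r2 where "r1 = T / 2 * (i1 / (i1 + i2))" and "r2 = T / 2 * (i2 / (i1 + i2))"
  have "r1 + r2 = T / 2 * ((i1 + i2) / (i1 + i2))"
    by (simp only: r1_def r2_def add_divide_distrib distrib_left)
  then have sum_r: "r1 + r2 = T / 2" using i_pos by simp
  have r_less: "2 * r1 < i1" "2 * r2 < i2"
    using T(3) i_pos by (auto simp: r1_def r2_def pos_divide_less_eq)
  have r_nonneg: "0 \<le> r1" "0 \<le> r2" using T(1) L0 i_pos by (auto simp: r1_def r2_def)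
  have "achievable_fb P1 P2 N s r1 r2"
  proof (rule achievable_fb_scheme_boundary[of N s "sqrt P1" "sqrt P2" "sqrt (e1 \<theta>)" "sqrt (e2 \<theta>)" _ _ "\<theta>\<^sup>2" \<kappa>])
    show "2 * r1 < ln (1 + (sqrt P1)\<^sup>2 / N) / 2 + ln (1 + (sqrt (e1 \<theta>))\<^sup>2 / (N + (\<theta>\<^sup>2)\<^sup>2 * s)) / 2"
      using r_less pos \<theta> by (simp add: i1_def)
    show "2 * r2 < ln (1 + (sqrt P2)\<^sup>2 / N) / 2 + ln (1 + (sqrt (e2 \<theta>))\<^sup>2 / (N + (\<theta>\<^sup>2)\<^sup>2 * s)) / 2"
      using r_less pos \<theta> by (simp add: i2_def)
    show "2 * (r1 + r2) < ln (1 + ((sqrt P1)\<^sup>2 + (sqrt P2)\<^sup>2) / N) / 2 +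
        ln (1 + (\<kappa>\<^sup>2 * ((sqrt P1)\<^sup>2 + (sqrt P2)\<^sup>2) + (sqrt (e1 \<theta>))\<^sup>2 + (sqrt (e2 \<theta>))\<^sup>2) / (N + (\<theta>\<^sup>2)\<^sup>2 * s)) / 2"
      unfolding sum_r using T pos \<theta> by (simp add: i12_def)
    show "(sqrt P1)\<^sup>2 + (\<kappa> * sqrt P2)\<^sup>2 + (sqrt (e1 \<theta>))\<^sup>2 \<le> 2 * P1"
      unfolding k using pos \<theta> by (simp add: power_mult_distrib) (simp add: e1_def algebra_simps)
    have "(\<kappa> * sqrt P1 + \<theta>\<^sup>2 * sqrt P2)\<^sup>2 = \<theta>\<^sup>2 * P1\<^sup>2 / P2 - 2 * \<theta> ^ 3 * P1 + \<theta> ^ 4 * P2"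
    proof -
      have "(\<kappa> * sqrt P1 + \<theta>\<^sup>2 * sqrt P2)\<^sup>2
         = \<kappa>\<^sup>2 * (sqrt P1)\<^sup>2 + 2 * (\<kappa> * sqrt P2) * (\<theta>\<^sup>2 * sqrt P1) + (\<theta>\<^sup>2)\<^sup>2 * (sqrt P2)\<^sup>2"
        by (simp add: power2_eq_square algebra_simps)
      also have "2 * (\<kappa> * sqrt P2) * (\<theta>\<^sup>2 * sqrt P1) = - 2 * \<theta> ^ 3 * (sqrt P1)\<^sup>2"
        unfolding k by (simp add: power2_eq_square eval_nat_numeral)
      finally show ?thesis unfolding k2 using pos by (simp add: power2_eq_square eval_nat_numeral)
    qed
    then show "(sqrt P2)\<^sup>2 + (\<theta>\<^sup>2 * sqrt P1)\<^sup>2 + (\<kappa> * sqrt P1 + \<theta>\<^sup>2 * sqrt P2)\<^sup>2 + (sqrt (e2 \<theta>))\<^sup>2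
        + (\<theta>\<^sup>2)\<^sup>2 * N + (\<theta>\<^sup>2)\<^sup>2 * s \<le> 2 * P2"
      using pos \<theta> by (simp add: power_mult_distrib)
        (simp add: e2_def S_def algebra_simps flip: power_mult)
  qed (use pos \<theta> r_nonneg in auto)
  then show thesis using that[of r1 r2] r_nonneg sum_r T(1) by (simp add: L_def)
qed

theorem mainTheorem9:
  fixes P1 P2 N s :: real
  assumes "P1 > 0" and "P2 > 0" and "N > 0" and "s \<ge> 0"
  shows "C_MAC P1 P2 N \<subset> C_NoisyPartialFB P1 P2 N s"
proof -
  obtain r1 r2 where r: "0 \<le> r1" "0 \<le> r2" "1/2 * ln (1 + (P1 + P2) / N) < r1 + r2" "achievable_fb P1 P2 N s r1 r2"
    using C_MAC_sum_rate_exceeded[OF assms] by blast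
  then have "(r1, r2) \<in> C_NoisyPartialFB P1 P2 N s" "(r1, r2) \<notin> C_MAC P1 P2 N"
    by (auto simp: C_NoisyPartialFB_def C_MAC_def)
  then show ?thesis using C_MAC_subset[OF assms] by blast
qed

end
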